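(* Let $T_1,\dots,T_m$ be a fixed family of invertible real $d\times d$ matrices with $\|T_j\|<1$ for $1\le j\le m$, let $\Sigma=\{1,\dots,m\}^{\mathbb N}$, and for $\mathbf a=(a_1,\dots,a_m)\in\mathbb R^{dm}$ let $\pi^{\mathbf a}:\Sigma\to\mathbb R^d$ be the coding map of the affine iterated function system $\{T_jx+a_j\}_{j=1}^m$. Let $0<\theta\le 1$ and let $E\subset\Sigma$ be non-empty. Then the following hold. (i) For all $\mathbf a\in\mathbb R^{dm}$, $$\underline{\dim}_{\theta}\,\pi^{\mathbf a}(E)\le \underline{\dim}_{\mathrm C,\theta}E\quad\text{and}\quad \overline{\dim}_{\theta}\,\pi^{\mathbf a}(E)\le \overline{\dim}_{\mathrm C,\theta}E .$$ (ii) Assume $\|T_j\|<1/2$ for $1\le j\le m$. Then for $\mathcal L^{dm}$-a.e. $\mathbf a\in\mathbb R^{dm}$, $$\underline{\dim}_{\theta}\,\pi^{\mathbf a}(E)= \underline{\dim}_{\mathrm C,\theta}E\quad\text{and}\quad \overline{\dim}_{\theta}\,\pi^{\mathbf a}(E)= \overline{\dim}_{\mathrm C,\theta}E .$$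
   Context: $\|\cdot\|$ is the operator norm induced by the Euclidean norm; $\mathcal L^{dm}$ is Lebesgue measure on $\mathbb R^{dm}$; $|U|$ is the diameter of $U\subset\mathbb R^d$. Coding map: with $f^{\mathbf a}_j(x)=T_jx+a_j$, $\pi^{\mathbf a}(\mathbf i)=\lim_{n\to\infty} f^{\mathbf a}_{i_1}\circ\cdots\circ f^{\mathbf a}_{i_n}(0)$ for $\mathbf i=i_1i_2\ldots\in\Sigma$. Intermediate dimensions: for a non-empty bounded set $F\subset\mathbb R^d$ and $0<\theta\le1$, the upper $\theta$-intermediate dimension $\overline{\dim}_\theta F$ is the infimum of all $s\ge0$ such that for all $\varepsilon>0$ there exists $r_0\in(0,1]$ such that for all $r\in(0,r_0)$ there is a cover $\{U_i\}$ of $F$ with $r^{1/\theta}\le|U_i|\le r$ for all $i$ and $\sum_i|U_i|^s\le\varepsilon$. The lower $\theta$-intermediate dimension $\underline{\dim}_\theta F$ is the infimum of all $s\ge0$ such that for all $\varepsilon>0$ and all $r_0\in(0,1]$ there exist $r\in(0,r_0)$ and a cover $\{U_i\}$ of $F$ with $r^{1/\theta}\le|U_i|\le r$ for all $i$ and $\sum_i|U_i|^s\le\varepsilon$. Symbolic space: $x\wedge y$ is the common initial segment of $x,y\in\Sigma$; $\Sigma$ carries the metric $d(x,y)=\exp(-|x\wedge y|)$, where $|I|$ is the length of a word $I$. For a finite word $I=i_1\cdots i_n$, $T_I=T_{i_1}\cdots T_{i_n}$, and $T_\varnothing$ is the identity. $\alpha_1(T)\ge\dots\ge\alpha_d(T)$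 are the singular values of $T$. Kernels: for $r>0$, $Z_r(x\wedge y)=\prod_{k=1}^d\min\{1,\ r/\alpha_k(T_{x\wedge y})\}$ if $x\ne y$, and $Z_r(x\wedge y)=1$ if $x=y$. For $0\le s\le d$, $0<\theta\le1$ and $0<r\le 1$, $J^s_{\theta,r}(x\wedge y)=\max_{r^{1/\theta}\le u\le r}u^{-s}Z_u(x\wedge y)$. Capacities: for compact $E\subset\Sigma$, with $\mathcal P(E)$ the set of Borel probability measures supported on $E$, $$C^s_{\theta,r}(E)=\Big(\inf_{\mu\in\mathcal P(E)}\iint J^s_{\theta,r}(x\wedge y)\,d\mu(x)\,d\mu(y)\Big)^{-1},$$ and $C^s_{\theta,r}(E):=C^s_{\theta,r}(\overline E)$ for non-compact $E$. Capacity dimensions: $\underline{\dim}_{\mathrm C,\theta}E$ is the unique $s\in[0,d]$ such that $\liminf_{r\to0}\frac{\log C^s_{\theta,r}(E)}{-\log r}=0$, and $\overline{\dim}_{\mathrm C,\theta}E$ is the unique $s\in[0,d]$ such that $\limsup_{r\to0}\frac{\log C^s_{\theta,r}(E)}{-\log r}=0$ (existence and uniqueness are known). *)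

theory Defs
  imports "HOL-Probability.Probability" "HOL-Computational_Algebra.Polynomial"
begin

text \<open>
  The alphabet \<open>{1,\<dots>,m}\<close> is a finite type \<open>'m\<close>, so that \<open>m = CARD('m)\<close>, the sequence space
  \<open>\<Sigma>\<close> is \<open>nat \<Rightarrow> 'm\<close> (positions counted from 0), and a translation vector
  \<open>(a\<^sub>1,\<dots>,a\<^sub>m)\<close> with entries in \<open>d\<close>-dimensional space is an element of \<open>real^'d^'m\<close>.
\<close>


section \<open>Singular values\<close>

definition charpoly :: "real^'d^'d \<Rightarrow> real poly" where
  "charpoly A = det (\<chi> i j. (if i = j then [:0, 1:] else 0) - [:A $ i $ j:])"

text \<open>
  Square roots of the eigenvalues of the transpose of \<open>A\<close> times \<open>A\<close>, repeated according to
  multiplicity, in decreasing order; \<open>singular_value k A\<close> is meant for \<open>1 \<le> k \<le> CARD('d)\<close>.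
\<close>
definition singular_values :: "real^'d^'d \<Rightarrow> real list" where
  "singular_values A =
     rev (sorted_list_of_multiset (image_mset sqrt (proots (charpoly (transpose A ** A)))))"

definition singular_value :: "nat \<Rightarrow> real^'d^'d \<Rightarrow> real" where
  "singular_value k A = singular_values A ! (k - 1)"


section \<open>Symbolic space\<close>

text \<open>The word \<open>x \<and> y\<close>; only meaningful for \<open>x \<noteq> y\<close>.\<close>
definition common_prefix :: "(nat \<Rightarrow> 'm) \<Rightarrow> (nat \<Rightarrow> 'm) \<Rightarrow> 'm list" where
  "common_prefix x y = map x [0..<(LEAST n. x n \<noteq> y n)]"

definition seq_dist :: "(nat \<Rightarrow> 'm) \<Rightarrow> (nat \<Rightarrow> 'm) \<Rightarrow> real" where
  "seq_dist x y = (if x = y then 0 else exp (- real (length (common_prefix x y))))"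

lemma Metric_space_seq_dist: "Metric_space UNIV (seq_dist :: (nat \<Rightarrow> 'm) \<Rightarrow> _)"
proof
  fix x y z :: "nat \<Rightarrow> 'm"
  show "0 \<le> seq_dist x y"
    by (simp add: seq_dist_def)
  show "seq_dist x y = seq_dist y x"
  proof -
    have "(\<lambda>n. x n \<noteq> y n) = (\<lambda>n. y n \<noteq> x n)" by (rule ext) auto
    then show ?thesis by (auto simp: seq_dist_def common_prefix_def)
  qed
  show "seq_dist x y = 0 \<longleftrightarrow> x = y"
    by (simp add: seq_dist_def)
  show "seq_dist x z \<le> seq_dist x y + seq_dist y z"
  proof (cases "x = y \<or> y = z \<or> x = z")
    case True
    then show ?thesis by (auto simp: seq_dist_def)
  next
    case False
    let ?L = "\<lambda>x y :: nat \<Rightarrow> 'm. LEAST n. x n \<noteq> y n"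
    obtain n where "x n \<noteq> z n"
      using False by blast
    then have "x (?L x z) \<noteq> z (?L x z)"
      by (rule LeastI)
    then have "x (?L x z) \<noteq> y (?L x z) \<or> y (?L x z) \<noteq> z (?L x z)"
      by auto
    then have "?L x y \<le> ?L x z \<or> ?L y z \<le> ?L x z"
      by (auto intro: Least_le)
    then have "exp (- real (?L x z)) \<le> exp (- real (?L x y)) + exp (- real (?L y z))"
    proof
      assume "?L x y \<le> ?L x z"
      then have "exp (- real (?L x z)) \<le> exp (- real (?L x y))" by simp
      then show ?thesis by (rule order_trans) simp
    next
      assume "?L y z \<le> ?L x z"
      then have "exp (- real (?L x z)) \<le> exp (- real (?L y z))" by simp
      then show ?thesis by (rule order_trans) simp
    qed
    then show ?thesis
      using False by (simp add: seq_dist_def common_prefix_def)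
  qed
qed

definition seq_topology :: "(nat \<Rightarrow> 'm) topology" where
  "seq_topology = Metric_space.mtopology UNIV seq_dist"

definition seq_borel :: "(nat \<Rightarrow> 'm) measure" where
  "seq_borel = sigma UNIV {U. openin seq_topology U}"

text \<open>To be used for compact \<open>E\<close>, which is Borel.\<close>
definition prob_measures_on :: "(nat \<Rightarrow> 'm) set \<Rightarrow> (nat \<Rightarrow> 'm) measure set" where
  "prob_measures_on E = {\<mu>. prob_space \<mu> \<and> sets \<mu> = sets seq_borel \<and> measure \<mu> E = 1}"

definition matrix_word :: "('m \<Rightarrow> real^'d^'d) \<Rightarrow> 'm list \<Rightarrow> real^'d^'d" where
  "matrix_word T I = foldr (\<lambda>j M. T j ** M) I (mat 1)"


section \<open>Coding map\<close>

definition ifs_map ::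
  "('m \<Rightarrow> real^'d^'d) \<Rightarrow> real^'d^'m \<Rightarrow> 'm \<Rightarrow> real^'d \<Rightarrow> real^'d" where
  "ifs_map T a j x = T j *v x + a $ j"

definition coding_map ::
  "('m \<Rightarrow> real^'d^'d) \<Rightarrow> real^'d^'m \<Rightarrow> (nat \<Rightarrow> 'm) \<Rightarrow> real^'d" where
  "coding_map T a i = lim (\<lambda>n. foldr (ifs_map T a) (map i [0..<n]) 0)"


section \<open>Intermediate dimensions\<close>

text \<open>
  Boundedness of the covering sets is required explicitly since \<open>diameter\<close> is unspecified on
  unbounded sets. The sum over the cover is taken in the extended nonnegative reals, so that it
  is \<open>\<infinity>\<close> when it diverges.
\<close>
definition admissible_cover ::
  "real \<Rightarrow> real \<Rightarrow> 'a::metric_space set \<Rightarrow> 'a set set \<Rightarrow> bool" where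
  "admissible_cover \<theta> r F \<U> \<longleftrightarrow>
     countable \<U> \<and> F \<subseteq> \<Union>\<U> \<and>
     (\<forall>U\<in>\<U>. bounded U \<and> r powr (1 / \<theta>) \<le> diameter U \<and> diameter U \<le> r)"

definition cover_sum :: "real \<Rightarrow> 'a::metric_space set set \<Rightarrow> ennreal" where
  "cover_sum s \<U> = (\<Sum>\<^sub>\<infinity>U\<in>\<U>. ennreal (diameter U powr s))"

definition upper_intermediate_dim :: "real \<Rightarrow> 'a::metric_space set \<Rightarrow> real" where
  "upper_intermediate_dim \<theta> F =
     Inf {s. 0 \<le> s \<and>
       (\<forall>\<epsilon>>0. \<exists>r0\<in>{0<..1}. \<forall>r\<in>{0<..<r0}. \<exists>\<U>.
          admissible_cover \<theta> r F \<U> \<and> cover_sum s \<U> \<le> ennreal \<epsilon>)}"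

definition lower_intermediate_dim :: "real \<Rightarrow> 'a::metric_space set \<Rightarrow> real" where
  "lower_intermediate_dim \<theta> F =
     Inf {s. 0 \<le> s \<and>
       (\<forall>\<epsilon>>0. \<forall>r0\<in>{0<..1}. \<exists>r\<in>{0<..<r0}. \<exists>\<U>.
          admissible_cover \<theta> r F \<U> \<and> cover_sum s \<U> \<le> ennreal \<epsilon>)}"


section \<open>Kernels, capacities and capacity dimensions\<close>

definition Z_kernel ::
  "('m \<Rightarrow> real^'d^'d) \<Rightarrow> real \<Rightarrow> (nat \<Rightarrow> 'm) \<Rightarrow> (nat \<Rightarrow> 'm) \<Rightarrow> real" where
  "Z_kernel T r x y =
     (if x = y then 1
      else \<Prod>k=1..CARD('d). min 1 (r / singular_value k (matrix_word T (common_prefix x y))))"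

text \<open>The supremum is a maximum: a continuous function of \<open>u\<close> on a compact interval.\<close>
definition J_kernel ::
  "('m \<Rightarrow> real^'d^'d) \<Rightarrow> real \<Rightarrow> real \<Rightarrow> real \<Rightarrow> (nat \<Rightarrow> 'm) \<Rightarrow> (nat \<Rightarrow> 'm) \<Rightarrow> real" where
  "J_kernel T \<theta> s r x y = (SUP u\<in>{r powr (1 / \<theta>)..r}. u powr (- s) * Z_kernel T u x y)"

definition energy ::
  "('m \<Rightarrow> real^'d^'d) \<Rightarrow> real \<Rightarrow> real \<Rightarrow> real \<Rightarrow> (nat \<Rightarrow> 'm) measure \<Rightarrow> real" where
  "energy T \<theta> s r \<mu> = (\<integral>y. (\<integral>x. J_kernel T \<theta> s r x y \<partial>\<mu>) \<partial>\<mu>)"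

definition compact_capacity ::
  "('m \<Rightarrow> real^'d^'d) \<Rightarrow> real \<Rightarrow> real \<Rightarrow> real \<Rightarrow> (nat \<Rightarrow> 'm) set \<Rightarrow> real" where
  "compact_capacity T \<theta> s r E = inverse (INF \<mu>\<in>prob_measures_on E. energy T \<theta> s r \<mu>)"

definition capacity ::
  "('m \<Rightarrow> real^'d^'d) \<Rightarrow> real \<Rightarrow> real \<Rightarrow> real \<Rightarrow> (nat \<Rightarrow> 'm) set \<Rightarrow> real" where
  "capacity T \<theta> s r E =
     (if compactin seq_topology E then compact_capacity T \<theta> s r E
      else compact_capacity T \<theta> s r (seq_topology closure_of E))"

definition lower_capacity_dim ::
  "('m \<Rightarrow> real^'d^'d) \<Rightarrow> real \<Rightarrow> (nat \<Rightarrow> 'm) set \<Rightarrow> real" where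
  "lower_capacity_dim T \<theta> E =
     (THE s. 0 \<le> s \<and> s \<le> real CARD('d) \<and>
        Liminf (at_right 0) (\<lambda>r. ereal (ln (capacity T \<theta> s r E) / - ln r)) = 0)"

definition upper_capacity_dim ::
  "('m \<Rightarrow> real^'d^'d) \<Rightarrow> real \<Rightarrow> (nat \<Rightarrow> 'm) set \<Rightarrow> real" where
  "upper_capacity_dim T \<theta> E =
     (THE s. 0 \<le> s \<and> s \<le> real CARD('d) \<and>
        Limsup (at_right 0) (\<lambda>r. ereal (ln (capacity T \<theta> s r E) / - ln r)) = 0)"

end

theory Submission
  imports Defs
begin

text \<open>
  Write \<open>\<pi>\<close> for the coding map. The image of the cylinder of a word \<open>I\<close> lies in a translate of
  \<open>T\<^sub>I\<close> applied to a fixed ball, an ellipsoid whose semi-axes are comparable to the singular values of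
  \<open>T\<^sub>I\<close>. It can be covered by about \<open>1 / Z\<^sub>u(I)\<close> sets of diameter \<open>u\<close>, each of cost \<open>u\<^sup>s\<close>. Choosing
  the best \<open>u\<close> in the window \<open>[r\<^bsup>1/\<theta>\<^esup>, r]\<close>, the cylinder costs about \<open>1 / J(I)\<close>, where
  \<open>J = J\<^sup>s\<^bsub>\<theta>,r\<^esub>\<close>.

  All estimates take place at a finite level: \<open>J\<close> depends only on the first \<open>N\<close> letters of its
  arguments, where \<open>N\<close> is of order \<open>log (1/r)\<close>. Hence the capacity is the inverse of the minimum of a
  quadratic form over finitely supported probability weights on \<open>E\<close> itself (\<open>capacity_eq\<close>), and
  neither the closure of \<open>E\<close> nor measures on the sequence space occur in the rest of the proof. The
  minimal energy grows in \<open>s\<close> like a power of \<open>r\<close> with exponent between \<open>-1\<close> and \<open>-1/\<theta>\<close> times the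
  increment. Therefore the exponents that define the capacity dimensions vanish exactly once
  (\<open>steep_function_zero\<close>), and being above or below a capacity dimension means that the minimal energy
  beats a power \<open>r\<^bsup>-\<delta>\<^esup>\<close> or \<open>r\<^bsup>\<delta>\<^esup>\<close>, for all small \<open>r\<close> or for arbitrarily small ones.

  Upper bound. Covering \<open>E\<close> by cylinders at cost \<open>\<Sum> 1 / J(I)\<close> is the problem of finding a cheap cut of
  the tree of prefixes. A cut and a flow of at least the same mass, which sends at most \<open>1 / J(I)\<close> through
  each word \<open>I\<close>, exist together (\<open>tree_flow\<close>). In the energy of the flow each of the \<open>N + 1\<close> levels
  contributes at most the total mass, so after normalisation the cost of the cut is at most \<open>N + 1\<close> times
  the capacity (\<open>cheap_cut\<close>). The factor \<open>N + 1\<close> is logarithmic and invisible for dimensions.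

  Lower bound. If the norms are less than \<open>1/2\<close>, then the set of \<open>a\<close> in a ball with
  \<open>|\<pi>(x) - \<pi>(y)| \<le> u\<close> has measure at most a constant times \<open>Z\<^sub>u(x \<and> y)\<close> (\<open>transversality\<close>). Averaging
  over \<open>a\<close>, weights of nearly minimal energy have a small potential
  \<open>\<Sum> p(x) p(y) u\<^bsup>-s\<^esup> 1{|\<pi>(x) - \<pi>(y)| \<le> u}\<close>, summed over dyadic scales \<open>u\<close>, and along a sequence of
  \<open>r\<close> that decreases geometrically these potentials tend to zero for almost every \<open>a\<close>. By the
  Cauchy-Schwarz inequality a small potential forces every cover to have a large sum
  (\<open>cover_sum_lower_bound\<close>).
\<close>


section \<open>Singular value decomposition\<close>

lemma symmetric_matrix_inner:
  fixes S :: "real^'n^'n"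
  assumes "transpose S = S"
  shows "x \<bullet> (S *v y) = (S *v x) \<bullet> y"
  by (metis assms dot_lmul_matrix transpose_matrix_vector)

text \<open>
  Maximise the Rayleigh quotient \<open>x \<bullet> S x\<close> over unit vectors orthogonal to \<open>B\<close>. The first variation at a
  maximum \<open>v\<close> shows that \<open>S v\<close> is orthogonal to everything orthogonal to \<open>B\<close> and \<open>v\<close>; since \<open>S\<close> also
  preserves the orthogonal complement of \<open>B\<close>, the vector \<open>S v\<close> is a multiple of \<open>v\<close>.
\<close>
lemma symmetric_matrix_further_eigenvector:
  fixes S :: "real^'n^'n"
  assumes sym: "transpose S = S" and fin: "finite B" and card: "card B < CARD('n)"
    and eig: "\<And>b. b \<in> B \<Longrightarrow> \<exists>\<mu>. S *v b = \<mu> *\<^sub>R b"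
  obtains v \<mu> where "norm v = 1" "\<And>b. b \<in> B \<Longrightarrow> b \<bullet> v = 0" "S *v v = \<mu> *\<^sub>R v"
proof -
  define K where "K = sphere (0::real^'n) 1 \<inter> (\<Inter>b\<in>B. {x. b \<bullet> x = 0})"
  have "compact K"
    unfolding K_def by (intro compact_Int_closed compact_sphere closed_INT ballI closed_hyperplane)
  have "dim B < DIM(real^'n)"
    using dim_le_card'[OF fin] card by simp
  then obtain x where x: "x \<noteq> 0" "\<And>y. y \<in> span B \<Longrightarrow> orthogonal x y"
    using orthogonal_to_subspace_exists by blast
  have "sgn x \<in> K"
    using x by (auto simp: K_def norm_sgn sgn_div_norm orthogonal_def span_base inner_commute)
  then have "K \<noteq> {}" by blast
  have "continuous_on K (\<lambda>x. x \<bullet> (S *v x))"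
    by (intro continuous_intros matrix_vector_mult_linear_continuous_on)
  then obtain v where v: "v \<in> K" and vmax: "\<And>y. y \<in> K \<Longrightarrow> y \<bullet> (S *v y) \<le> v \<bullet> (S *v v)"
    using continuous_attains_sup[OF \<open>compact K\<close> \<open>K \<noteq> {}\<close>] by blast
  define \<mu> where "\<mu> = v \<bullet> (S *v v)"
  have v1: "norm v = 1" "v \<bullet> v = 1" and vB: "\<And>b. b \<in> B \<Longrightarrow> b \<bullet> v = 0"
    using v by (auto simp: K_def dot_square_norm)
  have rayleigh: "w \<bullet> (S *v w) \<le> \<mu> * (w \<bullet> w)" if "\<And>b. b \<in> B \<Longrightarrow> b \<bullet> w = 0" for w
  proof (cases "w = 0")
    case False
    then have "sgn w \<in> K"
      using that by (auto simp: K_def norm_sgn sgn_div_norm)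
    from vmax[OF this] have "(inverse (norm w))\<^sup>2 * (w \<bullet> (S *v w)) \<le> \<mu>"
      by (simp add: \<mu>_def sgn_div_norm matrix_vector_mult_scaleR power2_eq_square field_simps)
    then show ?thesis
      using False by (simp add: dot_square_norm field_simps)
  qed simp
  have orth: "w \<bullet> (S *v v) = 0" if wB: "\<And>b. b \<in> B \<Longrightarrow> b \<bullet> w = 0" and wv: "w \<bullet> v = 0" for w
  proof (rule ccontr)
    assume ne: "w \<bullet> (S *v v) \<noteq> 0"
    define c where "c = w \<bullet> (S *v v)"
    define D where "D = \<mu> * (w \<bullet> w) - w \<bullet> (S *v w)"
    have D: "D \<ge> 0" using rayleigh[of w] wB by (simp add: D_def)
    have ineq: "2 * t * c \<le> t\<^sup>2 * D" for t
    proof -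
      have "(v + t *\<^sub>R w) \<bullet> (S *v (v + t *\<^sub>R w)) \<le> \<mu> * ((v + t *\<^sub>R w) \<bullet> (v + t *\<^sub>R w))"
        using wB vB by (intro rayleigh) (simp add: inner_add_right)
      moreover have "v \<bullet> (S *v w) = c"
        using symmetric_matrix_inner[OF sym, of v w] by (simp add: c_def inner_commute)
      ultimately show ?thesis
        using v1 wv by (simp add: matrix_vector_right_distrib matrix_vector_mult_scaleR inner_add_right
            inner_add_left \<mu>_def[symmetric] c_def[symmetric] D_def power2_eq_square algebra_simps
            inner_commute[of v w])
    qed
    \<comment> \<open>nearly the maximum of \<open>2 t c - t\<^sup>2 D\<close>; adding \<open>1\<close> avoids the case \<open>D = 0\<close>\<close>
    define t where "t = c / (D + 1)"
    have "2 * t * c = 2 * t\<^sup>2 * (D + 1)"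
      using D by (simp add: t_def power2_eq_square)
    moreover have "t\<^sup>2 > 0"
      using ne D by (auto simp: t_def c_def)
    ultimately have "t\<^sup>2 * (2 * (D + 1)) \<le> t\<^sup>2 * D" using ineq[of t] by argo
    then show False using \<open>t\<^sup>2 > 0\<close> D by simp
  qed
  define z where "z = S *v v - \<mu> *\<^sub>R v"
  have zB: "b \<bullet> z = 0" if b: "b \<in> B" for b
  proof -
    obtain \<nu> where "S *v b = \<nu> *\<^sub>R b" using eig b by blast
    then show ?thesis
      using symmetric_matrix_inner[OF sym, of b v] vB[OF b] by (simp add: z_def inner_diff_right)
  qed
  have zv: "z \<bullet> v = 0"
    unfolding inner_commute[of z] using v1 by (simp add: z_def inner_diff_right \<mu>_def)
  have "z \<bullet> z = z \<bullet> (S *v v) - \<mu> * (z \<bullet> v)"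
    by (subst (2) z_def) (simp add: inner_diff_right)
  also have "\<dots> = 0"
    using orth[OF zB zv] zv by simp
  finally have "z = 0" by simp
  then show ?thesis
    using that[of v \<mu>] v1 vB by (simp add: z_def)
qed

lemma symmetric_matrix_eigenbasis:
  fixes S :: "real^'n^'n"
  assumes sym: "transpose S = S"
  obtains q :: "'n \<Rightarrow> real^'n" and \<mu> :: "'n \<Rightarrow> real"
  where "\<And>i j. q i \<bullet> q j = (if i = j then 1 else 0)" "\<And>i. S *v q i = \<mu> i *\<^sub>R q i"
proof -
  let ?P = "\<lambda>B. finite B \<and> (\<forall>b\<in>B. norm b = 1) \<and> pairwise orthogonal B \<and> (\<forall>b\<in>B. \<exists>\<mu>. S *v b = \<mu> *\<^sub>R b)"
  have "k \<le> CARD('n) \<Longrightarrow> \<exists>B. card B = k \<and> ?P B" for k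
  proof (induction k)
    case 0
    show ?case by (rule exI[of _ "{}"]) auto
  next
    case (Suc k)
    then obtain B where B: "card B = k" "?P B" by auto
    obtain v \<mu> where v: "norm v = 1" "\<And>b. b \<in> B \<Longrightarrow> b \<bullet> v = 0" "S *v v = \<mu> *\<^sub>R v"
      by (rule symmetric_matrix_further_eigenvector[OF sym, of B]) (use B Suc.prems in auto)
    have "v \<notin> B" using v(1,2) by force
    have vB: "\<And>b. b \<in> B \<Longrightarrow> orthogonal b v" using v(2) by (simp add: orthogonal_def)
    show ?case
      using B v(1,3) \<open>v \<notin> B\<close> vB
      by (intro exI[of _ "insert v B"]) (auto simp: pairwise_insert orthogonal_commute)
  qed
  then obtain B where B: "card B = CARD('n)" "?P B" by blast
  then obtain q where q: "bij_betw q (UNIV::'n set) B"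
    using finite_same_card_bij[of "UNIV::'n set" B] by auto
  have qB: "q i \<in> B" for i using q by (auto simp: bij_betw_def)
  have "q i \<bullet> q j = (if i = j then 1 else 0)" for i j
  proof (cases "i = j")
    case True
    then show ?thesis using B qB[of i] by (simp add: dot_square_norm)
  next
    case False
    then have "q i \<noteq> q j" using q by (auto simp: bij_betw_def inj_on_def)
    then show ?thesis using False B qB by (auto simp: pairwise_def orthogonal_def)
  qed
  moreover have "\<forall>i. \<exists>\<mu>. S *v q i = \<mu> *\<^sub>R q i" using B qB by blast
  then obtain \<mu> where "\<And>i. S *v q i = \<mu> i *\<^sub>R q i" by metis
  ultimately show ?thesis by (rule that)
qed

definition const_poly_matrix :: "real^'n^'m \<Rightarrow> (real poly)^'n^'m" where
  "const_poly_matrix A = (\<chi> i j. [:A $ i $ j:])"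

lemma const_poly_matrix_mult:
  "const_poly_matrix (A ** B) = const_poly_matrix A ** const_poly_matrix B"
proof -
  have sum: "(\<Sum>x\<in>X. [:f x:]) = [:\<Sum>x\<in>X. f x:]" if "finite X" for X :: "'x set" and f :: "'x \<Rightarrow> real"
    using that by (induction X) auto
  show ?thesis
    by (simp add: const_poly_matrix_def matrix_matrix_mult_def vec_eq_iff sum mult.commute)
qed

lemma const_poly_matrix_one: "const_poly_matrix (mat 1) = mat 1"
  by (simp add: const_poly_matrix_def mat_def vec_eq_iff one_pCons)

text \<open>
  Conjugating by the orthogonal matrix with columns \<open>q i\<close>, read as a matrix of constant polynomials,
  turns the characteristic matrix of \<open>S\<close> into a diagonal one without changing its determinant.
\<close>
lemma charpoly_orthogonally_diagonalised:
  fixes S :: "real^'n^'n" and q :: "'n \<Rightarrow> real^'n"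
  assumes q: "\<And>i j. q i \<bullet> q j = (if i = j then 1 else 0)" and \<mu>: "\<And>i. S *v q i = \<mu> i *\<^sub>R q i"
  shows "charpoly S = (\<Prod>i\<in>UNIV. [:- \<mu> i, 1:])"
proof -
  define P :: "real^'n^'n" where "P = (\<chi> i j. q j $ i)"
  define X :: "real poly^'n^'n" where "X = mat [:0, 1:]"
  define D :: "real^'n^'n" where "D = (\<chi> i j. if i = j then \<mu> i else 0)"
  have PP: "transpose P ** P = mat 1"
    using q by (simp add: P_def transpose_def matrix_matrix_mult_def mat_def vec_eq_iff inner_vec_def)
  then have PP': "P ** transpose P = mat 1"
    using matrix_left_right_inverse by blast
  have "(S ** P) $ i $ j = (P ** D) $ i $ j" for i j
    using \<mu>[of j] by (simp add: P_def D_def matrix_matrix_mult_def matrix_vector_mult_def vec_eq_iff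
        if_distrib cong: if_cong)
  then have "S ** P = P ** D" by (simp add: vec_eq_iff)
  then have "transpose P ** S ** P = D"
    by (metis PP matrix_mul_assoc matrix_mul_lid)
  then have cD: "const_poly_matrix (transpose P) ** const_poly_matrix S ** const_poly_matrix P = const_poly_matrix D"
    by (simp flip: const_poly_matrix_mult)
  have cP: "const_poly_matrix (transpose P) ** const_poly_matrix P = mat 1"
    by (simp add: PP const_poly_matrix_one flip: const_poly_matrix_mult)
  have Xc: "const_poly_matrix (transpose P) ** X = X ** const_poly_matrix (transpose P)"
    by (simp add: X_def mat_def matrix_matrix_mult_def vec_eq_iff if_distrib if_distribR mult.commute cong: if_cong)
  have charpoly: "charpoly M = det (X - const_poly_matrix M)" for M :: "real^'n^'n"
    unfolding charpoly_def X_def const_poly_matrix_def mat_def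
    by (rule arg_cong[where f = det]) (simp add: vec_eq_iff)
  have ldiff: "M ** (N - N') = M ** N - M ** N'" and rdiff: "(N - N') ** M = N ** M - N' ** M"
    for M N N' :: "real poly^'n^'n"
    by (simp_all add: matrix_matrix_mult_def vec_eq_iff algebra_simps sum_subtractf)
  have "const_poly_matrix (transpose P) ** (X - const_poly_matrix S) ** const_poly_matrix P = X - const_poly_matrix D"
    by (metis (no_types, lifting) Xc cD cP matrix_mul_assoc matrix_mul_rid ldiff rdiff)
  then have "det (X - const_poly_matrix D) =
      det (const_poly_matrix (transpose P)) * det (X - const_poly_matrix S) * det (const_poly_matrix P)"
    by (metis det_mul)
  moreover have "det (const_poly_matrix (transpose P)) * det (const_poly_matrix P) = 1"
    by (simp add: cP flip: det_mul)
  ultimately have "charpoly S = det (X - const_poly_matrix D)"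
    by (simp add: charpoly mult.commute mult.left_commute)
  also have "\<dots> = (\<Prod>i\<in>UNIV. [:- \<mu> i, 1:])"
    by (subst det_diagonal) (auto simp: X_def D_def const_poly_matrix_def mat_def)
  finally show ?thesis .
qed

lemma sum_singleton_msets: "finite X \<Longrightarrow> (\<Sum>i\<in>X. {#f i#}) = image_mset f (mset_set X)"
  by (induction X rule: finite_induct) auto

text \<open>
  The \<open>q i\<close> are right singular vectors and the \<open>\<sigma> i\<close> the singular values, indexed by \<open>'d\<close> in no
  particular order. The last clause ties them to the sorted list: symmetric products are all that the
  kernels need, so no correspondence between the two indexings has to be chosen.
\<close>
definition svd :: "real^'d^'d \<Rightarrow> ('d \<Rightarrow> real^'d) \<Rightarrow> ('d \<Rightarrow> real) \<Rightarrow> bool" where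
  "svd A q \<sigma> \<longleftrightarrow> (\<forall>i. \<sigma> i > 0) \<and> (\<forall>i j. q i \<bullet> q j = (if i = j then 1 else 0)) \<and>
     (\<forall>i j. (A *v q i) \<bullet> (A *v q j) = (if i = j then (\<sigma> i)\<^sup>2 else 0)) \<and>
     (\<forall>f :: real \<Rightarrow> real. (\<Prod>k=1..CARD('d). f (singular_value k A)) = (\<Prod>i\<in>UNIV. f (\<sigma> i)))"

lemma svdD:
  fixes A :: "real^'d^'d" and f :: "real \<Rightarrow> real"
  assumes "svd A q \<sigma>"
  shows "\<sigma> i > 0" "q i \<bullet> q j = (if i = j then 1 else 0)"
    "(A *v q i) \<bullet> (A *v q j) = (if i = j then (\<sigma> i)\<^sup>2 else 0)"
    "(\<Prod>k=1..CARD('d). f (singular_value k A)) = (\<Prod>i\<in>UNIV. f (\<sigma> i))"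
proof -
  note * = assms[unfolded svd_def]
  show "\<sigma> i > 0" using * by simp
  show "q i \<bullet> q j = (if i = j then 1 else 0)" using * by simp
  show "(A *v q i) \<bullet> (A *v q j) = (if i = j then (\<sigma> i)\<^sup>2 else 0)" using * by simp
  show "(\<Prod>k=1..CARD('d). f (singular_value k A)) = (\<Prod>i\<in>UNIV. f (\<sigma> i))"
    by (rule *[THEN conjunct2, THEN conjunct2, THEN conjunct2, THEN spec])
qed

text \<open>
  An orthonormal eigenbasis of the transpose of \<open>A\<close> times \<open>A\<close> works, because its characteristic
  polynomial shows that the multiset of eigenvalues is the one that defines the singular values.
\<close>
lemma singular_value_decomposition:
  fixes A :: "real^'d^'d"
  assumes inv: "invertible A"
  shows "\<exists>q \<sigma>. svd A q \<sigma>"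
proof -
  have "transpose (transpose A ** A) = transpose A ** A"
    by (simp add: matrix_transpose_mul)
  then obtain q :: "'d \<Rightarrow> real^'d" and \<mu> where q: "\<And>i j. q i \<bullet> q j = (if i = j then 1 else 0)"
    and \<mu>: "\<And>i. (transpose A ** A) *v q i = \<mu> i *\<^sub>R q i"
    using symmetric_matrix_eigenbasis by blast
  define \<sigma> where "\<sigma> i = sqrt (\<mu> i)" for i
  have AA: "(A *v q i) \<bullet> (A *v q j) = (if i = j then \<mu> i else 0)" for i j
  proof -
    have "(A *v q i) \<bullet> (A *v q j) = (transpose A *v (A *v q i)) \<bullet> q j"
      by (metis dot_lmul_matrix transpose_matrix_vector)
    also have "\<dots> = \<mu> i * (q i \<bullet> q j)"
      using \<mu>[of i] by (simp add: matrix_vector_mul_assoc)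
    finally show ?thesis using q by simp
  qed
  have pos: "\<mu> i > 0" for i
  proof -
    have "q i \<noteq> 0" using q[of i i] by auto
    then have "A *v q i \<noteq> 0"
      using inv by (metis invertible_def matrix_vector_mul_assoc matrix_vector_mul_lid matrix_vector_mult_0_right)
    then show ?thesis using AA[of i i] by (simp flip: inner_gt_zero_iff)
  qed
  have "proots (charpoly (transpose A ** A)) = (\<Sum>i\<in>UNIV. {#\<mu> i#})"
    by (simp add: charpoly_orthogonally_diagonalised[OF q \<mu>] proots_prod)
  also have "\<dots> = image_mset \<mu> (mset_set UNIV)"
    by (simp add: sum_singleton_msets)
  finally have ms: "mset (singular_values A) = image_mset \<sigma> (mset_set UNIV)"
    by (simp add: singular_values_def \<sigma>_def[abs_def] multiset.map_comp comp_def)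
  then have len: "length (singular_values A) = CARD('d)"
    by (metis size_image_mset size_mset size_mset_set)
  have "(\<Prod>k=1..CARD('d). f (singular_value k A)) = (\<Prod>i\<in>UNIV. f (\<sigma> i))" for f :: "real \<Rightarrow> real"
  proof -
    have "(\<Prod>k=1..CARD('d). f (singular_value k A)) = (\<Prod>k<length (singular_values A). f (singular_values A ! k))"
      unfolding len singular_value_def
      by (rule prod.reindex_bij_witness[of _ Suc "\<lambda>k. k - 1"]) auto
    also have "\<dots> = prod_mset (image_mset f (mset (singular_values A)))"
      by (simp add: prod_mset_prod_list prod.list_conv_set_nth atLeast0LessThan flip: mset_map)
    also have "\<dots> = (\<Prod>i\<in>UNIV. f (\<sigma> i))"
      by (simp add: ms multiset.map_comp comp_def prod_unfold_prod_mset)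
    finally show ?thesis .
  qed
  moreover have "\<sigma> i > 0" "(\<sigma> i)\<^sup>2 = \<mu> i" for i
    using pos[of i] by (simp_all add: \<sigma>_def)
  ultimately have "svd A q \<sigma>"
    unfolding svd_def using q AA by simp
  then show ?thesis by blast
qed

lemma orthonormal_expansion:
  fixes q :: "'d \<Rightarrow> real^'d"
  assumes q: "\<And>i j. q i \<bullet> q j = (if i = j then 1 else 0)"
  shows "x = (\<Sum>i\<in>UNIV. (q i \<bullet> x) *\<^sub>R q i)"
proof -
  have "inj q"
  proof (rule injI)
    fix i j assume "q i = q j"
    then show "i = j" using q[of i j] q[of j j] by (auto split: if_splits)
  qed
  have "0 \<notin> range q" using q by (metis imageE inner_zero_left zero_neq_one)
  moreover have "pairwise orthogonal (range q)"
    using q by (auto simp: pairwise_def orthogonal_def)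
  ultimately have "independent (range q)"
    by (intro pairwise_orthogonal_independent)
  moreover have "card (range q) = dim (UNIV :: (real^'d) set)"
    using \<open>inj q\<close> by (simp add: card_image)
  ultimately have span: "span (range q) = UNIV"
    by (metis card_eq_dim finite_imageI finite subset_UNIV top.extremum_uniqueI)
  define y where "y = x - (\<Sum>i\<in>UNIV. (q i \<bullet> x) *\<^sub>R q i)"
  have "q j \<bullet> y = 0" for j
    by (simp add: y_def inner_diff_right inner_sum_right q if_distrib cong: if_cong)
  then have "orthogonal y z" if "z \<in> range q" for z
    using that by (auto simp: orthogonal_def inner_commute)
  then have "orthogonal y y"
    by (intro orthogonal_to_span[of y "range q"]) (auto simp: span)
  then show ?thesis by (simp add: y_def orthogonal_def)
qed

lemma norm_le_sum_inner:
  fixes q :: "'d \<Rightarrow> real^'d" and w :: "real^'d" and t :: real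
  assumes q: "\<And>i j. q i \<bullet> q j = (if i = j then 1 else 0)" and t: "\<And>i. \<bar>q i \<bullet> w\<bar> \<le> t"
  shows "norm w \<le> CARD('d) * t"
proof -
  have "norm w = norm (\<Sum>i\<in>UNIV. (q i \<bullet> w) *\<^sub>R q i)"
    using orthonormal_expansion[OF q, of w] by simp
  also have "\<dots> \<le> (\<Sum>i\<in>(UNIV::'d set). t)"
    using t q by (intro sum_norm_le) (simp add: norm_eq_sqrt_inner)
  finally show ?thesis by simp
qed

lemma svd_norms:
  assumes "svd A q \<sigma>"
  shows "norm (q i) = 1" "norm (A *v q i) = \<sigma> i"
  using svdD(1)[OF assms, of i] svdD(2,3)[OF assms, of i i] by (simp_all add: norm_eq_sqrt_inner)

lemma svd_expansion:
  assumes "svd A q \<sigma>"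
  shows "A *v z = (\<Sum>i\<in>UNIV. (q i \<bullet> z) *\<^sub>R (A *v q i))"
  by (subst orthonormal_expansion[OF svdD(2)[OF assms], of z])
     (simp add: linear_sum[OF matrix_vector_mul_linear] matrix_vector_mult_scaleR)

lemma svd_coordinate_le:
  assumes "svd A q \<sigma>"
  shows "\<sigma> i * \<bar>q i \<bullet> z\<bar> \<le> norm (A *v z)"
proof -
  have pos: "0 < \<sigma> i" by (rule svdD(1)[OF assms])
  have "(A *v q i) \<bullet> (A *v z) = (q i \<bullet> z) * (\<sigma> i)\<^sup>2"
    by (simp add: svd_expansion[OF assms, of z] inner_sum_right svdD(3)[OF assms] if_distrib cong: if_cong)
  then have "\<bar>q i \<bullet> z\<bar> * (\<sigma> i)\<^sup>2 \<le> \<sigma> i * norm (A *v z)"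
    using Cauchy_Schwarz_ineq2[of "A *v q i" "A *v z"] svd_norms(2)[OF assms, of i] by (simp add: abs_mult)
  then show ?thesis using pos by (simp add: power2_eq_square mult_ac)
qed

section \<open>The product of truncated reciprocal singular values\<close>

text \<open>
  The factor \<open>Z\<^sub>u(x \<and> y)\<close>, as a function of the matrix \<open>T\<^bsub>x \<and> y\<^esub>\<close>. It is comparable to the volume of the
  part of a unit ball that \<open>A\<close> maps into a ball of radius \<open>u\<close>, and its inverse to the number of balls of
  radius \<open>u\<close> that cover the image under \<open>A\<close> of the unit ball.
\<close>
definition sv_kernel :: "real^'d^'d \<Rightarrow> real \<Rightarrow> real" where
  "sv_kernel A u = (\<Prod>k=1..CARD('d). min 1 (u / singular_value k A))"

lemma sv_kernel_pos:
  fixes A :: "real^'d^'d" assumes "invertible A" "u > 0" shows "sv_kernel A u > 0"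
proof -
  obtain q \<sigma> where svd: "svd A q \<sigma>"
    using singular_value_decomposition[OF assms(1)] by blast
  note pos = svdD(1)[OF svd] and prod = svdD(4)[OF svd]
  then show ?thesis
    unfolding sv_kernel_def prod[of "\<lambda>\<alpha>. min 1 (u / \<alpha>)"] using assms(2) pos by (intro prod_pos) auto
qed

lemma sv_kernel_le_1:
  fixes A :: "real^'d^'d" assumes "invertible A" "u > 0" shows "sv_kernel A u \<le> 1"
proof -
  obtain q \<sigma> where svd: "svd A q \<sigma>"
    using singular_value_decomposition[OF assms(1)] by blast
  note pos = svdD(1)[OF svd] and prod = svdD(4)[OF svd]
  then show ?thesis
    unfolding sv_kernel_def prod[of "\<lambda>\<alpha>. min 1 (u / \<alpha>)"] using assms(2) pos
    by (intro prod_le_1) (auto simp: less_imp_le)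
qed

lemma sv_kernel_scale:
  fixes A :: "real^'d^'d" assumes "invertible A" "0 < u" "u \<le> c * v" "c \<ge> 1"
  shows "sv_kernel A u \<le> c ^ CARD('d) * sv_kernel A v"
proof -
  obtain q \<sigma> where svd: "svd A q \<sigma>"
    using singular_value_decomposition[OF assms(1)] by blast
  note pos = svdD(1)[OF svd] and prod = svdD(4)[OF svd]
  have "min 1 (u / \<sigma> i) \<le> c * min 1 (v / \<sigma> i)" for i
  proof -
    have "u / \<sigma> i \<le> c * (v / \<sigma> i)"
      using assms pos[of i] by (simp add: divide_right_mono less_imp_le)
    then show ?thesis
      using assms(4) by (auto simp: min_def)
  qed
  then have "(\<Prod>i\<in>UNIV. min 1 (u / \<sigma> i)) \<le> (\<Prod>i\<in>UNIV. c * min 1 (v / \<sigma> i))"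
    using pos assms(2) by (intro prod_mono) (auto simp: less_imp_le)
  then show ?thesis
    unfolding sv_kernel_def prod[of "\<lambda>\<alpha>. min 1 (u / \<alpha>)"] prod[of "\<lambda>\<alpha>. min 1 (v / \<alpha>)"]
    by (simp add: prod.distrib)
qed

lemma sv_kernel_eq_1:
  fixes A :: "real^'d^'d" assumes "invertible A" "onorm ((*v) A) \<le> u"
  shows "sv_kernel A u = 1"
proof -
  obtain q \<sigma> where svd: "svd A q \<sigma>"
    using singular_value_decomposition[OF assms(1)] by blast
  note pos = svdD(1)[OF svd] and prod = svdD(4)[OF svd]
  have "min 1 (u / \<sigma> i) = 1" for i
  proof -
    have "\<sigma> i \<le> u"
      using svd_norms[OF svd, of i] onorm[OF matrix_vector_mul_bounded_linear, of A "q i"] assms(2) by simp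
    then show ?thesis using pos[of i] by simp
  qed
  then show ?thesis
    unfolding sv_kernel_def prod[of "\<lambda>\<alpha>. min 1 (u / \<alpha>)"] by simp
qed

lemma sv_kernel_ge_power:
  fixes A :: "real^'d^'d" assumes "invertible A" "onorm ((*v) A) \<le> 1" "0 < u" "u \<le> 1"
  shows "u ^ CARD('d) \<le> sv_kernel A u"
proof -
  have "1 = sv_kernel A 1" using sv_kernel_eq_1[OF assms(1,2)] by simp
  also have "\<dots> \<le> (1 / u) ^ CARD('d) * sv_kernel A u"
    using assms by (intro sv_kernel_scale) auto
  finally show ?thesis
    using assms(3) by (simp add: power_divide field_simps)
qed

section \<open>Grids: covering ellipsoids and bounding volumes\<close>

lemma interval_grid:
  fixes x l :: real
  assumes "\<bar>x\<bar> \<le> l" "N > 0"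
  shows "\<exists>k<N. \<bar>x - ((2 * real k + 1) * l / N - l)\<bar> \<le> l / N"
proof (cases "l = 0")
  case True
  then show ?thesis using assms by auto
next
  case False
  then have l: "l > 0" using assms by linarith
  define y where "y = (x + l) * N / (2 * l)"
  have "0 \<le> (x + l) * N" "(x + l) * N \<le> (2 * l) * N"
    using assms by (auto intro!: mult_right_mono mult_nonneg_nonneg)
  then have y: "0 \<le> y" "y \<le> N"
    using l by (auto simp: y_def field_simps)
  obtain k where k: "k < N" "real k \<le> y" "y \<le> real k + 1"
  proof (cases "y = N")
    case True
    then show ?thesis using assms(2) that[of "N - 1"] by simp
  next
    case False
    then have "nat \<lfloor>y\<rfloor> < N" using y by linarith
    then show ?thesis using y that[of "nat \<lfloor>y\<rfloor>"] by linarith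
  qed
  have "x - ((2 * real k + 1) * l / N - l) = (2 * (y - k) - 1) * (l / N)"
    using l assms(2) by (simp add: y_def field_simps)
  also have "\<bar>\<dots>\<bar> \<le> 1 * (l / N)"
    unfolding abs_mult using k l by (intro mult_mono) auto
  finally show ?thesis using k(1) by auto
qed

text \<open>
  Cut the \<open>i\<close>-th side \<open>[-l i, l i]\<close> into \<open>N i\<close> equal intervals and take the midpoints.
\<close>
lemma box_grid:
  fixes l :: "'i::finite \<Rightarrow> real" and N :: "'i \<Rightarrow> nat"
  assumes "\<And>i. N i > 0"
  shows "\<exists>C :: ('i \<Rightarrow> real) set. finite C \<and> card C \<le> (\<Prod>i\<in>UNIV. N i) \<and>
    (\<forall>x. (\<forall>i. \<bar>x i\<bar> \<le> l i) \<longrightarrow> (\<exists>c\<in>C. \<forall>i. \<bar>x i - c i\<bar> \<le> l i / N i))"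
proof -
  let ?P = "PiE UNIV (\<lambda>i. {..<N i})"
  define g where "g \<kappa> = (\<lambda>i. (2 * real (\<kappa> i) + 1) * l i / N i - l i)" for \<kappa> :: "'i \<Rightarrow> nat"
  have fin: "finite ?P" by (intro finite_PiE) auto
  have "card (g ` ?P) \<le> (\<Prod>i\<in>UNIV. N i)"
    using card_image_le[OF fin, of g] by (simp add: card_PiE)
  moreover have "\<exists>c\<in>g ` ?P. \<forall>i. \<bar>x i - c i\<bar> \<le> l i / N i" if "\<And>i. \<bar>x i\<bar> \<le> l i" for x
  proof -
    have "\<forall>i. \<exists>k<N i. \<bar>x i - ((2 * real k + 1) * l i / N i - l i)\<bar> \<le> l i / N i"
      using interval_grid[OF that assms] by simp
    then obtain \<kappa> where "\<forall>i. \<kappa> i < N i \<and> \<bar>x i - ((2 * real (\<kappa> i) + 1) * l i / N i - l i)\<bar> \<le> l i / N i"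
      by (rule choice[THEN exE])
    then show ?thesis by (intro bexI[of _ "g \<kappa>"]) (auto simp: g_def)
  qed
  ultimately show ?thesis using fin by (intro exI[of _ "g ` ?P"]) simp
qed

text \<open>
  This replaces a change of variables. A grid of mesh \<open>\<delta>\<close>, the shortest side of the box, has about
  \<open>\<Prod> l i / \<delta>\<close> cells, and the part of \<open>S\<close> over one cell lies in a ball of radius \<open>2 K \<delta>\<close>. The powers of
  \<open>\<delta>\<close> cancel because the number of coordinates equals the dimension.
\<close>
lemma expansive_preimage_measure:
  fixes f :: "'a::euclidean_space \<Rightarrow> 'i::finite \<Rightarrow> real"
  assumes card: "CARD('i) = DIM('a)" and K: "K > 0"
    and expansive: "\<And>a b t. (\<And>i. \<bar>f a i - f b i\<bar> \<le> t) \<Longrightarrow> norm (a - b) \<le> K * t"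
    and l: "\<And>i. l i > 0" and S: "\<And>a i. a \<in> S \<Longrightarrow> \<bar>f a i\<bar> \<le> l i"
  shows "emeasure lborel S \<le> ennreal (unit_ball_vol DIM('a) * (4 * K) ^ DIM('a) * (\<Prod>i\<in>UNIV. l i))"
proof -
  define \<delta> where "\<delta> = Min (range l)"
  have \<delta>: "\<delta> > 0" "\<And>i. \<delta> \<le> l i"
    using l by (auto simp: \<delta>_def)
  \<comment> \<open>the mesh is at most \<open>\<delta>\<close>, and rounding up costs a factor \<open>2\<close> at most because \<open>\<delta> \<le> l i\<close>\<close>
  define N where "N i = nat \<lceil>l i / \<delta>\<rceil>" for i
  have N: "N i > 0" "l i / N i \<le> \<delta>" "N i \<le> 2 * l i / \<delta>" for i
  proof -
    have 1: "1 \<le> l i / \<delta>" using \<delta> by (simp add: field_simps)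
    then have 2: "l i / \<delta> \<le> N i" "N i < l i / \<delta> + 1" unfolding N_def by linarith+
    then show "N i > 0" using 1 by (intro Nat.gr0I) auto
    then show "l i / N i \<le> \<delta>" using 2 \<delta>(1) by (simp add: field_simps)
    have "2 * l i / \<delta> = l i / \<delta> + l i / \<delta>" by simp
    then show "N i \<le> 2 * l i / \<delta>" using 1 2 by linarith
  qed
  obtain C where C: "finite C" "card C \<le> (\<Prod>i\<in>UNIV. N i)"
    "\<forall>x. (\<forall>i. \<bar>x i\<bar> \<le> l i) \<longrightarrow> (\<exists>c\<in>C. \<forall>i. \<bar>x i - c i\<bar> \<le> l i / N i)"
    using box_grid[where N = N and l = l, OF N(1)] by (elim exE conjE) (rule that)
  define g where "g c = (SOME a. \<forall>i. \<bar>f a i - c i\<bar> \<le> \<delta>)" for c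
  have sub: "S \<subseteq> (\<Union>c\<in>C. cball (g c) (2 * K * \<delta>))"
  proof
    fix a assume "a \<in> S"
    then have "\<exists>c\<in>C. \<forall>i. \<bar>f a i - c i\<bar> \<le> l i / N i"
      using C(3) S by simp
    then obtain c where c: "c \<in> C" "\<And>i. \<bar>f a i - c i\<bar> \<le> l i / N i" by blast
    have ac: "\<bar>f a i - c i\<bar> \<le> \<delta>" for i using c(2)[of i] N(2)[of i] by linarith
    then have gc: "\<forall>i. \<bar>f (g c) i - c i\<bar> \<le> \<delta>"
      using someI[of "\<lambda>a. \<forall>i. \<bar>f a i - c i\<bar> \<le> \<delta>" a] by (simp add: g_def)
    have "\<bar>f (g c) i - f a i\<bar> \<le> 2 * \<delta>" for i
      using ac[of i] gc[rule_format, of i] by linarith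
    then have "norm (g c - a) \<le> K * (2 * \<delta>)" by (rule expansive)
    then show "a \<in> (\<Union>c\<in>C. cball (g c) (2 * K * \<delta>))"
      using c(1) by (auto simp: dist_norm mult_ac)
  qed
  have vol: "0 \<le> unit_ball_vol DIM('a)" by simp
  have "emeasure lborel S \<le> emeasure lborel (\<Union>c\<in>C. cball (g c) (2 * K * \<delta>))"
    by (intro emeasure_mono sub) (auto intro!: sets.finite_UN C(1))
  also have "\<dots> \<le> (\<Sum>c\<in>C. emeasure lborel (cball (g c) (2 * K * \<delta>)))"
    using C(1) by (intro emeasure_subadditive_finite) auto
  also have "\<dots> = ennreal (card C * (unit_ball_vol DIM('a) * (2 * K * \<delta>) ^ DIM('a)))"
    using K \<delta>(1) by (simp add: emeasure_cball ennreal_mult ennreal_of_nat_eq_real_of_nat)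
  also have "\<dots> \<le> ennreal (unit_ball_vol DIM('a) * (4 * K) ^ DIM('a) * (\<Prod>i\<in>UNIV. l i))"
  proof (rule ennreal_leI)
    have "real (card C) \<le> (\<Prod>i\<in>UNIV. real (N i))"
      using C(2) by (metis of_nat_le_iff of_nat_prod)
    also have "\<dots> \<le> (\<Prod>i\<in>UNIV. (2 / \<delta>) * l i)"
      using N(3) by (intro prod_mono) auto
    also have "\<dots> = (2 / \<delta>) ^ DIM('a) * (\<Prod>i\<in>UNIV. l i)"
      unfolding prod.distrib by (simp add: card)
    finally have "card C * (unit_ball_vol DIM('a) * (2 * K * \<delta>) ^ DIM('a)) \<le>
        (2 / \<delta>) ^ DIM('a) * (\<Prod>i\<in>UNIV. l i) * (unit_ball_vol DIM('a) * (2 * K * \<delta>) ^ DIM('a))"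
      using vol K \<delta>(1) by (intro mult_right_mono) auto
    also have "\<dots> = unit_ball_vol DIM('a) * ((2 / \<delta>) * (2 * K * \<delta>)) ^ DIM('a) * (\<Prod>i\<in>UNIV. l i)"
      by (simp only: power_mult_distrib mult_ac)
    also have "(2 / \<delta>) * (2 * K * \<delta>) = 4 * K" using \<delta>(1) by simp
    finally show "card C * (unit_ball_vol DIM('a) * (2 * K * \<delta>) ^ DIM('a)) \<le>
      unit_ball_vol DIM('a) * (4 * K) ^ DIM('a) * (\<Prod>i\<in>UNIV. l i)" .
  qed
  finally show ?thesis .
qed

text \<open>
  In the orthogonal frame \<open>A (q i)\<close> the image of the ball lies in a box with half-sides \<open>R \<sigma> i\<close>, which is
  cut into \<open>O(1 + \<sigma> i / u)\<close> pieces in direction \<open>i\<close>; each factor \<open>1 + \<sigma> i / u\<close> is matched by the factor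
  \<open>min 1 (u / \<sigma> i)\<close> of the kernel. Balls of radius \<open>u / 2\<close> are used since a cover has to consist of sets
  whose diameter is bounded from below as well, and these have diameter exactly \<open>u\<close>.
\<close>
lemma linear_image_ball_cover:
  fixes A :: "real^'d^'d" and R u :: real
  assumes inv: "invertible A" and R: "R \<ge> 0" and u: "u > 0"
  shows "\<exists>C. finite C \<and> card C * sv_kernel A u \<le> (2 * R * CARD('d) + 1) ^ CARD('d) \<and>
    (\<forall>z. norm z \<le> R \<longrightarrow> (\<exists>c\<in>C. A *v z \<in> cball c (u / 2)))"
proof -
  obtain q \<sigma> where svd: "svd A q \<sigma>"
    using singular_value_decomposition[OF assms(1)] by blast
  note pos = svdD(1)[OF svd] and prod = svdD(4)[OF svd]
  note norms = svd_norms[OF svd]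
  \<comment> \<open>each of the \<open>d\<close> directions may contribute an error of \<open>u / (2 d)\<close>\<close>
  define b where "b i = 2 * R * CARD('d) * \<sigma> i / u" for i
  have b: "b i \<ge> 0" for i using R u pos[of i] by (simp add: b_def)
  define N where "N i = nat \<lfloor>b i\<rfloor> + 1" for i
  have N: "N i > 0" "b i \<le> N i" "N i \<le> b i + 1" for i
    using b[of i] unfolding N_def by linarith+
  obtain C where C: "finite C" "card C \<le> (\<Prod>i\<in>UNIV. N i)"
    "\<forall>x. (\<forall>i. \<bar>x i\<bar> \<le> R) \<longrightarrow> (\<exists>c\<in>C. \<forall>i. \<bar>x i - c i\<bar> \<le> R / N i)"
    using box_grid[where N = N and l = "\<lambda>_. R", OF N(1)] by (elim exE conjE) (rule that)
  define g where "g c = (\<Sum>i\<in>UNIV. c i *\<^sub>R (A *v q i))" for c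
  have "card (g ` C) * sv_kernel A u \<le> (2 * R * CARD('d) + 1) ^ CARD('d)"
  proof -
    have "real (card (g ` C)) \<le> real (\<Prod>i\<in>UNIV. N i)"
      using C(2) card_image_le[OF C(1), of g] by linarith
    then have "real (card (g ` C)) * sv_kernel A u \<le> (\<Prod>i\<in>UNIV. real (N i)) * (\<Prod>i\<in>UNIV. min 1 (u / \<sigma> i))"
      using sv_kernel_pos[OF inv u] prod[of "\<lambda>\<alpha>. min 1 (u / \<alpha>)"]
      by (simp add: sv_kernel_def mult_right_mono)
    also have "\<dots> = (\<Prod>i\<in>UNIV. real (N i) * min 1 (u / \<sigma> i))" by (simp add: prod.distrib)
    also have "\<dots> \<le> (\<Prod>i\<in>(UNIV::'d set). 2 * R * CARD('d) + 1)"
    proof (intro prod_mono conjI)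
      fix i
      show "0 \<le> real (N i) * min 1 (u / \<sigma> i)" using u pos[of i] by simp
      have "real (N i) * min 1 (u / \<sigma> i) \<le> (b i + 1) * min 1 (u / \<sigma> i)"
        using N(3)[of i] u pos[of i] by (intro mult_right_mono) auto
      also have "\<dots> = b i * min 1 (u / \<sigma> i) + min 1 (u / \<sigma> i)" by (simp add: distrib_right)
      also have "\<dots> \<le> b i * (u / \<sigma> i) + 1"
        using b[of i] by (intro add_mono mult_left_mono) auto
      also have "b i * (u / \<sigma> i) = 2 * R * CARD('d)" using u pos[of i] by (simp add: b_def)
      finally show "real (N i) * min 1 (u / \<sigma> i) \<le> 2 * R * CARD('d) + 1" .
    qed
    finally show ?thesis by simp
  qed
  moreover have "\<exists>c\<in>g ` C. A *v z \<in> cball c (u / 2)" if "norm z \<le> R" for z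
  proof -
    have "\<bar>q i \<bullet> z\<bar> \<le> R" for i
      using Cauchy_Schwarz_ineq2[of "q i" z] norms that by simp
    then have "\<exists>c\<in>C. \<forall>i. \<bar>q i \<bullet> z - c i\<bar> \<le> R / N i"
      using C(3) by simp
    then obtain c where c: "c \<in> C" "\<And>i. \<bar>q i \<bullet> z - c i\<bar> \<le> R / N i" by blast
    have "norm (g c - A *v z) = norm (\<Sum>i\<in>UNIV. (c i - q i \<bullet> z) *\<^sub>R (A *v q i))"
      by (simp add: svd_expansion[OF svd, of z] g_def scaleR_diff_left sum_subtractf)
    also have "\<dots> \<le> (\<Sum>i\<in>UNIV. norm ((c i - q i \<bullet> z) *\<^sub>R (A *v q i)))"
      by (rule norm_sum)
    also have "\<dots> \<le> (\<Sum>i\<in>(UNIV::'d set). u / (2 * CARD('d)))"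
    proof (rule sum_mono)
      fix i
      have "norm ((c i - q i \<bullet> z) *\<^sub>R (A *v q i)) \<le> R / N i * \<sigma> i"
        using mult_right_mono[OF c(2)[of i], of "\<sigma> i"] pos[of i] by (simp add: norms abs_minus_commute)
      also have "\<dots> \<le> u / (2 * CARD('d))"
        using N(1,2)[of i] u by (simp add: b_def field_simps)
      finally show "norm ((c i - q i \<bullet> z) *\<^sub>R (A *v q i)) \<le> u / (2 * CARD('d))" .
    qed
    also have "\<dots> = u / 2" by simp
    finally show ?thesis using c(1) by (auto simp: dist_norm)
  qed
  ultimately show ?thesis using C(1) by (intro exI[of _ "g ` C"]) simp
qed

section \<open>The coding map\<close>

lemma matrix_word_simps [simp]:
  "matrix_word T [] = mat 1" "matrix_word T (j # I) = T j ** matrix_word T I"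
  by (simp_all add: matrix_word_def)

lemma matrix_word_append: "matrix_word T (I @ J) = matrix_word T I ** matrix_word T J"
  by (induction I) (simp_all add: matrix_mul_assoc)

locale contracting_matrices =
  fixes T :: "'m::finite \<Rightarrow> real^'d^'d"
  assumes invertible: "invertible (T j)"
    and onorm_less_1: "onorm (\<lambda>x. T j *v x) < 1"

begin

definition \<tau> :: real where "\<tau> = Max (range (\<lambda>j. onorm (\<lambda>x. T j *v x)))"

lemma tau_less_iff: "\<tau> < t \<longleftrightarrow> (\<forall>j. onorm (\<lambda>x. T j *v x) < t)"
  by (simp add: \<tau>_def)

lemma tau_less_1: "\<tau> < 1"
  by (simp add: tau_less_iff onorm_less_1)

lemma onorm_le_tau: "onorm (\<lambda>x. T j *v x) \<le> \<tau>"
  by (simp add: \<tau>_def)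

lemma tau_nonneg: "0 \<le> \<tau>"
  using onorm_pos_le[OF matrix_vector_mul_bounded_linear] onorm_le_tau order_trans by blast

lemma norm_T_le: "norm (T j *v v) \<le> \<tau> * norm v"
  by (rule order_trans[OF onorm[OF matrix_vector_mul_bounded_linear] mult_right_mono[OF onorm_le_tau norm_ge_zero]])

lemma norm_matrix_word_le: "norm (matrix_word T I *v v) \<le> \<tau> ^ length I * norm v"
proof (induction I)
  case (Cons j I)
  have "norm (matrix_word T (j # I) *v v) = norm (T j *v (matrix_word T I *v v))"
    by (simp add: matrix_vector_mul_assoc)
  also have "\<dots> \<le> \<tau> * norm (matrix_word T I *v v)" by (rule norm_T_le)
  also have "\<dots> \<le> \<tau> * (\<tau> ^ length I * norm v)" by (rule mult_left_mono[OF Cons tau_nonneg])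
  finally show ?case by (simp add: mult_ac)
qed simp

lemma onorm_matrix_word_le: "onorm ((*v) (matrix_word T I)) \<le> \<tau> ^ length I"
  using norm_matrix_word_le tau_nonneg by (intro onorm_bound) auto

lemma onorm_matrix_word_le_1: "onorm ((*v) (matrix_word T I)) \<le> 1"
  using onorm_matrix_word_le[of I] power_le_one[OF tau_nonneg, of "length I"] tau_less_1 by linarith

lemma invertible_matrix_word: "invertible (matrix_word T I)"
  by (induction I) (auto intro!: invertible_mult invertible simp: invertible_def[of "mat 1"] intro!: exI[of _ "mat 1"])

lemma foldr_ifs_map:
  "foldr (ifs_map T a) I z = matrix_word T I *v z + (\<Sum>k<length I. matrix_word T (take k I) *v (a $ (I ! k)))"
  by (induction I)
     (simp_all add: ifs_map_def sum.lessThan_Suc_shift matrix_vector_right_distrib matrix_vector_mul_assoc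
        linear_sum[OF matrix_vector_mul_linear] add_ac del: sum.lessThan_Suc)

text \<open>
  The coding map is the series of these terms; in particular it is linear in the translations \<open>a\<close>.
\<close>
definition coding_term :: "real^'d^'m \<Rightarrow> (nat \<Rightarrow> 'm) \<Rightarrow> nat \<Rightarrow> real^'d" where
  "coding_term a x k = matrix_word T (map x [0..<k]) *v (a $ x k)"

lemma norm_coding_term: "norm (coding_term a x k) \<le> \<tau> ^ k * norm (a $ x k)"
  using norm_matrix_word_le[of "map x [0..<k]"] by (simp add: coding_term_def)

lemma norm_coding_term': "norm (coding_term a x k) \<le> norm a * \<tau> ^ k"
proof -
  have "norm (a $ x k) \<le> norm a" by (rule Finite_Cartesian_Product.norm_nth_le)
  then have "\<tau> ^ k * norm (a $ x k) \<le> \<tau> ^ k * norm a" using tau_nonneg by (intro mult_left_mono) auto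
  then show ?thesis using norm_coding_term[of a x k] by (simp add: mult.commute)
qed

lemma summable_tau: "summable (\<lambda>k. \<tau> ^ k)"
  using tau_nonneg tau_less_1 by (intro summable_geometric) simp

lemma summable_norm_coding_term: "summable (\<lambda>k. norm (coding_term a x k))"
  by (rule summable_comparison_test'[OF summable_mult[OF summable_tau, of "norm a"], of 0])
     (simp add: norm_coding_term')

lemma summable_coding_term: "summable (coding_term a x)"
  by (rule summable_norm_cancel[OF summable_norm_coding_term])

lemma coding_map_eq: "coding_map T a x = suminf (coding_term a x)"
proof -
  have "foldr (ifs_map T a) (map x [0..<n]) 0 = (\<Sum>k<n. coding_term a x k)" for n
    by (auto simp: foldr_ifs_map coding_term_def take_map intro!: sum.cong)
  then show ?thesis
    unfolding coding_map_def using summable_LIMSEQ[OF summable_coding_term, of a x] by (simp add: limI)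
qed

lemma coding_map_add: "coding_map T (a + b) x = coding_map T a x + coding_map T b x"
proof -
  have "coding_term (a + b) x = (\<lambda>k. coding_term a x k + coding_term b x k)"
    by (simp add: coding_term_def fun_eq_iff matrix_vector_right_distrib)
  then show ?thesis by (simp add: coding_map_eq suminf_add[OF summable_coding_term summable_coding_term])
qed

lemma coding_map_scaleR: "coding_map T (c *\<^sub>R a) x = c *\<^sub>R coding_map T a x"
proof -
  have "coding_term (c *\<^sub>R a) x = (\<lambda>k. c *\<^sub>R coding_term a x k)"
    by (simp add: coding_term_def fun_eq_iff matrix_vector_mult_scaleR)
  then show ?thesis by (simp add: coding_map_eq suminf_scaleR_right[OF summable_coding_term])
qed

lemma norm_coding_map_le: "norm (coding_map T a x) \<le> norm a / (1 - \<tau>)"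
proof -
  have "norm (coding_map T a x) \<le> (\<Sum>k. norm (coding_term a x k))"
    unfolding coding_map_eq by (rule summable_norm[OF summable_norm_coding_term])
  also have "\<dots> \<le> (\<Sum>k. norm a * \<tau> ^ k)"
    by (rule suminf_le[OF norm_coding_term' summable_norm_coding_term summable_mult[OF summable_tau]])
  also have "\<dots> = norm a / (1 - \<tau>)"
    using suminf_geometric[of \<tau>] tau_nonneg tau_less_1 by (simp add: suminf_mult[OF summable_tau])
  finally show ?thesis .
qed

lemma bounded_linear_coding_map: "bounded_linear (\<lambda>a. coding_map T a x)"
  by (rule bounded_linear_intro[where K = "1 / (1 - \<tau>)"])
     (use norm_coding_map_le in \<open>auto simp: coding_map_add coding_map_scaleR\<close>)

lemma continuous_coding_map: "continuous_on UNIV (\<lambda>a. coding_map T a x)"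
  by (rule linear_continuous_on[OF bounded_linear_coding_map])

lemma close_pair_sets: "{a. dist (coding_map T a x) (coding_map T a y) \<le> u} \<in> sets borel"
  by (intro borel_closed closed_Collect_le continuous_intros continuous_coding_map)

lemma coding_map_shift:
  "coding_map T a x = (\<Sum>k<n. coding_term a x k) + matrix_word T (map x [0..<n]) *v coding_map T a (\<lambda>k. x (k + n))"
proof -
  have "map x [0..<k + n] = map x [0..<n] @ map (\<lambda>k. x (k + n)) [0..<k]" for k
    by (rule nth_equalityI) (auto simp: nth_append add.commute)
  then have "coding_term a x (k + n) = matrix_word T (map x [0..<n]) *v coding_term a (\<lambda>k. x (k + n)) k" for k
    by (simp add: coding_term_def matrix_word_append matrix_vector_mul_assoc)
  then have "(\<Sum>k. coding_term a x (k + n)) = matrix_word T (map x [0..<n]) *v coding_map T a (\<lambda>k. x (k + n))"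
    unfolding coding_map_eq
    by (simp add: bounded_linear.suminf[OF matrix_vector_mul_bounded_linear summable_coding_term])
  then show ?thesis
    using suminf_split_initial_segment[OF summable_coding_term, of a x n] by (simp add: coding_map_eq add.commute)
qed

text \<open>
  The terms of the common prefix cancel, and what remains is the image under \<open>T\<^sub>I\<close> of the difference at
  the shifted sequences.
\<close>
lemma coding_map_diff_common_prefix:
  assumes "\<And>k. k < n \<Longrightarrow> x k = y k"
  shows "coding_map T a x - coding_map T a y =
    matrix_word T (map x [0..<n]) *v (coding_map T a (\<lambda>k. x (k + n)) - coding_map T a (\<lambda>k. y (k + n)))"
proof -
  have pre: "map x [0..<k] = map y [0..<k]" if "k \<le> n" for k using assms that by auto
  have "(\<Sum>k<n. coding_term a x k) = (\<Sum>k<n. coding_term a y k)"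
  proof (intro sum.cong refl)
    fix k assume "k \<in> {..<n}"
    then have "x k = y k" "map x [0..<k] = map y [0..<k]" using assms pre[of k] by simp_all
    then show "coding_term a x k = coding_term a y k" by (simp only: coding_term_def)
  qed
  moreover have "coding_map T a y = (\<Sum>k<n. coding_term a y k) + matrix_word T (map x [0..<n]) *v coding_map T a (\<lambda>k. y (k + n))"
    unfolding pre[OF order_refl] by (rule coding_map_shift)
  ultimately show ?thesis
    using coding_map_shift[of a x n] by (simp only: matrix_vector_mult_diff_distrib add_diff_cancel_left)
qed

section \<open>Transversality\<close>

text \<open>
  A bound for the norm of the coefficient of \<open>a\<^sub>l\<close> in the coding series without its first term.
\<close>
definition tail_weight :: "(nat \<Rightarrow> 'm) \<Rightarrow> 'm \<Rightarrow> real" where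
  "tail_weight x l = (\<Sum>k. if x (Suc k) = l then \<tau> ^ Suc k else 0)"

lemma summable_tail_weight: "summable (\<lambda>k. if x (Suc k) = l then \<tau> ^ Suc k else 0)"
  by (rule summable_comparison_test'[OF summable_mult[OF summable_tau, of \<tau>], of 0])
     (use tau_nonneg in auto)

text \<open>
  Each position of \<open>x\<close> carries only one letter, so \<open>l\<close> and \<open>l'\<close> share a single geometric series.
\<close>
lemma tail_weight_add_le:
  assumes "l \<noteq> l'"
  shows "tail_weight x l + tail_weight x l' \<le> \<tau> / (1 - \<tau>)"
proof -
  have "tail_weight x l + tail_weight x l' \<le> (\<Sum>k. \<tau> * \<tau> ^ k)"
    unfolding tail_weight_def suminf_add[OF summable_tail_weight summable_tail_weight]
    using assms tau_nonneg
    by (intro suminf_le summable_add summable_tail_weight summable_mult summable_tau) auto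
  also have "\<dots> = \<tau> / (1 - \<tau>)"
    using suminf_geometric[of \<tau>] tau_nonneg tau_less_1 by (simp add: suminf_mult[OF summable_tau])
  finally show ?thesis .
qed

lemma coding_map_axis:
  "norm (coding_map T (axis l v) x - (if x 0 = l then v else 0)) \<le> tail_weight x l * norm v"
proof -
  let ?f = "coding_term (axis l v) x"
  let ?g = "\<lambda>k. if x (Suc k) = l then \<tau> ^ Suc k else 0"
  have bound: "norm (?f (Suc k)) \<le> ?g k * norm v" for k
    using norm_coding_term[of "axis l v" x "Suc k"] by (auto simp: axis_def)
  have sum: "summable (\<lambda>k. norm (?f (Suc k)))"
    using summable_norm_coding_term by (subst summable_Suc_iff)
  have "coding_map T (axis l v) x = ?f 0 + (\<Sum>k. ?f (Suc k))"
    unfolding coding_map_eq using suminf_split_head[OF summable_coding_term, of "axis l v" x] by simp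
  moreover have "?f 0 = (if x 0 = l then v else 0)"
    by (simp add: coding_term_def axis_def)
  ultimately have "norm (coding_map T (axis l v) x - (if x 0 = l then v else 0)) = norm (\<Sum>k. ?f (Suc k))"
    by simp
  also have "\<dots> \<le> (\<Sum>k. norm (?f (Suc k)))"
    by (rule summable_norm[OF sum])
  also have "\<dots> \<le> (\<Sum>k. ?g k * norm v)"
    by (rule suminf_le[OF bound sum summable_mult2[OF summable_tail_weight]])
  also have "\<dots> = tail_weight x l * norm v"
    unfolding tail_weight_def by (rule suminf_mult2[OF summable_tail_weight, symmetric])
  finally show ?thesis .
qed

text \<open>
  The coefficient of \<open>a\<^bsub>x 0\<^esub>\<close> in \<open>\<pi>(x) - \<pi>(y)\<close> is the identity plus an error, and that of \<open>a\<^bsub>y 0\<^esub>\<close> is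
  minus the identity plus an error. The two errors together are bounded by \<open>2 \<tau> / (1 - \<tau>)\<close>, so one of
  them is at most \<open>\<tau> / (1 - \<tau>)\<close>, which is less than \<open>1\<close> exactly when \<open>\<tau> < 1/2\<close>. This choice between
  the two letters, due to Solomyak, is what allows the constant \<open>1/2\<close> instead of \<open>1/3\<close>.
\<close>
lemma coding_map_separates_some_letter:
  assumes ne: "x 0 \<noteq> y 0"
  shows "\<exists>l. \<forall>v. (1 - \<tau> / (1 - \<tau>)) * norm v \<le> norm (coding_map T (axis l v) x - coding_map T (axis l v) y)"
proof -
  have key: "(1 - (tail_weight x l + tail_weight y l)) * norm v \<le> norm (coding_map T (axis l v) x - coding_map T (axis l v) y)"
    if l: "l = x 0 \<or> l = y 0" for l v
  proof -
    let ?x = "coding_map T (axis l v) x - (if x 0 = l then v else 0)"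
    let ?y = "coding_map T (axis l v) y - (if y 0 = l then v else 0)"
    let ?d = "(if x 0 = l then v else 0) - (if y 0 = l then v else 0)"
    have "norm v = norm ?d" using l ne by auto
    also have "?d = (coding_map T (axis l v) x - coding_map T (axis l v) y) - ?x + ?y" by simp
    also have "norm \<dots> \<le> norm (coding_map T (axis l v) x - coding_map T (axis l v) y) + norm ?x + norm ?y"
      by (meson add_right_mono norm_triangle_ineq norm_triangle_ineq4 order_trans)
    also have "\<dots> \<le> norm (coding_map T (axis l v) x - coding_map T (axis l v) y)
        + tail_weight x l * norm v + tail_weight y l * norm v"
      by (intro add_mono order_refl coding_map_axis)
    finally show ?thesis by (simp add: algebra_simps)
  qed
  have "(tail_weight x (x 0) + tail_weight y (x 0)) + (tail_weight x (y 0) + tail_weight y (y 0)) \<le> 2 * (\<tau> / (1 - \<tau>))"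
    using tail_weight_add_le[OF ne, of x] tail_weight_add_le[OF ne, of y] by linarith
  then have "tail_weight x (x 0) + tail_weight y (x 0) \<le> \<tau> / (1 - \<tau>) \<or>
      tail_weight x (y 0) + tail_weight y (y 0) \<le> \<tau> / (1 - \<tau>)" by linarith
  then obtain l where l: "l = x 0 \<or> l = y 0" "tail_weight x l + tail_weight y l \<le> \<tau> / (1 - \<tau>)"
    by blast
  have "(1 - \<tau> / (1 - \<tau>)) * norm v \<le> norm (coding_map T (axis l v) x - coding_map T (axis l v) y)" for v
    using order_trans[OF mult_right_mono[OF _ norm_ge_zero] key[OF l(1)], of "1 - \<tau> / (1 - \<tau>)" v] l(2) by simp
  then show ?thesis by blast
qed

lemma norm_vec_le_sum: fixes w :: "real^'d^'m" shows "norm w \<le> (\<Sum>k\<in>UNIV. norm (w $ k))"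
  unfolding norm_vec_def by (rule L2_set_le_sum) simp

text \<open>
  With \<open>I = x \<and> y\<close> one has \<open>\<pi>(x) - \<pi>(y) = T\<^sub>I (g a)\<close>, where \<open>g\<close> is linear in \<open>a\<close>. Replacing the block \<open>a\<^sub>l\<close>
  of a separated letter \<open>l\<close> by the coordinates of \<open>g a\<close> in the frame of right singular vectors of \<open>T\<^sub>I\<close>
  gives an expansive system of coordinates for \<open>a\<close>. In these coordinates the set in question lies
  in a box whose sides in the block of \<open>l\<close> are of order \<open>min 1 (u / \<sigma> i)\<close> and whose other sides are bounded.
\<close>
lemma transversality:
  assumes half: "\<tau> < 1 / 2" and \<rho>: "\<rho> > 0"
  shows "\<exists>C>0. \<forall>x y u. u > 0 \<longrightarrow>
    emeasure lborel {a :: real^'d^'m. norm a \<le> \<rho> \<and> dist (coding_map T a x) (coding_map T a y) \<le> u}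
      \<le> ennreal (C * Z_kernel T u x y)"
proof -
  define c where "c = 1 - \<tau> / (1 - \<tau>)"
  define G where "G = 2 / (1 - \<tau>)"
  define m where "m = real CARD('m)"
  define d where "d = real CARD('d)"
  \<comment> \<open>if all new coordinates of \<open>w\<close> are at most \<open>t\<close>, the blocks other than \<open>l\<close> have norm at most \<open>m d t\<close>,
    and solving for the block \<open>l\<close> gives norm at most \<open>(d t + G m d t) / c\<close>\<close>
  define K where "K = m * d + (d + G * (m * d)) / c"
  define H where "H = max 1 (max \<rho> (G * \<rho>))"
  define n where "n = DIM(real^'d^'m)"
  define C where "C = max (unit_ball_vol n * (4 * K) ^ n * H ^ n) (unit_ball_vol n * \<rho> ^ n)"
  have c: "c > 0" using half tau_nonneg by (simp add: c_def field_simps)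
  have G: "G > 0" using tau_less_1 by (simp add: G_def)
  have md: "m > 0" "d > 0" by (simp_all add: m_def d_def)
  have K: "K > 0" using c G md by (simp add: K_def add_pos_pos)
  have H: "H \<ge> 1" "H \<ge> \<rho>" "H \<ge> G * \<rho>" by (auto simp: H_def)
  have "C > 0" using \<rho> by (simp add: C_def less_max_iff_disj)
  moreover have "emeasure lborel {a :: real^'d^'m. norm a \<le> \<rho> \<and> dist (coding_map T a x) (coding_map T a y) \<le> u}
      \<le> ennreal (C * Z_kernel T u x y)" (is "emeasure lborel ?S \<le> _") if u: "u > 0" for x y u
  proof (cases "x = y")
    case True
    then have "?S \<subseteq> cball 0 \<rho>" by auto
    then have "emeasure lborel ?S \<le> emeasure lborel (cball (0 :: real^'d^'m) \<rho>)" by (intro emeasure_mono) auto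
    also have "\<dots> = ennreal (unit_ball_vol n * \<rho> ^ n)" using \<rho> by (simp add: emeasure_cball n_def)
    also have "\<dots> \<le> ennreal (C * Z_kernel T u x y)" using True by (intro ennreal_leI) (simp add: Z_kernel_def C_def)
    finally show ?thesis .
  next
    case False
    define N where "N = (LEAST k. x k \<noteq> y k)"
    have "\<exists>k. x k \<noteq> y k" using False by (simp add: fun_eq_iff)
    then have ne: "x N \<noteq> y N" unfolding N_def by (rule LeastI_ex)
    have pre: "x k = y k" if "k < N" for k
      using not_less_Least[OF that[unfolded N_def]] by simp
    define A where "A = matrix_word T (map x [0..<N])"
    have A: "A = matrix_word T (common_prefix x y)" by (simp add: A_def N_def common_prefix_def)
    have inv: "invertible A" by (simp add: A_def invertible_matrix_word)
    define x' where "x' = (\<lambda>k. x (k + N))"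
    define y' where "y' = (\<lambda>k. y (k + N))"
    define g where "g a = coding_map T a x' - coding_map T a y'" for a
    have gl: "bounded_linear g"
      unfolding g_def by (intro bounded_linear_sub bounded_linear_coding_map)
    have gdiff: "g a - g b = g (a - b)" for a b
      by (simp add: linear_diff[OF bounded_linear.linear[OF gl]])
    have gnorm: "norm (g a) \<le> G * norm a" for a
      using norm_triangle_ineq4[of "coding_map T a x'" "coding_map T a y'"]
        norm_coding_map_le[of a x'] norm_coding_map_le[of a y'] by (simp add: g_def G_def)
    have dist: "dist (coding_map T a x) (coding_map T a y) = norm (A *v g a)" for a
      using coding_map_diff_common_prefix[OF pre, where a = a] by (simp add: dist_norm A_def g_def x'_def y'_def)
    obtain l where l: "\<And>v. c * norm v \<le> norm (g (axis l v))"
      using coding_map_separates_some_letter[of x' y'] ne by (auto simp: c_def g_def x'_def y'_def)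
    obtain q \<sigma> where svd: "svd A q \<sigma>" using singular_value_decomposition[OF inv] by blast
    note q = svdD(2)[OF svd] and pos = svdD(1)[OF svd]
    define f where "f a = (\<lambda>(k, i). if k = l then q i \<bullet> g a else a $ k $ i)" for a :: "real^'d^'m"
    define L where "L = (\<lambda>(k, i). if k = l then H * min 1 (u / \<sigma> i) else H)"
    have Lprod: "(\<Prod>ki\<in>UNIV. L ki) = H ^ n * sv_kernel A u"
    proof -
      have "(\<Prod>ki\<in>UNIV. L ki) = (\<Prod>ki\<in>UNIV. H * (if fst ki = l then min 1 (u / \<sigma> (snd ki)) else 1))"
        by (intro prod.cong) (auto simp: L_def)
      also have "\<dots> = H ^ n * (\<Prod>k\<in>UNIV. \<Prod>i\<in>UNIV. if k = l then min 1 (u / \<sigma> i) else 1)"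
        unfolding prod.distrib by (simp add: n_def prod.cartesian_product case_prod_unfold)
      also have "(\<Prod>k\<in>UNIV. \<Prod>i\<in>UNIV. if k = l then min 1 (u / \<sigma> i) else 1)
          = (\<Prod>k\<in>UNIV. if k = l then (\<Prod>i\<in>UNIV. min 1 (u / \<sigma> i)) else 1)"
        by (intro prod.cong) auto
      also have "\<dots> = sv_kernel A u"
        using svdD(4)[OF svd, of "\<lambda>\<alpha>. min 1 (u / \<alpha>)"] by (simp add: sv_kernel_def)
      finally show ?thesis .
    qed
    have expansive: "norm (a - b) \<le> K * t" if t: "\<And>ki. \<bar>f a ki - f b ki\<bar> \<le> t" for a b t
    proof -
      define w where "w = a - b"
      define w' where "w' = w - axis l (w $ l)"
      have t0: "t \<ge> 0" using t[of "undefined"] by linarith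
      have gw: "norm (g w) \<le> d * t"
        unfolding d_def
      proof (rule norm_le_sum_inner[OF q])
        show "\<bar>q i \<bullet> g w\<bar> \<le> t" for i
          using t[of "(l, i)"] by (simp add: f_def w_def gdiff[symmetric] inner_diff_right)
      qed
      have "norm (w' $ k) \<le> d * t" for k
      proof (cases "k = l")
        case False
        have "norm (w $ k) \<le> (\<Sum>i\<in>(UNIV::'d set). t)"
          by (rule order_trans[OF norm_le_l1_cart sum_mono]) (use t[of "(k, _)"] False in \<open>simp add: f_def w_def\<close>)
        then show ?thesis using False by (simp add: w'_def d_def axis_def)
      qed (use t0 md in \<open>simp add: w'_def\<close>)
      then have "(\<Sum>k\<in>UNIV. norm (w' $ k)) \<le> (\<Sum>k\<in>(UNIV :: 'm set). d * t)" by (intro sum_mono)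
      then have w': "norm w' \<le> m * d * t"
        using norm_vec_le_sum[of w'] by (simp add: m_def)
      have "axis l (w $ l) = w - w'" by (simp add: w'_def)
      then have "c * norm (w $ l) \<le> norm (g w - g w')"
        using l[of "w $ l"] by (simp add: gdiff)
      also have "\<dots> \<le> norm (g w) + norm (g w')" by (rule norm_triangle_ineq4)
      also have "\<dots> \<le> d * t + G * (m * d * t)"
        using gw gnorm[of w'] mult_left_mono[OF w', of G] G by linarith
      finally have wl: "norm (w $ l) \<le> (d + G * (m * d)) / c * t"
        using c by (simp add: field_simps)
      have "norm w \<le> norm w' + norm (axis l (w $ l))"
        using norm_triangle_ineq[of w' "axis l (w $ l)"] by (simp add: w'_def)
      also have "norm (axis l (w $ l)) = norm (w $ l)" by (simp add: norm_eq_sqrt_inner inner_axis)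
      finally show ?thesis
        using w' wl by (simp add: K_def w_def[symmetric] distrib_right)
    qed
    have Lpos: "L ki > 0" for ki
      using u pos H(1) by (auto simp: L_def split: prod.splits)
    have inS: "\<bar>f a ki\<bar> \<le> L ki" if a: "a \<in> ?S" for a ki
    proof (cases ki)
      case (Pair k i)
      show ?thesis
      proof (cases "k = l")
        case True
        have na: "norm a \<le> \<rho>" "norm (A *v g a) \<le> u" using a by (auto simp: dist)
        have "\<bar>q i \<bullet> g a\<bar> \<le> norm (g a)"
          using Cauchy_Schwarz_ineq2[of "q i" "g a"] svd_norms(1)[OF svd, of i] by simp
        also have "\<dots> \<le> G * \<rho>" using gnorm[of a] mult_left_mono[OF na(1), of G] G by linarith
        finally have 1: "\<bar>q i \<bullet> g a\<bar> \<le> H" using H by linarith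
        have "\<sigma> i * \<bar>q i \<bullet> g a\<bar> \<le> u"
          using svd_coordinate_le[OF svd, of i "g a"] na(2) by linarith
        then have "\<bar>q i \<bullet> g a\<bar> \<le> u / \<sigma> i"
          using pos[of i] by (simp add: field_simps)
        also have "\<dots> \<le> H * (u / \<sigma> i)" using H(1) u pos[of i] by (simp add: divide_right_mono)
        finally have "\<bar>q i \<bullet> g a\<bar> \<le> H * min 1 (u / \<sigma> i)" using 1 by (simp add: min_def)
        then show ?thesis using True Pair by (simp add: f_def L_def)
      next
        case False
        have "\<bar>a $ k $ i\<bar> \<le> norm (a $ k)" by (rule component_le_norm_cart)
        also have "\<dots> \<le> norm a" by (rule Finite_Cartesian_Product.norm_nth_le)
        also have "\<dots> \<le> H" using a H by auto
        finally show ?thesis using False Pair by (simp add: f_def L_def)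
      qed
    qed
    have "emeasure lborel ?S \<le> ennreal (unit_ball_vol DIM(real^'d^'m) * (4 * K) ^ DIM(real^'d^'m) * (\<Prod>ki\<in>UNIV. L ki))"
      by (rule expansive_preimage_measure[where f = f and l = L, OF _ K expansive Lpos inS]) simp
    also have "\<dots> = ennreal (unit_ball_vol n * (4 * K) ^ n * H ^ n * sv_kernel A u)"
      unfolding Lprod n_def[symmetric] by (simp add: mult_ac)
    also have "\<dots> \<le> ennreal (C * sv_kernel A u)"
      using sv_kernel_pos[OF inv u] by (intro ennreal_leI mult_right_mono) (auto simp: C_def)
    also have "C * sv_kernel A u = C * Z_kernel T u x y"
      using False by (simp add: Z_kernel_def A sv_kernel_def)
    finally show ?thesis .
  qed
  ultimately show ?thesis by blast
qed

end

section \<open>The kernels on sequence space\<close>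

locale affine_ifs_coding = contracting_matrices T for T :: "'m::finite \<Rightarrow> real^'d^'d" +
  fixes \<theta> :: real and E :: "(nat \<Rightarrow> 'm) set"
  assumes theta_pos: "0 < \<theta>" and theta_le_1: "\<theta> \<le> 1" and E_nonempty: "E \<noteq> {}"

begin

abbreviation J :: "real \<Rightarrow> real \<Rightarrow> (nat \<Rightarrow> 'm) \<Rightarrow> (nat \<Rightarrow> 'm) \<Rightarrow> real" where
  "J \<equiv> J_kernel T \<theta>"

text \<open>
  The value of \<open>J\<close> at any two sequences whose longest common prefix is \<open>I\<close>.
\<close>
definition word_kernel :: "real \<Rightarrow> real \<Rightarrow> 'm list \<Rightarrow> real" where
  "word_kernel s r I = (SUP u\<in>{r powr (1 / \<theta>)..r}. u powr (- s) * sv_kernel (matrix_word T I) u)"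

text \<open>
  The length of the common prefix, cut off at \<open>N\<close>. Counting instead of minimising covers the case
  \<open>x = y\<close> and makes it evident that only the first \<open>N\<close> letters matter.
\<close>
definition agreement :: "nat \<Rightarrow> (nat \<Rightarrow> 'm) \<Rightarrow> (nat \<Rightarrow> 'm) \<Rightarrow> nat" where
  "agreement N x y = card {k. k < N \<and> (\<forall>i\<le>k. x i = y i)}"

lemma Z_kernel_eq_sv:
  "Z_kernel T u x y = (if x = y then 1 else sv_kernel (matrix_word T (common_prefix x y)) u)"
  by (simp add: Z_kernel_def sv_kernel_def)

lemma Z_kernel_pos: "u > 0 \<Longrightarrow> Z_kernel T u x y > 0"
  by (simp add: Z_kernel_eq_sv sv_kernel_pos invertible_matrix_word)

lemma Z_kernel_le_1: "u > 0 \<Longrightarrow> Z_kernel T u x y \<le> 1"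
  by (simp add: Z_kernel_eq_sv sv_kernel_le_1 invertible_matrix_word)

lemma Z_kernel_scale: "0 < u \<Longrightarrow> u \<le> c * v \<Longrightarrow> 1 \<le> c \<Longrightarrow> Z_kernel T u x y \<le> c ^ CARD('d) * Z_kernel T v x y"
  by (simp add: Z_kernel_eq_sv sv_kernel_scale invertible_matrix_word one_le_power)

lemma Z_kernel_ge_power: "0 < u \<Longrightarrow> u \<le> 1 \<Longrightarrow> u ^ CARD('d) \<le> Z_kernel T u x y"
  by (simp add: Z_kernel_eq_sv sv_kernel_ge_power invertible_matrix_word onorm_matrix_word_le_1 power_le_one)

lemma window:
  assumes "0 < r" "r < 1"
  shows "0 < r powr (1 / \<theta>)" "r powr (1 / \<theta>) \<le> r"
proof -
  show "0 < r powr (1 / \<theta>)" using assms by simp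
  have "r powr (1 / \<theta>) \<le> r powr 1"
    using assms theta_pos theta_le_1 by (intro powr_mono') (auto simp: field_simps)
  then show "r powr (1 / \<theta>) \<le> r" using assms by simp
qed

lemma window_pos: "0 < r \<Longrightarrow> u \<in> {r powr (1 / \<theta>)..r} \<Longrightarrow> 0 < u"
  using powr_gt_zero[of r "1 / \<theta>"] by (simp only: atLeastAtMost_iff) linarith

lemma window_sup_ge:
  assumes r: "0 < r" and s: "0 \<le> s" and u: "u \<in> {r powr (1 / \<theta>)..r}"
    and z: "\<And>v. 0 < v \<Longrightarrow> 0 \<le> z v \<and> z v \<le> 1"
  shows "u powr (- s) * z u \<le> (SUP v\<in>{r powr (1 / \<theta>)..r}. v powr (- s) * z v)"
proof (rule cSUP_upper[OF u], rule bdd_aboveI2)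
  fix v assume v: "v \<in> {r powr (1 / \<theta>)..r}"
  then have "0 < v" by (rule window_pos[OF r])
  moreover have "v powr (- s) \<le> (r powr (1 / \<theta>)) powr (- s)"
    using r s v by (intro powr_mono2') auto
  ultimately show "v powr (- s) * z v \<le> (r powr (1 / \<theta>)) powr (- s)"
    using z[of v] mult_mono[of "v powr (- s)" "(r powr (1 / \<theta>)) powr (- s)" "z v" 1] by simp
qed

lemma J_ge:
  assumes "0 < r" "0 \<le> s" "u \<in> {r powr (1 / \<theta>)..r}"
  shows "u powr (- s) * Z_kernel T u x y \<le> J s r x y"
  unfolding J_kernel_def
  by (rule window_sup_ge[OF assms]) (simp add: Z_kernel_pos Z_kernel_le_1 less_imp_le)

lemma J_le:
  assumes "0 < r" "r < 1" "\<And>u. u \<in> {r powr (1 / \<theta>)..r} \<Longrightarrow> u powr (- s) * Z_kernel T u x y \<le> b"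
  shows "J s r x y \<le> b"
  unfolding J_kernel_def using assms window[of r] by (intro cSUP_least) auto

lemma J_pos: assumes "0 < r" "r < 1" "0 \<le> s" shows "0 < J s r x y"
proof -
  have "0 < r powr (- s) * Z_kernel T r x y" using assms by (simp add: Z_kernel_pos)
  also have "\<dots> \<le> J s r x y" using assms window[of r] by (intro J_ge) auto
  finally show ?thesis .
qed

lemma J_zero_le_1: assumes "0 < r" "r < 1" shows "J 0 r x y \<le> 1"
proof (rule J_le[OF assms])
  fix u assume "u \<in> {r powr (1 / \<theta>)..r}"
  then have "u > 0" using window_pos[OF assms(1)] by blast
  then show "u powr - 0 * Z_kernel T u x y \<le> 1" by (simp add: Z_kernel_le_1)
qed

lemma J_dim_ge_1: assumes "0 < r" "r < 1" shows "1 \<le> J (real CARD('d)) r x y"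
proof -
  have "1 = r powr (- real CARD('d)) * r ^ CARD('d)"
    using assms by (simp add: powr_minus powr_realpow)
  also have "\<dots> \<le> r powr (- real CARD('d)) * Z_kernel T r x y"
    using assms by (intro mult_left_mono Z_kernel_ge_power) auto
  also have "\<dots> \<le> J (real CARD('d)) r x y"
    using assms window[of r] by (intro J_ge) auto
  finally show ?thesis .
qed

text \<open>
  Together with the next estimate: raising the exponent from \<open>s\<close> to \<open>t\<close> multiplies each term by
  \<open>u\<^bsup>-(t-s)\<^esup>\<close>, and \<open>u\<close> lies between \<open>r\<^bsup>1/\<theta>\<^esup>\<close> and \<open>r\<close>.
\<close>
lemma J_exponent_lower:
  assumes "0 < r" "r < 1" "0 \<le> s" "s \<le> t"
  shows "J s r x y \<le> r powr (t - s) * J t r x y"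
proof (rule J_le[OF assms(1,2)])
  fix u assume u: "u \<in> {r powr (1 / \<theta>)..r}"
  then have u0: "u > 0" using window_pos[OF assms(1)] by blast
  have "u powr (- s) * Z_kernel T u x y = u powr (t - s) * (u powr (- t) * Z_kernel T u x y)"
    using u0 by (simp flip: powr_add mult.assoc)
  also have "\<dots> \<le> r powr (t - s) * J t r x y"
    using u u0 assms J_ge[of r t u x y] Z_kernel_pos[of u x y]
    by (intro mult_mono powr_mono2) (auto intro!: mult_nonneg_nonneg less_imp_le)
  finally show "u powr (- s) * Z_kernel T u x y \<le> r powr (t - s) * J t r x y" .
qed

lemma J_exponent_upper:
  assumes "0 < r" "r < 1" "0 \<le> s" "s \<le> t"
  shows "J t r x y \<le> r powr (- (t - s) / \<theta>) * J s r x y"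
proof (rule J_le[OF assms(1,2)])
  fix u assume u: "u \<in> {r powr (1 / \<theta>)..r}"
  then have u0: "u > 0" using window_pos[OF assms(1)] by blast
  have "u powr (- t) * Z_kernel T u x y = u powr (- (t - s)) * (u powr (- s) * Z_kernel T u x y)"
    using u0 by (simp flip: powr_add mult.assoc)
  also have "\<dots> \<le> (r powr (1 / \<theta>)) powr (- (t - s)) * J s r x y"
    using u u0 assms J_ge[of r s u x y] Z_kernel_pos[of u x y] window[OF assms(1,2)]
    by (intro mult_mono powr_mono2') (auto intro!: mult_nonneg_nonneg less_imp_le)
  also have "(r powr (1 / \<theta>)) powr (- (t - s)) = r powr (- (t - s) / \<theta>)"
    by (simp add: powr_powr)
  finally show "u powr (- t) * Z_kernel T u x y \<le> r powr (- (t - s) / \<theta>) * J s r x y" .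
qed

text \<open>
  Once the common prefix has length \<open>N\<close>, all singular values are at most \<open>r\<^bsup>1/\<theta>\<^esup>\<close>, so \<open>Z\<^sub>u = 1\<close> for all
  \<open>u\<close> in the window and \<open>J\<close> already has its value on the diagonal.
\<close>
lemma J_eq_word_kernel:
  assumes r: "0 < r" "r < 1" and N: "\<tau> ^ N \<le> r powr (1 / \<theta>)"
  shows "J s r x y = word_kernel s r (map x [0..<agreement N x y])"
proof -
  have saturated: "sv_kernel (matrix_word T I) u = 1"
    if "N \<le> length I" "u \<in> {r powr (1 / \<theta>)..r}" for I u
  proof (rule sv_kernel_eq_1[OF invertible_matrix_word])
    have "onorm ((*v) (matrix_word T I)) \<le> \<tau> ^ length I" by (rule onorm_matrix_word_le)
    also have "\<dots> \<le> \<tau> ^ N" using that tau_nonneg tau_less_1 by (intro power_decreasing) auto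
    also have "\<dots> \<le> u" using N that by simp
    finally show "onorm ((*v) (matrix_word T I)) \<le> u" .
  qed
  have "Z_kernel T u x y = sv_kernel (matrix_word T (map x [0..<agreement N x y])) u"
    if u: "u \<in> {r powr (1 / \<theta>)..r}" for u
  proof (cases "x = y")
    case True
    then have "agreement N x y = N" by (simp add: agreement_def)
    then show ?thesis using True saturated[OF _ u, of "map x [0..<N]"] by (simp add: Z_kernel_eq_sv)
  next
    case False
    define L where "L = (LEAST k. x k \<noteq> y k)"
    have "\<exists>k. x k \<noteq> y k" using False by (simp add: fun_eq_iff)
    then have ne: "x L \<noteq> y L" unfolding L_def by (rule LeastI_ex)
    have pre: "x k = y k" if "k < L" for k
      using not_less_Least[OF that[unfolded L_def]] by simp
    have "(\<forall>i\<le>k. x i = y i) \<longleftrightarrow> k < L" for k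
      using ne pre by (meson le_less_trans not_le)
    then have "{k. k < N \<and> (\<forall>i\<le>k. x i = y i)} = {..<min N L}" by auto
    then have ag: "agreement N x y = min N L" by (simp add: agreement_def)
    show ?thesis
    proof (cases "L < N")
      case True
      then show ?thesis using False ag by (simp add: Z_kernel_eq_sv common_prefix_def L_def)
    next
      case notless: False
      then have "min N L = N" by simp
      then show ?thesis
        using False ag notless saturated[OF _ u, of "map x [0..<N]"] saturated[OF _ u, of "map x [0..<L]"]
        by (simp add: Z_kernel_eq_sv common_prefix_def L_def)
    qed
  qed
  then show ?thesis
    unfolding J_kernel_def word_kernel_def by (intro SUP_cong) auto
qed

lemma saturation_level_exists: "0 < r \<Longrightarrow> \<exists>N. \<tau> ^ N \<le> r powr (1 / \<theta>)"
  using real_arch_pow_inv[OF _ tau_less_1, of "r powr (1 / \<theta>)"] by (auto intro: less_imp_le)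

lemma agreement_prefix_cong:
  assumes "\<And>k. k < N \<Longrightarrow> x k = x' k" "\<And>k. k < N \<Longrightarrow> y k = y' k"
  shows "agreement N x y = agreement N x' y'"
proof -
  have "{k. k < N \<and> (\<forall>i\<le>k. x i = y i)} = {k. k < N \<and> (\<forall>i\<le>k. x' i = y' i)}"
    using assms by (auto dest: le_less_trans)
  then show ?thesis by (simp add: agreement_def)
qed

lemma agreement_le: "agreement N x y \<le> N"
  unfolding agreement_def by (rule order_trans[OF card_mono[of "{..<N}"]]) auto

lemma agreement_agree: assumes "k < agreement N x y" shows "x k = y k"
proof (rule ccontr)
  assume "x k \<noteq> y k"
  then have "{j. j < N \<and> (\<forall>i\<le>j. x i = y i)} \<subseteq> {..<k}" by (auto simp: not_less[symmetric])
  then have "agreement N x y \<le> k"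
    unfolding agreement_def using card_mono[of "{..<k}"] by fastforce
  then show False using assms by simp
qed

lemma J_prefix_cong:
  assumes "0 < r" "r < 1" and N: "\<tau> ^ N \<le> r powr (1 / \<theta>)"
    and xy: "\<And>k. k < N \<Longrightarrow> x k = x' k" "\<And>k. k < N \<Longrightarrow> y k = y' k"
  shows "J s r x y = J s r x' y'"
proof -
  have "agreement N x y = agreement N x' y'" using xy by (rule agreement_prefix_cong)
  moreover have "map x [0..<agreement N x' y'] = map x' [0..<agreement N x' y']"
    using xy(1) agreement_le[of N x' y'] by simp
  ultimately show ?thesis by (simp only: J_eq_word_kernel[OF assms(1-3)])
qed

end

section \<open>Cylinders and measures on sequence space\<close>

lemma sets_seq_borel: "sets (seq_borel :: (nat \<Rightarrow> 'm) measure) = sigma_sets UNIV {U. openin seq_topology U}"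
  by (simp add: seq_borel_def)

lemma space_seq_borel: "space (seq_borel :: (nat \<Rightarrow> 'm) measure) = UNIV"
  by (simp add: seq_borel_def)

lemma topspace_seq_topology: "topspace (seq_topology :: (nat \<Rightarrow> 'm) topology) = UNIV"
  by (simp add: seq_topology_def Metric_space.topspace_mtopology[OF Metric_space_seq_dist])

lemma closedin_seq_borel:
  assumes "closedin seq_topology (K :: (nat \<Rightarrow> 'm) set)" shows "K \<in> sets seq_borel"
proof -
  have "openin seq_topology (UNIV - K)"
    using assms by (simp add: closedin_def topspace_seq_topology)
  then have "UNIV - (UNIV - K) \<in> sigma_sets UNIV {U. openin seq_topology U}"
    by (intro sigma_sets.Compl sigma_sets.Basic) simp
  then show ?thesis by (simp add: sets_seq_borel double_diff)
qed

definition cylinder :: "'m list \<Rightarrow> (nat \<Rightarrow> 'm) set" where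
  "cylinder I = {x. map x [0..<length I] = I}"

lemma cylinder_append_disjoint:
  assumes "x \<in> cylinder (I @ [j])" "x \<in> cylinder K" "length I < length K" shows "K ! length I = j"
proof -
  have "K ! length I = map x [0..<length K] ! length I" using assms(2) by (simp add: cylinder_def)
  also have "\<dots> = x (length I)" using assms(3) by simp
  also have "\<dots> = map x [0..<length (I @ [j])] ! length I" by (simp add: nth_append)
  also have "\<dots> = j" using assms(1) by (simp only: cylinder_def mem_Collect_eq nth_append_length)
  finally show ?thesis .
qed

lemma cylinder_append_subset: "cylinder (I @ [j]) \<subseteq> cylinder I"
  by (auto simp: cylinder_def)

lemma cylinder_split: "x \<in> cylinder I \<Longrightarrow> x \<in> cylinder (I @ [x (length I)])"
  by (simp add: cylinder_def)

lemma cylinder_unique: "x \<in> cylinder I \<Longrightarrow> x \<in> cylinder K \<Longrightarrow> length I = length K \<Longrightarrow> I = K"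
  by (simp add: cylinder_def)

lemma openin_cylinder: "openin seq_topology (cylinder I :: (nat \<Rightarrow> 'm) set)"
proof -
  interpret Metric_space "UNIV :: (nat \<Rightarrow> 'm) set" seq_dist by (rule Metric_space_seq_dist)
  have "mball x (exp (- real (length I))) \<subseteq> cylinder I" if x: "x \<in> cylinder I" for x
  proof
    fix y assume "y \<in> mball x (exp (- real (length I)))"
    then have d: "seq_dist x y < exp (- real (length I))" by simp
    show "y \<in> cylinder I"
    proof (cases "x = y")
      case False
      then have "length I < (LEAST n. x n \<noteq> y n)"
        using d by (simp add: seq_dist_def common_prefix_def)
      then have "x k = y k" if "k < length I" for k
        using not_less_Least[of k "\<lambda>n. x n \<noteq> y n"] that by simp
      then have "map y [0..<length I] = map x [0..<length I]" by simp
      then show ?thesis using x by (simp only: cylinder_def mem_Collect_eq)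
    qed (use x in simp)
  qed
  then show ?thesis
    unfolding seq_topology_def openin_mtopology by (auto intro!: exI[of _ "exp (- real (length I))"])
qed

lemma cylinder_seq_borel: "cylinder I \<in> sets seq_borel"
  unfolding sets_seq_borel by (intro sigma_sets.Basic) (simp add: openin_cylinder)

lemma finite_words: "finite {I :: 'm::finite list. length I = N}"
  using finite_lists_length_eq[of "UNIV :: 'm set" N] by simp

lemma prefix_function_eq_sum:
  fixes f :: "'m::finite list \<Rightarrow> real"
  shows "f (map x [0..<N]) = (\<Sum>I\<in>{I. length I = N}. indicator (cylinder I) x * f I)"
proof -
  have "(\<Sum>I\<in>{I. length I = N}. indicator (cylinder I) x * f I) = (\<Sum>I\<in>{map x [0..<N]}. f I)"
    using finite_words[where 'm = 'm]
    by (intro sum.mono_neutral_cong_right) (auto simp: cylinder_def indicator_def)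
  then show ?thesis by simp
qed

lemma integral_prefix_function:
  fixes f :: "'m::finite list \<Rightarrow> real"
  assumes "prob_space \<mu>" "sets \<mu> = sets seq_borel"
  shows "(\<integral>x. f (map x [0..<N]) \<partial>\<mu>) = (\<Sum>I\<in>{I. length I = N}. measure \<mu> (cylinder I) * f I)"
proof -
  interpret prob_space \<mu> by fact
  have c: "cylinder I \<in> sets \<mu>" for I :: "'m list" by (simp add: assms(2) cylinder_seq_borel)
  have "(\<integral>x. f (map x [0..<N]) \<partial>\<mu>) = (\<integral>x. (\<Sum>I\<in>{I. length I = N}. indicator (cylinder I) x * f I) \<partial>\<mu>)"
    by (simp only: prefix_function_eq_sum)
  also have "\<dots> = (\<Sum>I\<in>{I. length I = N}. (\<integral>x. indicator (cylinder I) x * f I \<partial>\<mu>))"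
    using c by (intro Bochner_Integration.integral_sum integrable_mult_left integrable_real_indicator) (auto simp: emeasure_eq_measure)
  also have "\<dots> = (\<Sum>I\<in>{I. length I = N}. measure \<mu> (cylinder I) * f I)"
    using c sets.sets_into_space by (intro sum.cong) (auto simp: Int_absorb2)
  finally show ?thesis .
qed

lemma prefix_function_measurable:
  fixes f :: "'m::finite list \<Rightarrow> real"
  shows "(\<lambda>x. f (map x [0..<N])) \<in> borel_measurable seq_borel"
  unfolding prefix_function_eq_sum using cylinder_seq_borel by measurable

section \<open>Capacity as a minimum over finite weights\<close>

context affine_ifs_coding
begin

definition discrete_energy :: "real \<Rightarrow> real \<Rightarrow> (nat \<Rightarrow> 'm) set \<Rightarrow> ((nat \<Rightarrow> 'm) \<Rightarrow> real) \<Rightarrow> real" where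
  "discrete_energy s r R p = (\<Sum>x\<in>R. \<Sum>y\<in>R. p x * p y * J s r x y)"

text \<open>
  Weights live on points of \<open>E\<close> and not of its closure, so that covers of \<open>\<pi>(E)\<close> can be tested against
  them directly.
\<close>
definition weights :: "((nat \<Rightarrow> 'm) set \<times> ((nat \<Rightarrow> 'm) \<Rightarrow> real)) set" where
  "weights = {(R, p). finite R \<and> R \<subseteq> E \<and> (\<forall>x\<in>R. 0 \<le> p x) \<and> sum p R = 1}"

definition min_energy :: "real \<Rightarrow> real \<Rightarrow> real" where
  "min_energy s r = (INF (R, p)\<in>weights. discrete_energy s r R p)"

text \<open>
  Since \<open>J\<close> depends only on prefixes of length \<open>N\<close>, the mass of each cylinder of level \<open>N\<close> can be moved
  to a single point. A cylinder that misses \<open>E\<close>, being open, misses the closure of \<open>E\<close> and has no mass;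
  in all others the point can be chosen in \<open>E\<close>.
\<close>
lemma energy_discretises:
  assumes r: "0 < r" "r < 1" and K: "K \<subseteq> seq_topology closure_of E" and \<mu>: "\<mu> \<in> prob_measures_on K"
  shows "\<exists>(R, p)\<in>weights. energy T \<theta> s r \<mu> = discrete_energy s r R p"
proof -
  interpret prob_space \<mu> using \<mu> by (simp add: prob_measures_on_def)
  have sets: "sets \<mu> = sets seq_borel" and \<mu>K: "prob K = 1"
    using \<mu> by (auto simp: prob_measures_on_def)
  have space: "space \<mu> = UNIV" using sets_eq_imp_space_eq[OF sets] by (simp add: space_seq_borel)
  obtain N where N: "\<tau> ^ N \<le> r powr (1 / \<theta>)" using saturation_level_exists[OF r(1)] by blast
  define L where "L = {I :: 'm list. length I = N}"
  define W where "W = {I \<in> L. cylinder I \<inter> E \<noteq> {}}"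
  define rep where "rep I = (SOME x. x \<in> cylinder I \<inter> E)" for I
  define ext where "ext I = (\<lambda>k. I ! k)" for I :: "'m list"
  define j where "j I I' = J s r (ext I) (ext I')" for I I'
  have finL: "finite L" by (simp add: L_def finite_words)
  have rep: "rep I \<in> cylinder I" "rep I \<in> E" if "I \<in> W" for I
    using that someI_ex[of "\<lambda>x. x \<in> cylinder I \<inter> E"] by (auto simp: W_def rep_def)
  have J_j: "J s r x y = j (map x [0..<N]) (map y [0..<N])" for x y
    unfolding j_def by (rule J_prefix_cong[OF r N]) (simp_all add: ext_def)
  have cyl: "cylinder I \<in> events" for I by (simp add: sets cylinder_seq_borel)
  have null: "prob (cylinder I) = 0" if "I \<in> L - W" for I
  proof -
    have "cylinder I \<inter> E = {}" using that by (simp add: W_def)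
    then have "cylinder I \<inter> seq_topology closure_of E = {}"
      using openin_Int_closure_of_eq_empty[OF openin_cylinder[of I], of E] by simp
    then have "cylinder I \<subseteq> space \<mu> - K" using K by (auto simp: space)
    moreover have "K \<in> events" using \<mu>K measure_notin_sets[of K \<mu>] by force
    ultimately have "prob (cylinder I) \<le> 1 - prob K"
      using prob_compl[of K] finite_measure_mono[of "cylinder I" "space \<mu> - K"] by auto
    then show ?thesis using \<mu>K measure_nonneg[of \<mu> "cylinder I"] by simp
  qed
  have inner: "(\<integral>x. J s r x y \<partial>\<mu>) = (\<Sum>I\<in>L. prob (cylinder I) * j I (map y [0..<N]))" for y
    unfolding J_j L_def by (rule integral_prefix_function[OF prob_space_axioms sets])
  have "energy T \<theta> s r \<mu> = (\<Sum>I'\<in>L. prob (cylinder I') * (\<Sum>I\<in>L. prob (cylinder I) * j I I'))"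
    unfolding energy_def inner unfolding L_def
    by (rule integral_prefix_function[OF prob_space_axioms sets, of "\<lambda>I'. \<Sum>I\<in>{I. length I = N}. prob (cylinder I) * j I I'"])
  also have "\<dots> = (\<Sum>I'\<in>W. prob (cylinder I') * (\<Sum>I\<in>L. prob (cylinder I) * j I I'))"
    using null by (intro sum.mono_neutral_right[OF finL]) (auto simp: W_def)
  also have "\<dots> = (\<Sum>I'\<in>W. prob (cylinder I') * (\<Sum>I\<in>W. prob (cylinder I) * j I I'))"
    using null by (intro sum.cong refl arg_cong2[where f = "(*)"] sum.mono_neutral_right[OF finL]) (auto simp: W_def)
  also have "\<dots> = (\<Sum>I'\<in>W. \<Sum>I\<in>W. prob (cylinder I) * prob (cylinder I') * J s r (rep I) (rep I'))"
  proof -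
    have "J s r (rep I) (rep I') = j I I'" if "I \<in> W" "I' \<in> W" for I I'
      using rep(1)[OF that(1)] rep(1)[OF that(2)] that unfolding J_j by (simp add: cylinder_def W_def L_def)
    then show ?thesis by (simp add: sum_distrib_left mult_ac cong: sum.cong)
  qed
  also have "\<dots> = (\<Sum>I\<in>W. \<Sum>I'\<in>W. prob (cylinder I) * prob (cylinder I') * J s r (rep I) (rep I'))"
    by (rule sum.swap)
  finally have en: "energy T \<theta> s r \<mu> =
      (\<Sum>I\<in>W. \<Sum>I'\<in>W. prob (cylinder I) * prob (cylinder I') * J s r (rep I) (rep I'))" .
  define p where "p x = prob (cylinder (map x [0..<N]))" for x
  have rep_prefix: "map (rep I) [0..<N] = I" if "I \<in> W" for I
    using rep(1)[OF that] that by (simp add: cylinder_def W_def L_def)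
  then have inj: "inj_on rep W" by (rule inj_on_inverseI[of W "\<lambda>x. map x [0..<N]"])
  have p: "p (rep I) = prob (cylinder I)" if "I \<in> W" for I by (simp only: p_def rep_prefix[OF that])
  have "sum p (rep ` W) = (\<Sum>I\<in>W. prob (cylinder I))"
    by (simp add: sum.reindex[OF inj] p cong: sum.cong)
  also have "\<dots> = (\<Sum>I\<in>L. prob (cylinder I) * 1)"
    using null by (simp, intro sum.mono_neutral_left[OF finL]) (auto simp: W_def)
  also have "\<dots> = (\<integral>x. 1 \<partial>\<mu>)"
    unfolding L_def by (rule integral_prefix_function[OF prob_space_axioms sets, symmetric, of "\<lambda>_. 1"])
  also have "\<dots> = 1" by (simp add: prob_space)
  finally have "sum p (rep ` W) = 1" .
  then have "(rep ` W, p) \<in> weights"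
    using rep(2) finL by (auto simp: weights_def p_def W_def)
  moreover have "energy T \<theta> s r \<mu> = discrete_energy s r (rep ` W) p"
    unfolding en discrete_energy_def by (simp add: sum.reindex[OF inj] p cong: sum.cong)
  ultimately show ?thesis by blast
qed

lemma discrete_energy_realised:
  assumes r: "0 < r" "r < 1" and K: "E \<subseteq> K" "K \<in> sets seq_borel" and Rp: "(R, p) \<in> weights"
  shows "\<exists>\<mu>\<in>prob_measures_on K. energy T \<theta> s r \<mu> = discrete_energy s r R p"
proof -
  have fin: "finite R" and RE: "R \<subseteq> E" and p0: "\<And>x. x \<in> R \<Longrightarrow> 0 \<le> p x" and p1: "sum p R = 1"
    using Rp by (auto simp: weights_def)
  obtain N where N: "\<tau> ^ N \<le> r powr (1 / \<theta>)" using saturation_level_exists[OF r(1)] by blast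
  define \<nu> where "\<nu> = point_measure R (\<lambda>x. ennreal (p x))"
  define \<mu> where "\<mu> = distr \<nu> seq_borel (\<lambda>x. x)"
  have id: "(\<lambda>x. x) \<in> measurable \<nu> seq_borel" by (simp add: \<nu>_def space_seq_borel)
  have em: "emeasure \<mu> A = 1" if "A \<in> sets seq_borel" "R \<subseteq> A" for A
  proof -
    have "emeasure \<mu> A = emeasure \<nu> R"
      using that by (simp add: \<mu>_def emeasure_distr[OF id]) (simp add: \<nu>_def space_point_measure Int_absorb1)
    also have "\<dots> = (\<Sum>x\<in>R. ennreal (p x))" by (simp add: \<nu>_def emeasure_point_measure_finite fin)
    also have "\<dots> = ennreal (sum p R)" using p0 by (simp add: sum_ennreal)
    finally show ?thesis by (simp add: p1)
  qed
  have "prob_space \<mu>"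
    using em[of UNIV] sets.top[of "seq_borel :: (nat \<Rightarrow> 'm) measure"]
    by (intro prob_spaceI) (simp add: \<mu>_def space_seq_borel)
  moreover have "measure \<mu> K = 1" using em[OF K(2)] RE K(1) by (simp add: measure_def)
  ultimately have "\<mu> \<in> prob_measures_on K" by (simp add: prob_measures_on_def \<mu>_def)
  moreover have "energy T \<theta> s r \<mu> = discrete_energy s r R p"
  proof -
    have int: "(\<integral>x. f x \<partial>\<mu>) = (\<Sum>x\<in>R. p x * f x)" if "f \<in> borel_measurable seq_borel" for f :: "_ \<Rightarrow> real"
    proof -
      have "(\<integral>x. f x \<partial>\<mu>) = (\<integral>x. f x \<partial>\<nu>)"
        unfolding \<mu>_def by (rule integral_distr[OF id that])
      then show ?thesis
        by (simp add: \<nu>_def lebesgue_integral_point_measure_finite[OF fin p0])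
    qed
    define ext where "ext I = (\<lambda>k. I ! k)" for I :: "'m list"
    have J_ext: "J s r x y = J s r (ext (map x [0..<N])) (ext (map y [0..<N]))" for x y
      by (rule J_prefix_cong[OF r N]) (simp_all add: ext_def)
    have m1: "(\<lambda>x. J s r x y) \<in> borel_measurable seq_borel" for y
      by (subst J_ext) (rule prefix_function_measurable)
    have m2: "J s r x \<in> borel_measurable seq_borel" for x
      by (subst J_ext[abs_def]) (rule prefix_function_measurable)
    have "energy T \<theta> s r \<mu> = (\<integral>y. (\<Sum>x\<in>R. p x * J s r x y) \<partial>\<mu>)"
      unfolding energy_def by (simp add: int[OF m1])
    also have "\<dots> = (\<Sum>y\<in>R. p y * (\<Sum>x\<in>R. p x * J s r x y))"
      using m2 by (intro int borel_measurable_sum borel_measurable_times borel_measurable_const) auto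
    also have "\<dots> = (\<Sum>y\<in>R. \<Sum>x\<in>R. p x * p y * J s r x y)"
      by (simp add: sum_distrib_left mult_ac)
    also have "\<dots> = discrete_energy s r R p"
      unfolding discrete_energy_def by (rule sum.swap)
    finally show ?thesis .
  qed
  ultimately show ?thesis by blast
qed

text \<open>
  The definition of the capacity uses \<open>E\<close> or its closure. Every closed set between the two gives the same
  set of energies.
\<close>
lemma capacity_eq:
  assumes r: "0 < r" "r < 1"
  shows "capacity T \<theta> s r E = inverse (min_energy s r)"
proof -
  have main: "compact_capacity T \<theta> s r K = inverse (min_energy s r)"
    if K: "E \<subseteq> K" "K \<subseteq> seq_topology closure_of E" "closedin seq_topology K" for K
  proof -
    have "(energy T \<theta> s r) ` prob_measures_on K = (\<lambda>(R, p). discrete_energy s r R p) ` weights"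
    proof (intro equalityI subsetI)
      fix e assume "e \<in> energy T \<theta> s r ` prob_measures_on K"
      then obtain \<mu> where \<mu>: "\<mu> \<in> prob_measures_on K" "e = energy T \<theta> s r \<mu>" by auto
      obtain R p where "(R, p) \<in> weights" "energy T \<theta> s r \<mu> = discrete_energy s r R p"
        using energy_discretises[OF r K(2) \<mu>(1), of s] by auto
      then show "e \<in> (\<lambda>(R, p). discrete_energy s r R p) ` weights"
        using \<mu>(2) by (intro rev_image_eqI[of "(R, p)"]) simp_all
    next
      fix e assume "e \<in> (\<lambda>(R, p). discrete_energy s r R p) ` weights"
      then obtain R p where "(R, p) \<in> weights" "e = discrete_energy s r R p" by auto
      then show "e \<in> energy T \<theta> s r ` prob_measures_on K"
        using discrete_energy_realised[OF r K(1) closedin_seq_borel[OF K(3)], of R p s] by (metis imageI)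
    qed
    then show ?thesis by (simp add: compact_capacity_def min_energy_def)
  qed
  interpret M: Metric_space "UNIV :: (nat \<Rightarrow> 'm) set" seq_dist by (rule Metric_space_seq_dist)
  have sub: "E \<subseteq> seq_topology closure_of E"
    by (rule closure_of_subset) (simp add: topspace_seq_topology)
  show ?thesis
  proof (cases "compactin seq_topology E")
    case True
    then have "closedin seq_topology E"
      unfolding seq_topology_def by (intro compactin_imp_closedin M.Hausdorff_space_mtopology)
    then show ?thesis using main[of E] sub True by (simp add: capacity_def)
  next
    case False
    then show ?thesis using main[of "seq_topology closure_of E"] sub by (simp add: capacity_def)
  qed
qed

lemma weights_nonempty: "weights \<noteq> {}"
proof -
  obtain x where "x \<in> E" using E_nonempty by blast
  then have "({x}, \<lambda>_. 1) \<in> weights" by (simp add: weights_def)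
  then show ?thesis by blast
qed

lemma weights_pair_sum:
  assumes "(R, p) \<in> weights" shows "(\<Sum>x\<in>R. \<Sum>y\<in>R. p x * p y) = 1"
proof -
  have "(\<Sum>x\<in>R. \<Sum>y\<in>R. p x * p y) = sum p R * sum p R" by (simp add: sum_product)
  then show ?thesis using assms by (simp add: weights_def)
qed

lemma discrete_energy_mono:
  assumes "(R, p) \<in> weights" "\<And>x y. J s r x y \<le> c * J t r' x y"
  shows "discrete_energy s r R p \<le> c * discrete_energy t r' R p"
proof -
  have p0: "\<And>x. x \<in> R \<Longrightarrow> 0 \<le> p x" using assms by (auto simp: weights_def)
  have "discrete_energy s r R p \<le> (\<Sum>x\<in>R. \<Sum>y\<in>R. p x * p y * (c * J t r' x y))"
    unfolding discrete_energy_def using assms(2) p0 by (intro sum_mono mult_left_mono) auto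
  also have "\<dots> = c * discrete_energy t r' R p"
    by (simp add: discrete_energy_def sum_distrib_left mult_ac)
  finally show ?thesis .
qed

lemma discrete_energy_nonneg:
  assumes "0 < r" "r < 1" "0 \<le> s" "(R, p) \<in> weights" shows "0 \<le> discrete_energy s r R p"
  unfolding discrete_energy_def using assms J_pos[of r s]
  by (intro sum_nonneg mult_nonneg_nonneg) (auto simp: weights_def less_imp_le)

lemma min_energy_le:
  assumes "0 < r" "r < 1" "0 \<le> s" "(R, p) \<in> weights" shows "min_energy s r \<le> discrete_energy s r R p"
proof -
  have "bdd_below ((\<lambda>(R, p). discrete_energy s r R p) ` weights)"
    using discrete_energy_nonneg[OF assms(1-3)] by (auto intro!: bdd_belowI2[of _ 0])
  then show ?thesis unfolding min_energy_def using cINF_lower[OF _ assms(4)] by fastforce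
qed

lemma min_energy_mono:
  assumes r: "0 < r" "r < 1" and st: "0 \<le> s" "0 \<le> t" and c: "0 < c" and le: "\<And>x y. J s r x y \<le> c * J t r x y"
  shows "min_energy s r \<le> c * min_energy t r"
proof -
  have "min_energy s r / c \<le> min_energy t r"
    unfolding min_energy_def[of t]
  proof (rule cINF_greatest[OF weights_nonempty], clarify)
    fix R p assume Rp: "(R, p) \<in> weights"
    have "min_energy s r \<le> c * discrete_energy t r R p"
      using min_energy_le[OF r st(1) Rp] discrete_energy_mono[OF Rp le] by linarith
    then show "min_energy s r / c \<le> discrete_energy t r R p" using c by (simp add: field_simps)
  qed
  then show ?thesis using c by (simp add: field_simps)
qed

lemma min_energy_zero_le_1: assumes r: "0 < r" "r < 1" shows "min_energy 0 r \<le> 1"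
proof -
  obtain R p where Rp: "(R, p) \<in> weights" using weights_nonempty by auto
  have p0: "\<And>x. x \<in> R \<Longrightarrow> 0 \<le> p x" using Rp by (auto simp: weights_def)
  have "discrete_energy 0 r R p \<le> (\<Sum>x\<in>R. \<Sum>y\<in>R. p x * p y * 1)"
    unfolding discrete_energy_def using p0 J_zero_le_1[OF r] by (intro sum_mono mult_left_mono) auto
  then show ?thesis using weights_pair_sum[OF Rp] min_energy_le[OF r _ Rp, of 0] by simp
qed

lemma min_energy_dim_ge_1: assumes r: "0 < r" "r < 1" shows "1 \<le> min_energy (real CARD('d)) r"
  unfolding min_energy_def
proof (rule cINF_greatest[OF weights_nonempty], clarify)
  fix R p assume Rp: "(R, p) \<in> weights"
  have p0: "\<And>x. x \<in> R \<Longrightarrow> 0 \<le> p x" using Rp by (auto simp: weights_def)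
  have "(\<Sum>x\<in>R. \<Sum>y\<in>R. p x * p y * 1) \<le> discrete_energy (real CARD('d)) r R p"
    unfolding discrete_energy_def using p0 J_dim_ge_1[OF r] by (intro sum_mono mult_left_mono) auto
  then show "1 \<le> discrete_energy (real CARD('d)) r R p" using weights_pair_sum[OF Rp] by simp
qed

lemma min_energy_exponent:
  assumes "0 < r" "r < 1" "0 \<le> s" "s \<le> t"
  shows "min_energy s r \<le> r powr (t - s) * min_energy t r"
    "min_energy t r \<le> r powr (- (t - s) / \<theta>) * min_energy s r"
  using assms J_exponent_lower[OF assms] J_exponent_upper[OF assms]
  by (auto intro!: min_energy_mono)

lemma min_energy_pos:
  assumes "0 < r" "r < 1" "0 \<le> s" shows "0 < min_energy s r"
proof -
  define D where "D = real CARD('d)"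
  have D: "0 < min_energy D r" using min_energy_dim_ge_1[OF assms(1,2)] by (simp add: D_def)
  obtain c where "c > 0" "min_energy D r \<le> c * min_energy s r"
  proof (cases "s \<le> D")
    case True
    then show ?thesis using min_energy_exponent(2)[OF assms True] assms(1) that[of "r powr (- (D - s) / \<theta>)"] by simp
  next
    case False
    then show ?thesis using min_energy_exponent(1)[of r D s] assms that[of "r powr (s - D)"] by (simp add: D_def)
  qed
  then show ?thesis using D by (metis less_le_trans zero_less_mult_pos)
qed

end

section \<open>Capacity dimensions as thresholds of the minimal energy\<close>

text \<open>
  The hypotheses say that \<open>g\<close> decreases with slope between \<open>-1/\<theta>\<close> and \<open>-1\<close>. It is therefore finite,
  continuous and strictly decreasing, and the intermediate value theorem applies.
\<close>
lemma steep_function_zero: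
  fixes g :: "real \<Rightarrow> ereal" and D \<theta> :: real
  assumes D: "0 \<le> D" and \<theta>: "0 < \<theta>" "\<theta> \<le> 1"
    and upper: "\<And>s t. 0 \<le> s \<Longrightarrow> s \<le> t \<Longrightarrow> g t \<le> g s + ereal (- (t - s))"
    and lower: "\<And>s t. 0 \<le> s \<Longrightarrow> s \<le> t \<Longrightarrow> g s + ereal (- (t - s) / \<theta>) \<le> g t"
    and g0: "0 \<le> g 0" and gD: "g D \<le> 0"
  defines "z \<equiv> THE s. 0 \<le> s \<and> s \<le> D \<and> g s = 0"
  shows "0 \<le> z" "z < s \<Longrightarrow> g s < 0" "0 \<le> s \<Longrightarrow> s < z \<Longrightarrow> 0 < g s"
proof -
  have "g 0 + ereal (- (D - 0) / \<theta>) \<le> 0" using lower[of 0 D] D gD by (auto intro: order_trans)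
  then have "g 0 \<noteq> \<infinity>" by auto
  then obtain k0 where k0: "g 0 = ereal k0" using g0 by (cases "g 0") auto
  have fin: "\<bar>g s\<bar> \<noteq> \<infinity>" if "0 \<le> s" for s
    using upper[of 0 s] lower[of 0 s] that k0 by (cases "g s") auto
  define k where "k s = real_of_ereal (g s)" for s
  have gk: "g s = ereal (k s)" if "0 \<le> s" for s using fin[OF that] by (simp add: k_def ereal_real')
  have up: "k t \<le> k s - (t - s)" and lo: "k s - (t - s) / \<theta> \<le> k t" if "0 \<le> s" "s \<le> t" for s t
    using upper[of s t] lower[of s t] that by (simp_all add: gk diff_divide_distrib)
  have "continuous_on {0..D} k"
  proof (rule continuous_onI)
    fix x e :: real assume x: "x \<in> {0..D}" and e: "e > 0"
    show "\<exists>d>0. \<forall>x'\<in>{0..D}. dist x' x < d \<longrightarrow> dist (k x') (k x) \<le> e"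
    proof (intro exI[of _ "e * \<theta>"] conjI ballI impI)
      show "0 < e * \<theta>" using e \<theta> by simp
      fix y assume y: "y \<in> {0..D}" "dist y x < e * \<theta>"
      have "\<bar>k y - k x\<bar> \<le> \<bar>y - x\<bar> / \<theta>"
      proof (cases "x \<le> y")
        case True
        then show ?thesis using up[of x y] lo[of x y] x by (simp add: abs_if)
      next
        case False
        then show ?thesis using up[of y x] lo[of y x] y by (simp add: abs_if)
      qed
      also have "\<dots> \<le> e" using y \<theta> by (simp add: dist_real_def field_simps)
      finally show "dist (k y) (k x) \<le> e" by (simp add: dist_real_def)
    qed
  qed
  moreover have "k D \<le> 0" "0 \<le> k 0" using g0 gD D by (simp_all add: gk)
  ultimately obtain w where w: "0 \<le> w" "w \<le> D" "k w = 0"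
    using IVT2'[of k D 0 0] D by blast
  have z: "z = w"
    unfolding z_def
  proof (rule the_equality)
    show "0 \<le> w \<and> w \<le> D \<and> g w = 0" using w by (simp add: gk)
    fix v assume v: "0 \<le> v \<and> v \<le> D \<and> g v = 0"
    then have "k v = 0" using gk[of v] by simp
    then show "v = w" using up[of v w] up[of w v] v w by linarith
  qed
  show "0 \<le> z" using w z by simp
  show "g s < 0" if "z < s" using up[of w s] that w z by (simp add: gk)
  show "0 < g s" if "0 \<le> s" "s < z" using up[of s w] that w z by (simp add: gk)
qed

lemma eventually_unit_interval: "eventually (\<lambda>r::real. 0 < r \<and> r < 1) (at_right 0)"
  using eventually_at_right_real[of 0 1] by simp

context affine_ifs_coding
begin

text \<open>
  The exponent \<open>\<kappa>\<close> for which the minimal energy equals \<open>r\<^sup>\<kappa>\<close>. It is the quotient in the definition of the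
  capacity dimensions, since the capacity is the inverse of the minimal energy.
\<close>
definition scaling_exponent :: "real \<Rightarrow> real \<Rightarrow> real" where
  "scaling_exponent s r = ln (min_energy s r) / ln r"

lemma capacity_exponent_eq:
  assumes "0 < r" "r < 1" "0 \<le> s"
  shows "ln (capacity T \<theta> s r E) / - ln r = scaling_exponent s r"
  using assms min_energy_pos[OF assms] by (simp add: capacity_eq scaling_exponent_def ln_inverse)

lemma scaling_exponent_bounds:
  assumes r: "0 < r" "r < 1" and st: "0 \<le> s" "s \<le> t"
  shows "scaling_exponent t r \<le> scaling_exponent s r + (- (t - s))"
    "scaling_exponent s r + (- (t - s) / \<theta>) \<le> scaling_exponent t r"
proof -
  have pos: "0 < min_energy s r" "0 < min_energy t r" using min_energy_pos r st by auto
  have l: "ln r < 0" using r by simp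
  have "ln (min_energy s r) \<le> ln (r powr (t - s) * min_energy t r)"
    using min_energy_exponent(1)[OF r st] pos by (intro ln_mono) auto
  also have "\<dots> = (t - s) * ln r + ln (min_energy t r)"
    using r pos by (simp add: ln_mult ln_powr)
  finally show "scaling_exponent t r \<le> scaling_exponent s r + (- (t - s))"
    using l by (simp add: scaling_exponent_def field_simps)
  have "ln (min_energy t r) \<le> ln (r powr (- (t - s) / \<theta>) * min_energy s r)"
    using min_energy_exponent(2)[OF r st] pos by (intro ln_mono) auto
  also have "\<dots> = (- (t - s) / \<theta>) * ln r + ln (min_energy s r)"
    using r pos by (simp add: ln_mult ln_powr)
  finally have "((- (t - s) / \<theta>) * ln r + ln (min_energy s r)) / ln r \<le> ln (min_energy t r) / ln r"
    using l by (intro divide_right_mono_neg) auto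
  then show "scaling_exponent s r + (- (t - s) / \<theta>) \<le> scaling_exponent t r"
    using l by (simp add: scaling_exponent_def add_divide_distrib add.commute)
qed

lemma scaling_exponent_0: "0 < r \<Longrightarrow> r < 1 \<Longrightarrow> 0 \<le> scaling_exponent 0 r"
  using min_energy_zero_le_1[of r] min_energy_pos[of r 0]
  by (simp add: scaling_exponent_def divide_nonpos_neg)

lemma scaling_exponent_dim: "0 < r \<Longrightarrow> r < 1 \<Longrightarrow> scaling_exponent (real CARD('d)) r \<le> 0"
  using min_energy_dim_ge_1[of r] by (simp add: scaling_exponent_def divide_nonneg_neg)

lemma scaling_exponent_less_iff:
  assumes "0 < r" "r < 1" "0 \<le> s"
  shows "scaling_exponent s r < c \<longleftrightarrow> r powr c < min_energy s r"
    "c < scaling_exponent s r \<longleftrightarrow> min_energy s r < r powr c"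
proof -
  have l: "ln r < 0" using assms by simp
  have e: "0 < min_energy s r" using min_energy_pos assms by auto
  have "r powr c < min_energy s r \<longleftrightarrow> c * ln r < ln (min_energy s r)"
    using assms e ln_less_cancel_iff[of "r powr c" "min_energy s r"] by (simp add: ln_powr)
  then show "scaling_exponent s r < c \<longleftrightarrow> r powr c < min_energy s r"
    using l by (simp add: scaling_exponent_def neg_divide_less_eq)
  have "min_energy s r < r powr c \<longleftrightarrow> ln (min_energy s r) < c * ln r"
    using assms e ln_less_cancel_iff[of "min_energy s r" "r powr c"] by (simp add: ln_powr)
  then show "c < scaling_exponent s r \<longleftrightarrow> min_energy s r < r powr c"
    using l by (simp add: scaling_exponent_def neg_less_divide_eq)
qed

text \<open>
  Lower and upper limits are both monotone and commute with adding constants, and the bounds on the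
  scaling exponent hold for each \<open>r < 1\<close> with increments that do not depend on \<open>r\<close>. So the limit is
  a steep function of \<open>s\<close>, for either kind of limit.
\<close>
lemma capacity_dim_sign:
  fixes \<Lambda> :: "(real \<Rightarrow> ereal) \<Rightarrow> ereal"
  assumes \<Lambda>: "\<Lambda> = Liminf (at_right 0) \<or> \<Lambda> = Limsup (at_right 0)"
  defines "z \<equiv> THE s. 0 \<le> s \<and> s \<le> real CARD('d) \<and>
    \<Lambda> (\<lambda>r. ereal (ln (capacity T \<theta> s r E) / - ln r)) = 0"
  shows "0 \<le> z" "z < s \<Longrightarrow> \<Lambda> (\<lambda>r. ereal (scaling_exponent s r)) < 0"
    "0 \<le> s \<Longrightarrow> s < z \<Longrightarrow> 0 < \<Lambda> (\<lambda>r. ereal (scaling_exponent s r))"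
proof -
  have mono: "\<Lambda> f \<le> \<Lambda> h" if "\<And>r. 0 < r \<Longrightarrow> r < 1 \<Longrightarrow> f r \<le> h r" for f h
  proof -
    have "eventually (\<lambda>r. f r \<le> h r) (at_right 0)"
      using eventually_unit_interval by eventually_elim (use that in blast)
    from Liminf_mono[OF this] Limsup_mono[OF this] show ?thesis using \<Lambda> by auto
  qed
  have const: "\<Lambda> (\<lambda>_. e) = e" for e
    using \<Lambda> by (auto simp: Liminf_const Limsup_const trivial_limit_at_right_real)
  have add: "\<Lambda> (\<lambda>r. ereal (f r + e)) = \<Lambda> (\<lambda>r. ereal (f r)) + ereal e" for f e
    using \<Lambda> Liminf_add_ereal_right[of "at_right (0::real)" "ereal e" "\<lambda>r. ereal (f r)"]
      Limsup_add_ereal_right[of "at_right (0::real)" "ereal e" "\<lambda>r. ereal (f r)"]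
    by (auto simp: trivial_limit_at_right_real)
  define g where "g s = \<Lambda> (\<lambda>r. ereal (scaling_exponent s r))" for s
  have "\<Lambda> (\<lambda>r. ereal (ln (capacity T \<theta> s r E) / - ln r)) = g s" if "0 \<le> s" for s
    unfolding g_def by (intro antisym mono) (use capacity_exponent_eq that in simp_all)
  then have z: "z = (THE s. 0 \<le> s \<and> s \<le> real CARD('d) \<and> g s = 0)"
    unfolding z_def by (metis (lifting))
  have bounds: "g t \<le> g s + ereal (- (t - s))" "g s + ereal (- (t - s) / \<theta>) \<le> g t"
    if "0 \<le> s" "s \<le> t" for s t
    unfolding g_def add[symmetric] using scaling_exponent_bounds[OF _ _ that] by (auto intro!: mono)
  have ends: "0 \<le> g 0" "g (real CARD('d)) \<le> 0"
    using mono[of "\<lambda>_. 0" "\<lambda>r. ereal (scaling_exponent 0 r)"]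
      mono[of "\<lambda>r. ereal (scaling_exponent (real CARD('d)) r)" "\<lambda>_. 0"]
    by (simp_all add: g_def const scaling_exponent_0 scaling_exponent_dim)
  note zero = steep_function_zero[OF of_nat_0_le_iff theta_pos theta_le_1 bounds ends, folded z]
  show "0 \<le> z" by (rule zero(1))
  show "\<Lambda> (\<lambda>r. ereal (scaling_exponent s r)) < 0" if "z < s"
    using zero(2)[OF _ _ _ _ that] by (simp add: g_def)
  show "0 < \<Lambda> (\<lambda>r. ereal (scaling_exponent s r))" if "0 \<le> s" "s < z"
    using zero(3)[OF _ _ _ _ that] by (simp add: g_def)
qed

lemmas lower_capacity_dim_sign = capacity_dim_sign[OF disjI1[OF refl], folded lower_capacity_dim_def]
lemmas upper_capacity_dim_sign = capacity_dim_sign[OF disjI2[OF refl], folded upper_capacity_dim_def]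

lemma above_lower_capacity_dim:
  assumes "lower_capacity_dim T \<theta> E < s"
  shows "\<exists>\<delta>>0. frequently (\<lambda>r. r powr (- \<delta>) < min_energy s r) (at_right 0)"
proof -
  have s: "0 \<le> s" using assms lower_capacity_dim_sign(1) by linarith
  obtain c where c: "Liminf (at_right 0) (\<lambda>r. ereal (scaling_exponent s r)) < ereal c" "ereal c < 0"
    using ereal_dense2[OF lower_capacity_dim_sign(2)[OF assms]] by blast
  have "\<not> eventually (\<lambda>r. ereal c \<le> ereal (scaling_exponent s r)) (at_right 0)"
  proof
    assume "eventually (\<lambda>r. ereal c \<le> ereal (scaling_exponent s r)) (at_right 0)"
    from Liminf_bounded[OF this] c(1) show False by simp
  qed
  then have "frequently (\<lambda>r. scaling_exponent s r < c) (at_right 0)"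
    by (simp add: not_eventually not_le)
  then have "frequently (\<lambda>r. r powr (- (- c)) < min_energy s r) (at_right 0)"
    by (rule frequently_rev_mp) (use s scaling_exponent_less_iff in \<open>auto intro: eventually_mono[OF eventually_unit_interval]\<close>)
  then show ?thesis using c(2) by (intro exI[of _ "- c"]) simp
qed

lemma below_lower_capacity_dim:
  assumes "0 \<le> s" "s < lower_capacity_dim T \<theta> E"
  shows "\<exists>\<delta>>0. eventually (\<lambda>r. min_energy s r < r powr \<delta>) (at_right 0)"
proof -
  obtain c where c: "0 < ereal c" "ereal c < Liminf (at_right 0) (\<lambda>r. ereal (scaling_exponent s r))"
    using ereal_dense2[OF lower_capacity_dim_sign(3)[OF assms]] by blast
  have "eventually (\<lambda>r. min_energy s r < r powr c) (at_right 0)"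
    using less_LiminfD[OF c(2)] eventually_unit_interval
    by eventually_elim (use scaling_exponent_less_iff(2) assms(1) in auto)
  then show ?thesis using c(1) by (intro exI[of _ c]) simp
qed

lemma above_upper_capacity_dim:
  assumes "upper_capacity_dim T \<theta> E < s"
  shows "\<exists>\<delta>>0. eventually (\<lambda>r. r powr (- \<delta>) < min_energy s r) (at_right 0)"
proof -
  have s: "0 \<le> s" using assms upper_capacity_dim_sign(1) by linarith
  obtain c where c: "Limsup (at_right 0) (\<lambda>r. ereal (scaling_exponent s r)) < ereal c" "ereal c < 0"
    using ereal_dense2[OF upper_capacity_dim_sign(2)[OF assms]] by blast
  have "eventually (\<lambda>r. r powr (- (- c)) < min_energy s r) (at_right 0)"
    using Limsup_lessD[OF c(1)] eventually_unit_interval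
    by eventually_elim (use scaling_exponent_less_iff(1) s in auto)
  then show ?thesis using c(2) by (intro exI[of _ "- c"]) simp
qed

lemma below_upper_capacity_dim:
  assumes "0 \<le> s" "s < upper_capacity_dim T \<theta> E"
  shows "\<exists>\<delta>>0. frequently (\<lambda>r. min_energy s r < r powr \<delta>) (at_right 0)"
proof -
  obtain c where c: "0 < ereal c" "ereal c < Limsup (at_right 0) (\<lambda>r. ereal (scaling_exponent s r))"
    using ereal_dense2[OF upper_capacity_dim_sign(3)[OF assms]] by blast
  have "\<not> eventually (\<lambda>r. ereal (scaling_exponent s r) \<le> ereal c) (at_right 0)"
  proof
    assume "eventually (\<lambda>r. ereal (scaling_exponent s r) \<le> ereal c) (at_right 0)"
    from Limsup_bounded[OF this] c(2) show False by simp
  qed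
  then have "frequently (\<lambda>r. c < scaling_exponent s r) (at_right 0)"
    by (simp add: not_eventually not_le)
  then have "frequently (\<lambda>r. min_energy s r < r powr c) (at_right 0)"
    by (rule frequently_rev_mp) (use assms(1) scaling_exponent_less_iff in \<open>auto intro: eventually_mono[OF eventually_unit_interval]\<close>)
  then show ?thesis using c(1) by (intro exI[of _ c]) simp
qed

end

section \<open>Flows and cuts in the tree of prefixes\<close>

lemma neg_ln_le_powr:
  fixes r \<delta> :: real
  assumes "0 < r" "r < 1" "0 < \<delta>" shows "- ln r \<le> r powr (- \<delta>) / \<delta>"
proof -
  have "- ln r = ln (1 / r)" using assms by (simp add: ln_div)
  also have "\<dots> \<le> (1 / r) powr \<delta> / \<delta>" using assms by (intro ln_powr_bound) auto
  also have "(1 / r) powr \<delta> = r powr (- \<delta>)" using assms by (simp add: powr_divide powr_minus_divide)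
  finally show ?thesis .
qed

lemma sum_UN_le:
  fixes f :: "'b \<Rightarrow> real"
  assumes "finite X" "\<And>i. i \<in> X \<Longrightarrow> finite (A i)" "\<And>x. 0 \<le> f x"
  shows "sum f (\<Union>i\<in>X. A i) \<le> (\<Sum>i\<in>X. sum f (A i))"
  using assms(1,2)
proof (induction X)
  case (insert i X)
  have "sum f (A i \<union> (\<Union>i\<in>X. A i)) \<le> sum f (A i) + sum f (\<Union>i\<in>X. A i)"
    using insert.prems insert.hyps(1) assms(3)
    by (subst sum_Un) (auto intro!: sum_nonneg)
  then show ?case using insert by fastforce
qed simp

context affine_ifs_coding
begin

text \<open>
  The level is proportional to \<open>- ln r\<close>, which is dominated by every negative power of \<open>r\<close>.
\<close>
lemma saturation_level_log_bound:
  assumes \<delta>: "0 < \<delta>"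
  shows "\<exists>C>0. \<forall>r. 0 < r \<longrightarrow> r < 1 \<longrightarrow> (\<exists>N. \<tau> ^ N \<le> r powr (1 / \<theta>) \<and> real N + 1 \<le> C * r powr (- \<delta>))"
proof -
  \<comment> \<open>any number in \<open>(0, 1)\<close> that is at least \<open>\<tau>\<close>, positive so that its logarithm can be used\<close>
  define \<rho> where "\<rho> = (1 + \<tau>) / 2"
  have \<rho>: "0 < \<rho>" "\<rho> < 1" "\<tau> \<le> \<rho>" using tau_nonneg tau_less_1 by (simp_all add: \<rho>_def)
  have ln\<rho>: "ln \<rho> < 0" using \<rho> by simp
  define B where "B = 1 / (\<theta> * (- ln \<rho>))"
  have B: "B > 0" using theta_pos ln\<rho> by (simp add: B_def mult_pos_neg)
  define C where "C = B / \<delta> + 2"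
  have "\<exists>N. \<tau> ^ N \<le> r powr (1 / \<theta>) \<and> real N + 1 \<le> C * r powr (- \<delta>)" if r: "0 < r" "r < 1" for r
  proof -
    define N where "N = nat \<lceil>B * (- ln r)\<rceil>"
    have pos: "0 \<le> B * (- ln r)" using B r by (simp add: mult_nonneg_nonpos)
    have N: "B * (- ln r) \<le> N" "N \<le> B * (- ln r) + 1" using pos unfolding N_def by linarith+
    have "\<tau> ^ N \<le> \<rho> ^ N" using \<rho> tau_nonneg by (intro power_mono)
    also have "\<dots> = exp (N * ln \<rho>)" using \<rho> by (simp add: exp_of_nat_mult)
    also have "\<dots> \<le> exp (B * (- ln r) * ln \<rho>)"
      using N(1) ln\<rho> by (simp only: exp_le_cancel_iff mult_right_mono_neg)
    also have "B * (- ln r) * ln \<rho> = 1 / \<theta> * ln r" using ln\<rho> theta_pos by (simp add: B_def field_simps)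
    also have "exp \<dots> = r powr (1 / \<theta>)" using r by (simp add: powr_def)
    finally have sat: "\<tau> ^ N \<le> r powr (1 / \<theta>)" .
    have "B * (- ln r) \<le> B * (r powr (- \<delta>) / \<delta>)"
      using B neg_ln_le_powr[OF r \<delta>] by (intro mult_left_mono) auto
    moreover have "1 \<le> r powr (- \<delta>)" using r \<delta> by (simp add: powr_minus one_le_inverse_iff powr_le1)
    ultimately have "real N + 1 \<le> B * (r powr (- \<delta>) / \<delta>) + 2 * r powr (- \<delta>)" using N(2) by linarith
    then show ?thesis using sat by (intro exI[of _ N]) (simp add: C_def algebra_simps)
  qed
  moreover have "C > 0" using B \<delta> by (simp add: C_def add_pos_pos)
  ultimately show ?thesis by blast
qed

lemma word_kernel_ge:
  assumes "0 < r" "0 \<le> s" "u \<in> {r powr (1 / \<theta>)..r}"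
  shows "u powr (- s) * sv_kernel (matrix_word T I) u \<le> word_kernel s r I"
  unfolding word_kernel_def
  by (rule window_sup_ge[OF assms]) (simp add: sv_kernel_pos sv_kernel_le_1 invertible_matrix_word less_imp_le)

lemma word_kernel_pos: assumes "0 < r" "r < 1" "0 \<le> s" shows "0 < word_kernel s r I"
proof -
  have "0 < r powr (- s) * sv_kernel (matrix_word T I) r"
    using assms by (simp add: sv_kernel_pos invertible_matrix_word)
  also have "\<dots> \<le> word_kernel s r I" using assms window[of r] by (intro word_kernel_ge) auto
  finally show ?thesis .
qed

text \<open>
  Losing a factor \<open>2\<close> avoids proving that the supremum over the window is attained.
\<close>
lemma word_kernel_almost_attained:
  assumes "0 < r" "r < 1" "0 \<le> s"
  shows "\<exists>u\<in>{r powr (1 / \<theta>)..r}. word_kernel s r I \<le> 2 * (u powr (- s) * sv_kernel (matrix_word T I) u)"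
proof (rule ccontr)
  assume "\<not> ?thesis"
  then have "u powr (- s) * sv_kernel (matrix_word T I) u \<le> word_kernel s r I / 2"
    if "u \<in> {r powr (1 / \<theta>)..r}" for u
    using that by (smt (verit) field_sum_of_halves)
  then have "(SUP u\<in>{r powr (1 / \<theta>)..r}. u powr (- s) * sv_kernel (matrix_word T I) u) \<le> word_kernel s r I / 2"
    using window[OF assms(1,2)] by (intro cSUP_least) auto
  then have "word_kernel s r I \<le> word_kernel s r I / 2"
    by (simp only: word_kernel_def)
  then show False using word_kernel_pos[OF assms, of I] by simp
qed

text \<open>
  Max-flow min-cut for a tree with capacities \<open>w\<close>, in the form of a recursion from level \<open>N\<close> towards the
  root: add up flows and cuts of the children; if the total exceeds the capacity \<open>w I\<close> of the node, use
  the cut \<open>{I}\<close> instead and scale the flow down to mass \<open>w I\<close>. The constraint is claimed only for words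
  that are not shorter than \<open>I\<close>; for shorter ones it is enforced at later stages of the recursion.
\<close>
lemma tree_flow:
  fixes w :: "'m list \<Rightarrow> real"
  assumes w: "\<And>K. 0 < w K" and R: "finite R" and rep: "\<And>x. x \<in> E \<Longrightarrow> \<exists>y\<in>R. \<forall>k<N. x k = y k"
    and len: "length I + h = N"
  shows "\<exists>A p. finite A \<and> E \<inter> cylinder I \<subseteq> (\<Union>K\<in>A. cylinder K) \<and>
    (\<forall>x. 0 \<le> p x) \<and> (\<forall>x. p x \<noteq> 0 \<longrightarrow> x \<in> cylinder I) \<and> sum w A \<le> sum p R \<and>
    (\<forall>K. length I \<le> length K \<longrightarrow> length K \<le> N \<longrightarrow> sum p (R \<inter> cylinder K) \<le> w K)"
  using len
proof (induction h arbitrary: I)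
  case 0
  show ?case
  proof (cases "E \<inter> cylinder I = {}")
    case True
    then show ?thesis using w by (intro exI[of _ "{}"] exI[of _ "\<lambda>_. 0"]) (auto simp: less_imp_le)
  next
    case False
    then obtain x where x: "x \<in> E" "x \<in> cylinder I" by blast
    obtain y where y: "y \<in> R" "\<And>k. k < N \<Longrightarrow> x k = y k" using rep[OF x(1)] by blast
    have "map y [0..<length I] = map x [0..<length I]" using y(2) 0 by simp
    then have yI: "y \<in> cylinder I" using x(2) by (simp only: cylinder_def mem_Collect_eq)
    define p where "p = (\<lambda>x. if x = y then w I else 0)"
    have pR: "sum p X = (if y \<in> X then w I else 0)" if "X \<subseteq> R" for X
      using finite_subset[OF that R] by (simp add: p_def)
    have "sum p (R \<inter> cylinder K) \<le> w K" if "length K = N" for K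
    proof (cases "y \<in> cylinder K")
      case True
      then have "I = K" using cylinder_unique[OF yI True] that 0 by simp
      then show ?thesis using w[of K] by (subst pR) auto
    next
      case False
      then show ?thesis using w[of K] by (subst pR) (auto simp: less_imp_le)
    qed
    moreover have "sum p R = w I" using y(1) by (subst pR) auto
    ultimately show ?thesis using 0 w[of I] yI
      by (intro exI[of _ "{I}"] exI[of _ p]) (auto simp: p_def less_imp_le)
  qed
next
  case (Suc h)
  define Q where "Q j A p \<longleftrightarrow> finite A \<and> E \<inter> cylinder (I @ [j]) \<subseteq> (\<Union>K\<in>A. cylinder K) \<and>
    (\<forall>x. 0 \<le> p x) \<and> (\<forall>x. p x \<noteq> 0 \<longrightarrow> x \<in> cylinder (I @ [j])) \<and> sum w A \<le> sum p R \<and>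
    (\<forall>K. length (I @ [j]) \<le> length K \<longrightarrow> length K \<le> N \<longrightarrow> sum p (R \<inter> cylinder K) \<le> w K)" for j A p
  have "\<exists>A p. Q j A p" for j
    unfolding Q_def by (rule Suc.IH) (use Suc.prems in simp)
  then obtain A p where Q: "\<And>j. Q j (A j) (p j)" by metis
  have Ap: "finite (A j)" "E \<inter> cylinder (I @ [j]) \<subseteq> (\<Union>K\<in>A j. cylinder K)"
    "0 \<le> p j x" "p j x \<noteq> 0 \<Longrightarrow> x \<in> cylinder (I @ [j])" "sum w (A j) \<le> sum (p j) R"
    "length (I @ [j]) \<le> length K \<Longrightarrow> length K \<le> N \<Longrightarrow> sum (p j) (R \<inter> cylinder K) \<le> w K"
    for j x K
    using Q[of j] unfolding Q_def by simp_all
  define P where "P x = (\<Sum>j\<in>UNIV. p j x)" for x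
  define t where "t = sum P R"
  have P0: "0 \<le> P x" for x unfolding P_def using Ap(3) by (intro sum_nonneg) auto
  have Psupp: "x \<in> cylinder I" if "P x \<noteq> 0" for x
  proof -
    have "\<exists>j. p j x \<noteq> 0"
    proof (rule ccontr)
      assume "\<not> (\<exists>j. p j x \<noteq> 0)"
      then have "P x = 0" by (simp add: P_def)
      then show False using that by simp
    qed
    then obtain j where "p j x \<noteq> 0" by (elim exE)
    then have "x \<in> cylinder (I @ [j])" by (rule Ap(4))
    then show ?thesis by (rule subsetD[OF cylinder_append_subset])
  qed
  have cover: "E \<inter> cylinder I \<subseteq> (\<Union>K\<in>(\<Union>j. A j). cylinder K)"
  proof
    fix x assume "x \<in> E \<inter> cylinder I"
    then have "x \<in> E \<inter> cylinder (I @ [x (length I)])" using cylinder_split by blast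
    then show "x \<in> (\<Union>K\<in>(\<Union>j. A j). cylinder K)" using Ap(2) by blast
  qed
  have mass: "sum w (\<Union>j. A j) \<le> t"
  proof -
    have "sum w (\<Union>j. A j) \<le> (\<Sum>j\<in>UNIV. sum w (A j))"
      using Ap(1) w by (intro sum_UN_le) (auto simp: less_imp_le)
    also have "\<dots> \<le> (\<Sum>j\<in>UNIV. sum (p j) R)" using Ap(5) by (intro sum_mono)
    also have "\<dots> = t" unfolding t_def P_def by (rule sum.swap)
    finally show ?thesis .
  qed
  have longer: "sum P (R \<inter> cylinder K) \<le> w K" if K: "length I < length K" "length K \<le> N" for K
  proof -
    have "sum P (R \<inter> cylinder K) = (\<Sum>j\<in>UNIV. sum (p j) (R \<inter> cylinder K))"
      unfolding P_def by (rule sum.swap)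
    also have "\<dots> = (\<Sum>j\<in>{K ! length I}. sum (p j) (R \<inter> cylinder K))"
    proof (intro sum.mono_neutral_right ballI)
      fix j assume j: "j \<in> UNIV - {K ! length I}"
      have "p j x = 0" if "x \<in> R \<inter> cylinder K" for x
        using cylinder_append_disjoint[OF Ap(4)[of j x], of K] that K(1) j by auto
      then show "sum (p j) (R \<inter> cylinder K) = 0" by (simp add: sum.neutral)
    qed auto
    also have "\<dots> \<le> w K" using Ap(6)[of "K ! length I" K] K by simp
    finally show ?thesis .
  qed
  have same: "sum P (R \<inter> cylinder K) = (if K = I then t else 0)" if "length K = length I" for K
  proof (cases "K = I")
    case True
    have "sum P (R \<inter> cylinder I) = sum P R"
      using Psupp R by (intro sum.mono_neutral_left) auto
    then show ?thesis using True by (simp add: t_def)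
  next
    case False
    have "P x = 0" if "x \<in> R \<inter> cylinder K" for x
      using cylinder_unique[OF Psupp, of x K] that False \<open>length K = length I\<close> by fastforce
    then show ?thesis using False by (simp add: sum.neutral)
  qed
  show ?case
  proof (cases "t \<le> w I")
    case True
    have "sum P (R \<inter> cylinder K) \<le> w K" if "length I \<le> length K" "length K \<le> N" for K
      using longer[of K] same[of K] that True w[of K] by (cases "length I < length K") (auto simp: less_imp_le)
    then show ?thesis
      using Ap(1) cover P0 Psupp mass by (intro exI[of _ "\<Union>j. A j"] exI[of _ P]) (auto simp: t_def)
  next
    case False
    then have t: "0 < t" "w I < t" using w[of I] by auto
    define c where "c = w I / t"
    have c: "0 < c" "c \<le> 1" using t w[of I] by (simp_all add: c_def)
    have "c * sum P (R \<inter> cylinder K) \<le> w K" if K: "length I \<le> length K" "length K \<le> N" for K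
    proof (cases "length I < length K")
      case True
      have "c * sum P (R \<inter> cylinder K) \<le> 1 * sum P (R \<inter> cylinder K)"
        using c P0 by (intro mult_right_mono sum_nonneg) auto
      then show ?thesis using longer[OF True K(2)] by simp
    next
      case False
      then show ?thesis using same[of K] K t w[of K] by (auto simp: c_def less_imp_le)
    qed
    moreover have "c * sum P R = w I" using t by (simp add: c_def t_def)
    ultimately show ?thesis
      using c P0 Psupp
      by (intro exI[of _ "{I}"] exI[of _ "\<lambda>x. c * P x"]) (auto simp: sum_distrib_left[symmetric])
  qed
qed

lemma finite_prefix_representatives:
  "\<exists>R. finite R \<and> R \<subseteq> E \<and> (\<forall>x\<in>E. \<exists>y\<in>R. \<forall>k<N. x k = y k)"
proof -
  define W where "W = (\<lambda>x. map x [0..<N]) ` E"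
  have "W \<subseteq> {I. length I = N}" by (auto simp: W_def)
  then have fin: "finite W" using finite_words finite_subset by blast
  define rep where "rep I = (SOME x. x \<in> E \<and> map x [0..<N] = I)" for I
  have rep: "rep I \<in> E" "map (rep I) [0..<N] = I" if "I \<in> W" for I
    using that someI_ex[of "\<lambda>x. x \<in> E \<and> map x [0..<N] = I"] by (auto simp: W_def rep_def)
  have "\<exists>y\<in>rep ` W. \<forall>k<N. x k = y k" if "x \<in> E" for x
  proof -
    have I: "map x [0..<N] \<in> W" unfolding W_def using that by (rule imageI)
    show ?thesis using rep(2)[OF I] I by (intro bexI[of _ "rep (map x [0..<N])"]) auto
  qed
  then show ?thesis using fin rep(1) by (intro exI[of _ "rep ` W"]) auto
qed

text \<open>
  Let \<open>p\<close> be the flow for the capacities \<open>1 / J\<close>, of mass \<open>t\<close>. For fixed \<open>x\<close>, the points \<open>y\<close> that agree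
  with \<open>x\<close> in exactly \<open>n\<close> letters, or in at least \<open>N\<close> for \<open>n = N\<close>, lie in one cylinder, whose mass times the value of \<open>J\<close> there is at
  most \<open>1\<close>. Hence \<open>\<Sum>\<^sub>y p(y) J(x, y) \<le> N + 1\<close>, and the weights \<open>p / t\<close> have energy at most \<open>(N + 1) / t\<close>.
\<close>
lemma cheap_cut:
  assumes r: "0 < r" "r < 1" and s: "0 \<le> s" and N: "\<tau> ^ N \<le> r powr (1 / \<theta>)"
  shows "\<exists>A. finite A \<and> E \<subseteq> (\<Union>K\<in>A. cylinder K) \<and>
    (\<Sum>K\<in>A. 1 / word_kernel s r K) \<le> (real N + 1) / min_energy s r"
proof -
  define w where "w K = 1 / word_kernel s r K" for K
  have w: "0 < w K" for K using word_kernel_pos[OF r s] by (simp add: w_def)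
  obtain R where R: "finite R" "R \<subseteq> E" "\<And>x. x \<in> E \<Longrightarrow> \<exists>y\<in>R. \<forall>k<N. x k = y k"
    using finite_prefix_representatives[of N] by auto
  obtain A p where Ap: "finite A" "E \<inter> cylinder [] \<subseteq> (\<Union>K\<in>A. cylinder K)" "\<And>x. 0 \<le> p x"
    "sum w A \<le> sum p R" "\<And>K. length K \<le> N \<Longrightarrow> sum p (R \<inter> cylinder K) \<le> w K"
    using tree_flow[where w = w and R = R and N = N and I = "[]" and h = N, OF w R(1,3)] by auto
  have EA: "E \<subseteq> (\<Union>K\<in>A. cylinder K)" using Ap(2) by (auto simp: cylinder_def)
  then have "A \<noteq> {}" using E_nonempty by auto
  then have wA: "0 < sum w A" using w Ap(1) by (intro sum_pos) auto
  define t where "t = sum p R"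
  have t: "0 < t" using wA Ap(4) by (simp add: t_def)
  have "(R, \<lambda>x. p x / t) \<in> weights"
    using R Ap(3) t by (simp add: weights_def t_def flip: sum_divide_distrib)
  then have "min_energy s r \<le> discrete_energy s r R (\<lambda>x. p x / t)"
    by (rule min_energy_le[OF r s])
  also have "\<dots> = (\<Sum>x\<in>R. p x * (\<Sum>y\<in>R. p y * J s r x y)) / t\<^sup>2"
    by (simp add: discrete_energy_def sum_distrib_left sum_divide_distrib power2_eq_square mult_ac)
  also have "(\<Sum>x\<in>R. p x * (\<Sum>y\<in>R. p y * J s r x y)) \<le> (\<Sum>x\<in>R. p x * (real N + 1))"
  proof (intro sum_mono mult_left_mono Ap(3))
    fix x assume "x \<in> R"
    have "J s r x y \<le> (\<Sum>n\<le>N. if y \<in> cylinder (map x [0..<n]) then word_kernel s r (map x [0..<n]) else 0)" for y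
    proof -
      define n where "n = agreement N x y"
      have "map y [0..<n] = map x [0..<n]" using agreement_agree[of _ N x y, symmetric] by (simp add: n_def)
      then have "y \<in> cylinder (map x [0..<n])" by (simp add: cylinder_def)
      then have "J s r x y = (if y \<in> cylinder (map x [0..<n]) then word_kernel s r (map x [0..<n]) else 0)"
        using J_eq_word_kernel[OF r N] by (simp add: n_def)
      also have "\<dots> \<le> (\<Sum>n\<le>N. if y \<in> cylinder (map x [0..<n]) then word_kernel s r (map x [0..<n]) else 0)"
        using word_kernel_pos[OF r s] agreement_le
        by (intro member_le_sum) (auto simp: less_imp_le n_def)
      finally show ?thesis .
    qed
    then have "(\<Sum>y\<in>R. p y * J s r x y) \<le>
        (\<Sum>y\<in>R. p y * (\<Sum>n\<le>N. if y \<in> cylinder (map x [0..<n]) then word_kernel s r (map x [0..<n]) else 0))"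
      using Ap(3) by (intro sum_mono mult_left_mono) auto
    also have "\<dots> = (\<Sum>n\<le>N. \<Sum>y\<in>R. if y \<in> cylinder (map x [0..<n]) then p y * word_kernel s r (map x [0..<n]) else 0)"
      unfolding sum_distrib_left by (subst sum.swap) (intro sum.cong refl, simp)
    also have "\<dots> = (\<Sum>n\<le>N. sum p (R \<inter> cylinder (map x [0..<n])) * word_kernel s r (map x [0..<n]))"
      by (intro sum.cong refl) (simp add: sum.inter_restrict[OF R(1)] sum_distrib_right if_distrib if_distribR cong: if_cong)
    also have "\<dots> \<le> (\<Sum>n\<le>N. 1)"
    proof (rule sum_mono)
      fix n assume n: "n \<in> {..N}"
      then have "sum p (R \<inter> cylinder (map x [0..<n])) \<le> 1 / word_kernel s r (map x [0..<n])"
        using Ap(5)[of "map x [0..<n]"] by (simp add: w_def)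
      then show "sum p (R \<inter> cylinder (map x [0..<n])) * word_kernel s r (map x [0..<n]) \<le> 1"
        using word_kernel_pos[OF r s, of "map x [0..<n]"] by (simp add: field_simps)
    qed
    finally show "(\<Sum>y\<in>R. p y * J s r x y) \<le> real N + 1" by simp
  qed
  then have "(\<Sum>x\<in>R. p x * (\<Sum>y\<in>R. p y * J s r x y)) / t\<^sup>2 \<le> (\<Sum>x\<in>R. p x * (real N + 1)) / t\<^sup>2"
    by (intro divide_right_mono) auto
  also have "(\<Sum>x\<in>R. p x * (real N + 1)) / t\<^sup>2 = (real N + 1) / t"
    using t by (simp add: t_def power2_eq_square flip: sum_distrib_right)
  finally have "t \<le> (real N + 1) / min_energy s r"
    using t min_energy_pos[OF r s] by (simp add: field_simps)
  then show ?thesis using EA Ap(1,4) by (intro exI[of _ A]) (auto simp: w_def t_def)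
qed

end

section \<open>The upper bound for all translations\<close>

lemma cover_sum_mono_exponent:
  assumes "\<And>U. U \<in> \<U> \<Longrightarrow> 0 < diameter U \<and> diameter U \<le> 1" "s' \<le> s"
  shows "cover_sum s \<U> \<le> cover_sum s' \<U>"
  unfolding cover_sum_def
  using assms by (intro infsum_mono nonneg_summable_on_complete ennreal_leI powr_mono') (auto intro: less_imp_le)

lemma cover_sum_finite:
  assumes "finite \<U>" shows "cover_sum s \<U> = ennreal (\<Sum>U\<in>\<U>. diameter U powr s)"
  unfolding cover_sum_def using assms by (simp add: sum_ennreal)

text \<open>
  Lets the lower bound work with the finitely many members of a cover that contain a point with weight.
\<close>
lemma finite_sum_le_cover_sum:
  assumes "finite \<V>" "\<V> \<subseteq> \<U>"
  shows "ennreal (\<Sum>U\<in>\<V>. diameter U powr s) \<le> cover_sum s \<U>"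
proof -
  have "ennreal (\<Sum>U\<in>\<V>. diameter U powr s) = (\<Sum>\<^sub>\<infinity>U\<in>\<V>. ennreal (diameter U powr s))"
    using assms(1) by (simp add: sum_ennreal)
  also have "\<dots> \<le> cover_sum s \<U>"
    unfolding cover_sum_def using assms(2) by (intro infsum_mono_neutral nonneg_summable_on_complete) auto
  finally show ?thesis .
qed

context affine_ifs_coding
begin

definition upper_admissible :: "real \<Rightarrow> (real^'d) set \<Rightarrow> bool" where
  "upper_admissible s F \<longleftrightarrow> (\<forall>\<epsilon>>0. \<exists>r0\<in>{0<..1}. \<forall>r\<in>{0<..<r0}. \<exists>\<U>.
     admissible_cover \<theta> r F \<U> \<and> cover_sum s \<U> \<le> ennreal \<epsilon>)"

definition lower_admissible :: "real \<Rightarrow> (real^'d) set \<Rightarrow> bool" where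
  "lower_admissible s F \<longleftrightarrow> (\<forall>\<epsilon>>0. \<forall>r0\<in>{0<..1}. \<exists>r\<in>{0<..<r0}. \<exists>\<U>.
     admissible_cover \<theta> r F \<U> \<and> cover_sum s \<U> \<le> ennreal \<epsilon>)"

lemma intermediate_dim_eq:
  "upper_intermediate_dim \<theta> F = Inf {s. 0 \<le> s \<and> upper_admissible s F}"
  "lower_intermediate_dim \<theta> F = Inf {s. 0 \<le> s \<and> lower_admissible s F}"
  by (simp_all add: upper_intermediate_dim_def lower_intermediate_dim_def upper_admissible_def lower_admissible_def)

lemma coding_map_cylinder:
  assumes "x \<in> cylinder K"
  shows "coding_map T a x = (\<Sum>k<length K. matrix_word T (take k K) *v (a $ (K ! k)))
    + matrix_word T K *v coding_map T a (\<lambda>k. x (k + length K))"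
proof -
  have K: "map x [0..<length K] = K" using assms by (simp add: cylinder_def)
  have "coding_term a x k = matrix_word T (take k K) *v (a $ (K ! k))" if "k < length K" for k
  proof -
    have "take k K = map x [0..<k]" "K ! k = x k"
      using that by (subst (1) K[symmetric], simp add: take_map)+
    then show ?thesis by (simp add: coding_term_def)
  qed
  then show ?thesis using coding_map_shift[of a x "length K"] K by simp
qed

text \<open>
  The image of the cylinder is a translate of the image under \<open>T\<^sub>K\<close> of a part of the ball that contains
  all values of the coding map.
\<close>
lemma image_cylinder_cover:
  assumes u: "0 < u"
  shows "\<exists>\<V>. finite \<V> \<and> coding_map T a ` cylinder K \<subseteq> \<Union>\<V> \<and> (\<forall>V\<in>\<V>. bounded V \<and> diameter V = u) \<and>
    card \<V> * sv_kernel (matrix_word T K) u \<le> (2 * (norm a / (1 - \<tau>)) * CARD('d) + 1) ^ CARD('d)"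
proof -
  have R: "0 \<le> norm a / (1 - \<tau>)" using tau_less_1 by simp
  obtain C where C: "finite C"
    "card C * sv_kernel (matrix_word T K) u \<le> (2 * (norm a / (1 - \<tau>)) * CARD('d) + 1) ^ CARD('d)"
    "\<forall>z. norm z \<le> norm a / (1 - \<tau>) \<longrightarrow> (\<exists>c\<in>C. matrix_word T K *v z \<in> cball c (u / 2))"
    using linear_image_ball_cover[OF invertible_matrix_word R u, of K] by (elim exE conjE) (rule that)
  define b where "b = (\<Sum>k<length K. matrix_word T (take k K) *v (a $ (K ! k)))"
  define V where "V c = cball (b + c) (u / 2)" for c
  have "\<exists>c\<in>C. coding_map T a x \<in> V c" if x: "x \<in> cylinder K" for x
  proof -
    define z where "z = coding_map T a (\<lambda>k. x (k + length K))"
    have "norm z \<le> norm a / (1 - \<tau>)" unfolding z_def by (rule norm_coding_map_le)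
    then obtain c where c: "c \<in> C" "matrix_word T K *v z \<in> cball c (u / 2)" using C(3) by blast
    have "coding_map T a x = b + matrix_word T K *v z"
      unfolding b_def z_def by (rule coding_map_cylinder[OF x])
    then show ?thesis using c by (auto simp: V_def dist_norm)
  qed
  moreover have "card (V ` C) * sv_kernel (matrix_word T K) u \<le> card C * sv_kernel (matrix_word T K) u"
    using card_image_le[OF C(1), of V] sv_kernel_pos[OF invertible_matrix_word u, of K]
    by (intro mult_right_mono) auto
  ultimately show ?thesis
    using C(1,2) u by (intro exI[of _ "V ` C"]) (auto simp: V_def)
qed

lemma cover_from_energy:
  "\<exists>M>0. \<forall>s r N. 0 \<le> s \<longrightarrow> 0 < r \<longrightarrow> r < 1 \<longrightarrow> \<tau> ^ N \<le> r powr (1 / \<theta>) \<longrightarrow>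
     (\<exists>\<U>. admissible_cover \<theta> r (coding_map T a ` E) \<U> \<and>
        cover_sum s \<U> \<le> ennreal (M * ((real N + 1) / min_energy s r)))"
proof -
  define M where "M = (2 * (norm a / (1 - \<tau>)) * CARD('d) + 1) ^ CARD('d)"
  have M: "0 < M" using tau_less_1 by (auto simp: M_def intro!: zero_less_power add_nonneg_pos)
  have "\<exists>\<U>. admissible_cover \<theta> r (coding_map T a ` E) \<U> \<and>
        cover_sum s \<U> \<le> ennreal (2 * M * ((real N + 1) / min_energy s r))"
    if s: "0 \<le> s" and r: "0 < r" "r < 1" and N: "\<tau> ^ N \<le> r powr (1 / \<theta>)" for s r N
  proof -
    obtain A where A: "finite A" "E \<subseteq> (\<Union>K\<in>A. cylinder K)"
      "(\<Sum>K\<in>A. 1 / word_kernel s r K) \<le> (real N + 1) / min_energy s r"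
      using cheap_cut[OF r s N] by auto
    obtain u where u: "\<And>K. u K \<in> {r powr (1 / \<theta>)..r}"
      "\<And>K. word_kernel s r K \<le> 2 * (u K powr (- s) * sv_kernel (matrix_word T K) (u K))"
      using word_kernel_almost_attained[OF r s] by metis
    have u0: "0 < u K" for K using window_pos[OF r(1) u(1)] .
    have "\<forall>K. \<exists>\<V>. finite \<V> \<and> coding_map T a ` cylinder K \<subseteq> \<Union>\<V> \<and> (\<forall>V\<in>\<V>. bounded V \<and> diameter V = u K) \<and>
      card \<V> * sv_kernel (matrix_word T K) (u K) \<le> M"
      unfolding M_def using image_cylinder_cover[OF u0] by blast
    then obtain \<V> where \<V>: "\<forall>K. finite (\<V> K) \<and> coding_map T a ` cylinder K \<subseteq> \<Union>(\<V> K) \<and>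
      (\<forall>V\<in>\<V> K. bounded V \<and> diameter V = u K) \<and> card (\<V> K) * sv_kernel (matrix_word T K) (u K) \<le> M"
      by (rule choice[THEN exE])
    define \<U> where "\<U> = (\<Union>K\<in>A. \<V> K)"
    have fin: "finite \<U>" using A(1) \<V> by (simp add: \<U>_def)
    have "coding_map T a ` E \<subseteq> \<Union>\<U>"
    proof
      fix y assume "y \<in> coding_map T a ` E"
      then obtain x where x: "x \<in> E" "y = coding_map T a x" by blast
      obtain K where K: "K \<in> A" "x \<in> cylinder K" using A(2) x(1) by blast
      have "y \<in> \<Union>(\<V> K)" using \<V>[rule_format, of K] K(2) x(2) by blast
      then show "y \<in> \<Union>\<U>" using K(1) by (auto simp: \<U>_def)
    qed
    moreover have "\<forall>U\<in>\<U>. bounded U \<and> r powr (1 / \<theta>) \<le> diameter U \<and> diameter U \<le> r"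
      using \<V> u(1) by (auto simp: \<U>_def)
    ultimately have "admissible_cover \<theta> r (coding_map T a ` E) \<U>"
      using fin by (simp add: admissible_cover_def countable_finite)
    moreover have "(\<Sum>U\<in>\<U>. diameter U powr s) \<le> 2 * M * ((real N + 1) / min_energy s r)"
    proof -
      have "(\<Sum>U\<in>\<U>. diameter U powr s) \<le> (\<Sum>K\<in>A. \<Sum>U\<in>\<V> K. diameter U powr s)"
        unfolding \<U>_def using \<V> A(1) by (intro sum_UN_le) auto
      also have "\<dots> \<le> (\<Sum>K\<in>A. 2 * M * (1 / word_kernel s r K))"
      proof (rule sum_mono)
        fix K
        have Z: "0 < sv_kernel (matrix_word T K) (u K)" by (rule sv_kernel_pos[OF invertible_matrix_word u0])
        have wk: "0 < word_kernel s r K" by (rule word_kernel_pos[OF r s])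
        have "(\<Sum>U\<in>\<V> K. diameter U powr s) = card (\<V> K) * u K powr s"
          using \<V> by simp
        also have "\<dots> \<le> (M / sv_kernel (matrix_word T K) (u K)) * u K powr s"
          using \<V>[rule_format, of K] Z by (intro mult_right_mono) (auto simp: field_simps)
        also have "\<dots> = M * (u K powr s / sv_kernel (matrix_word T K) (u K))" by simp
        also have "\<dots> \<le> M * (2 / word_kernel s r K)"
        proof -
          have "word_kernel s r K * u K powr s \<le> 2 * sv_kernel (matrix_word T K) (u K)"
            using mult_right_mono[OF u(2)[of K], of "u K powr s"] u0[of K]
            by (simp add: powr_minus field_simps)
          then show ?thesis using Z wk M by (intro mult_left_mono) (auto simp: field_simps)
        qed
        finally show "(\<Sum>U\<in>\<V> K. diameter U powr s) \<le> 2 * M * (1 / word_kernel s r K)" by (simp add: mult.commute)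
      qed
      also have "\<dots> = 2 * M * (\<Sum>K\<in>A. 1 / word_kernel s r K)" by (rule sum_distrib_left[symmetric])
      also have "\<dots> \<le> 2 * M * ((real N + 1) / min_energy s r)"
        using A(3) M by (intro mult_left_mono) auto
      finally show ?thesis .
    qed
    ultimately show ?thesis using cover_sum_finite[OF fin, of s] by (auto intro!: exI[of _ \<U>] ennreal_leI)
  qed
  then show ?thesis using M by (intro exI[of _ "2 * M"]) auto
qed

text \<open>
  If the minimal energy exceeds \<open>r\<^bsup>-\<delta>\<^esup>\<close>, the cover built from the cheap cut costs \<open>O(r\<^bsup>\<delta>/2\<^esup>)\<close>: half of
  the exponent absorbs the logarithmic factor.
\<close>
lemma cheap_covers:
  assumes s: "0 \<le> s" and \<delta>: "0 < \<delta>" and \<epsilon>: "0 < \<epsilon>"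
  shows "eventually (\<lambda>r. r powr (- \<delta>) < min_energy s r \<longrightarrow>
    (\<exists>\<U>. admissible_cover \<theta> r (coding_map T a ` E) \<U> \<and> cover_sum s \<U> \<le> ennreal \<epsilon>)) (at_right 0)"
proof -
  obtain M where M: "0 < M" "\<And>s r N. 0 \<le> s \<Longrightarrow> 0 < r \<Longrightarrow> r < 1 \<Longrightarrow> \<tau> ^ N \<le> r powr (1 / \<theta>) \<Longrightarrow>
     \<exists>\<U>. admissible_cover \<theta> r (coding_map T a ` E) \<U> \<and>
        cover_sum s \<U> \<le> ennreal (M * ((real N + 1) / min_energy s r))"
    using cover_from_energy[of a] by auto
  obtain C where C: "0 < C"
    "\<And>r. 0 < r \<Longrightarrow> r < 1 \<Longrightarrow> \<exists>N. \<tau> ^ N \<le> r powr (1 / \<theta>) \<and> real N + 1 \<le> C * r powr (- (\<delta> / 2))"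
    using saturation_level_log_bound[of "\<delta> / 2"] \<delta> by auto
  define b where "b = min 1 ((\<epsilon> / (M * C)) powr (2 / \<delta>))"
  have b: "0 < b" using \<epsilon> M(1) C(1) by (simp add: b_def)
  have "\<exists>\<U>. admissible_cover \<theta> r (coding_map T a ` E) \<U> \<and> cover_sum s \<U> \<le> ennreal \<epsilon>"
    if r: "0 < r" "r < b" and en: "r powr (- \<delta>) < min_energy s r" for r
  proof -
    have r1: "r < 1" using r by (simp add: b_def)
    obtain N where N: "\<tau> ^ N \<le> r powr (1 / \<theta>)" "real N + 1 \<le> C * r powr (- (\<delta> / 2))"
      using C(2)[OF r(1) r1] by blast
    obtain \<U> where \<U>: "admissible_cover \<theta> r (coding_map T a ` E) \<U>"
      "cover_sum s \<U> \<le> ennreal (M * ((real N + 1) / min_energy s r))"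
      using M(2)[OF s r(1) r1 N(1)] by blast
    have "(real N + 1) / min_energy s r \<le> C * r powr (- (\<delta> / 2)) / r powr (- \<delta>)"
      using N(2) en r C(1) by (intro frac_le) auto
    also have "\<dots> = C * r powr (\<delta> / 2)"
      using r(1) by (simp add: powr_diff[symmetric] flip: times_divide_eq_right)
    also have "r powr (\<delta> / 2) \<le> ((\<epsilon> / (M * C)) powr (2 / \<delta>)) powr (\<delta> / 2)"
      using r \<delta> by (intro powr_mono2) (auto simp: b_def)
    also have "\<dots> = \<epsilon> / (M * C)"
      using \<delta> \<epsilon> M(1) C(1) by (simp add: powr_powr)
    finally have "M * ((real N + 1) / min_energy s r) \<le> M * (C * (\<epsilon> / (M * C)))"
      using M(1) C(1) by (intro mult_left_mono) (auto simp: mult_left_mono)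
    also have "\<dots> = \<epsilon>" using M(1) C(1) by simp
    finally show ?thesis using \<U> by (meson ennreal_leI order_trans)
  qed
  then show ?thesis
    unfolding eventually_at_right_field using b by blast
qed

lemma upper_admissible_above:
  assumes "upper_capacity_dim T \<theta> E < s"
  shows "upper_admissible s (coding_map T a ` E)"
  unfolding upper_admissible_def
proof (intro allI impI)
  fix \<epsilon> :: real assume \<epsilon>: "0 < \<epsilon>"
  have s: "0 \<le> s" using assms upper_capacity_dim_sign(1) by linarith
  obtain \<delta> where \<delta>: "0 < \<delta>" "eventually (\<lambda>r. r powr (- \<delta>) < min_energy s r) (at_right 0)"
    using above_upper_capacity_dim[OF assms] by blast
  have "eventually (\<lambda>r. \<exists>\<U>. admissible_cover \<theta> r (coding_map T a ` E) \<U> \<and> cover_sum s \<U> \<le> ennreal \<epsilon>) (at_right 0)"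
    using cheap_covers[OF s \<delta>(1) \<epsilon>, of a] \<delta>(2) by eventually_elim blast
  then obtain b where b: "0 < b" "\<And>r. 0 < r \<Longrightarrow> r < b \<Longrightarrow>
      \<exists>\<U>. admissible_cover \<theta> r (coding_map T a ` E) \<U> \<and> cover_sum s \<U> \<le> ennreal \<epsilon>"
    unfolding eventually_at_right_field by blast
  show "\<exists>r0\<in>{0<..1}. \<forall>r\<in>{0<..<r0}. \<exists>\<U>. admissible_cover \<theta> r (coding_map T a ` E) \<U> \<and> cover_sum s \<U> \<le> ennreal \<epsilon>"
    by (rule bexI[of _ "min 1 b"]) (use b in auto)
qed

lemma lower_admissible_above:
  assumes "lower_capacity_dim T \<theta> E < s"
  shows "lower_admissible s (coding_map T a ` E)"
  unfolding lower_admissible_def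
proof (intro allI impI ballI)
  fix \<epsilon> r0 :: real assume \<epsilon>: "0 < \<epsilon>" and r0: "r0 \<in> {0<..1}"
  have s: "0 \<le> s" using assms lower_capacity_dim_sign(1) by linarith
  obtain \<delta> where \<delta>: "0 < \<delta>" "frequently (\<lambda>r. r powr (- \<delta>) < min_energy s r) (at_right 0)"
    using above_lower_capacity_dim[OF assms] by blast
  have "eventually (\<lambda>r. r \<in> {0<..<r0}) (at_right 0)"
    using r0 by (intro eventually_at_right_real) auto
  from frequently_eventually_conj[OF \<delta>(2) eventually_conj[OF cheap_covers[OF s \<delta>(1) \<epsilon>, of a] this]]
  have "frequently (\<lambda>r. r \<in> {0<..<r0} \<and>
      (\<exists>\<U>. admissible_cover \<theta> r (coding_map T a ` E) \<U> \<and> cover_sum s \<U> \<le> ennreal \<epsilon>)) (at_right 0)"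
    by (rule frequently_elim1) blast
  then show "\<exists>r\<in>{0<..<r0}. \<exists>\<U>. admissible_cover \<theta> r (coding_map T a ` E) \<U> \<and> cover_sum s \<U> \<le> ennreal \<epsilon>"
    by (auto dest!: frequently_ex)
qed

text \<open>
  The sets of admissible exponents are non-empty since they contain everything above the capacity
  dimension; otherwise their infima would be arbitrary.
\<close>
lemma intermediate_dim_greatest:
  "(\<And>s'. 0 \<le> s' \<Longrightarrow> upper_admissible s' (coding_map T a ` E) \<Longrightarrow> s \<le> s') \<Longrightarrow>
     s \<le> upper_intermediate_dim \<theta> (coding_map T a ` E)"
  "(\<And>s'. 0 \<le> s' \<Longrightarrow> lower_admissible s' (coding_map T a ` E) \<Longrightarrow> s \<le> s') \<Longrightarrow>
     s \<le> lower_intermediate_dim \<theta> (coding_map T a ` E)"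
proof -
  have "{s. 0 \<le> s \<and> upper_admissible s (coding_map T a ` E)} \<noteq> {}"
    using upper_admissible_above[of "upper_capacity_dim T \<theta> E + 1" a] upper_capacity_dim_sign(1)
    by (auto intro!: exI[of _ "upper_capacity_dim T \<theta> E + 1"])
  then show "(\<And>s'. 0 \<le> s' \<Longrightarrow> upper_admissible s' (coding_map T a ` E) \<Longrightarrow> s \<le> s') \<Longrightarrow>
     s \<le> upper_intermediate_dim \<theta> (coding_map T a ` E)"
    unfolding intermediate_dim_eq by (intro cInf_greatest) auto
  have "{s. 0 \<le> s \<and> lower_admissible s (coding_map T a ` E)} \<noteq> {}"
    using lower_admissible_above[of "lower_capacity_dim T \<theta> E + 1" a] lower_capacity_dim_sign(1)
    by (auto intro!: exI[of _ "lower_capacity_dim T \<theta> E + 1"])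
  then show "(\<And>s'. 0 \<le> s' \<Longrightarrow> lower_admissible s' (coding_map T a ` E) \<Longrightarrow> s \<le> s') \<Longrightarrow>
     s \<le> lower_intermediate_dim \<theta> (coding_map T a ` E)"
    unfolding intermediate_dim_eq by (intro cInf_greatest) auto
qed

lemma intermediate_dim_nonneg:
  "0 \<le> upper_intermediate_dim \<theta> (coding_map T a ` E)"
  "0 \<le> lower_intermediate_dim \<theta> (coding_map T a ` E)"
  by (rule intermediate_dim_greatest, assumption)+

lemma intermediate_dim_le_capacity_dim:
  "upper_intermediate_dim \<theta> (coding_map T a ` E) \<le> upper_capacity_dim T \<theta> E"
  "lower_intermediate_dim \<theta> (coding_map T a ` E) \<le> lower_capacity_dim T \<theta> E"
proof -
  have bdd: "bdd_below {s::real. 0 \<le> s \<and> P s}" for P by (rule bdd_belowI[of _ 0]) auto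
  have "Inf {s. 0 \<le> s \<and> upper_admissible s (coding_map T a ` E)} \<le> s" if "upper_capacity_dim T \<theta> E < s" for s
    using that upper_capacity_dim_sign(1) upper_admissible_above[OF that, of a]
    by (intro cInf_lower bdd) simp
  then show "upper_intermediate_dim \<theta> (coding_map T a ` E) \<le> upper_capacity_dim T \<theta> E"
    unfolding intermediate_dim_eq by (rule dense_ge)
  have "Inf {s. 0 \<le> s \<and> lower_admissible s (coding_map T a ` E)} \<le> s" if "lower_capacity_dim T \<theta> E < s" for s
    using that lower_capacity_dim_sign(1) lower_admissible_above[OF that, of a]
    by (intro cInf_lower bdd) simp
  then show "lower_intermediate_dim \<theta> (coding_map T a ` E) \<le> lower_capacity_dim T \<theta> E"
    unfolding intermediate_dim_eq by (rule dense_ge)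
qed

end

section \<open>The lower bound for almost all translations\<close>

lemma ennreal_triple_sum:
  assumes "\<And>x y u. x \<in> R \<Longrightarrow> y \<in> R \<Longrightarrow> 0 \<le> h x y u"
  shows "ennreal (\<Sum>x\<in>R. \<Sum>y\<in>R. \<Sum>u\<in>G. h x y u) = (\<Sum>x\<in>R. \<Sum>y\<in>R. \<Sum>u\<in>G. ennreal (h x y u))"
  using assms by (simp add: sum_ennreal sum_nonneg cong: sum.cong)

lemma dyadic_bracket:
  fixes r :: real assumes "0 < r" "r < 1"
  shows "\<exists>k. r \<le> (1 / 2) ^ k \<and> (1 / 2) ^ k \<le> 2 * r"
proof -
  have ex: "\<exists>n. (1 / 2) ^ n < r" using real_arch_pow_inv[OF assms(1), of "1 / 2"] by simp
  define n where "n = (LEAST n. (1 / 2) ^ n < r)"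
  have n: "(1 / 2) ^ n < r" unfolding n_def by (rule LeastI_ex[OF ex])
  then obtain k where k: "n = Suc k" using assms(2) by (cases n) auto
  have "\<not> (1 / 2) ^ k < r" using not_less_Least[of k "\<lambda>n. (1 / 2) ^ n < r"] k by (simp add: n_def)
  then show ?thesis using n k by (intro exI[of _ k]) simp
qed

context affine_ifs_coding
begin

text \<open>
  Scales that leave the window by a factor \<open>c\<close> at most are compared with the nearest scale \<open>v\<close> inside it.
\<close>
lemma term_outside_window:
  assumes r: "0 < r" "r < 1" and s: "0 \<le> s" and c: "1 \<le> c"
    and u: "r powr (1 / \<theta>) / c \<le> u" "u \<le> c * r"
  shows "u powr (- s) * Z_kernel T u x y \<le> c powr s * c ^ CARD('d) * J s r x y"
proof -
  define v where "v = min r (max (r powr (1 / \<theta>)) u)"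
  note win = window[OF r]
  have v: "v \<in> {r powr (1 / \<theta>)..r}" using win by (auto simp: v_def)
  have u0: "0 < u" using u(1) win(1) c by (meson divide_pos_pos less_le_trans zero_less_one)
  have v0: "0 < v" using window_pos[OF r(1) v] .
  define w where "w = r powr (1 / \<theta>)"
  have "w \<le> c * w" "u \<le> c * u" "r \<le> c * r" using c u0 win r by (simp_all add: w_def)
  moreover have "w \<le> c * u" using u(1) c by (simp add: w_def field_simps)
  moreover have "(u < w \<and> v = w) \<or> v = u \<or> (r < u \<and> v = r)"
    using win(2) by (auto simp: v_def w_def min_def max_def)
  ultimately have uv: "u \<le> c * v" "v \<le> c * u"
    using u(2) by auto
  have "u powr (- s) \<le> (v / c) powr (- s)"
    using uv(2) v0 c s u0 by (intro powr_mono2') (auto simp: field_simps)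
  also have "\<dots> = c powr s * v powr (- s)"
    using v0 c by (simp add: powr_divide powr_minus field_simps)
  finally have 1: "u powr (- s) \<le> c powr s * v powr (- s)" .
  have 2: "Z_kernel T u x y \<le> c ^ CARD('d) * Z_kernel T v x y"
    using Z_kernel_scale[OF u0 uv(1) c] .
  have "u powr (- s) * Z_kernel T u x y \<le> (c powr s * v powr (- s)) * (c ^ CARD('d) * Z_kernel T v x y)"
    using 1 2 Z_kernel_pos[OF u0, of x y] by (intro mult_mono) (auto simp: less_imp_le)
  also have "\<dots> = c powr s * c ^ CARD('d) * (v powr (- s) * Z_kernel T v x y)" by (simp add: mult_ac)
  also have "\<dots> \<le> c powr s * c ^ CARD('d) * J s r x y"
    using J_ge[OF r(1) s v] c by (intro mult_left_mono) auto
  finally show ?thesis .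
qed

text \<open>
  The dyadic multiples of \<open>r\<^bsup>1/\<theta>\<^esup> / c\<close>, as far as they are needed to approximate from above, up to a
  factor \<open>2\<close>, all diameters between \<open>r\<^bsup>1/\<theta>\<^esup> / c\<close> and \<open>c r\<close>. The slack \<open>c\<close> makes it possible to treat all
  \<open>r\<close> between two members of a geometric sequence at once.
\<close>
definition scales :: "real \<Rightarrow> real \<Rightarrow> real set" where
  "scales c r = {u. (\<exists>j::nat. u = r powr (1 / \<theta>) / c * 2 ^ j) \<and> u \<le> 2 * c * r}"

lemma scales_dyadic:
  assumes "0 < r" "1 \<le> c" "r powr (1 / \<theta>) / c \<le> t" "t \<le> c * r"
  shows "\<exists>u\<in>scales c r. t \<le> u \<and> u \<le> 2 * t"
proof -
  define b where "b = r powr (1 / \<theta>) / c"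
  have b: "0 < b" using assms(1,2) by (simp add: b_def)
  obtain n0 where "t / b < 2 ^ n0" using real_arch_pow[of 2 "t / b"] by auto
  then have ex: "\<exists>n. t \<le> b * 2 ^ n" using b by (intro exI[of _ n0]) (simp add: field_simps)
  define n where "n = (LEAST n. t \<le> b * 2 ^ n)"
  have n: "t \<le> b * 2 ^ n" unfolding n_def by (rule LeastI_ex[OF ex])
  have "b * 2 ^ n \<le> 2 * t"
  proof (cases n)
    case 0
    then show ?thesis using assms(3) b by (simp add: b_def[symmetric])
  next
    case (Suc k)
    then have "\<not> t \<le> b * 2 ^ k" using not_less_Least[of k "\<lambda>n. t \<le> b * 2 ^ n"] by (simp add: n_def)
    then show ?thesis using Suc by simp
  qed
  then show ?thesis
    using n assms(4) by (intro bexI[of _ "b * 2 ^ n"]) (auto simp: scales_def b_def)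
qed

lemma scales_bounds:
  assumes "0 < r" "1 \<le> c" "u \<in> scales c r"
  shows "r powr (1 / \<theta>) / c \<le> u" "u \<le> 2 * c * r" "0 < u"
proof -
  obtain j :: nat where j: "u = r powr (1 / \<theta>) / c * 2 ^ j" "u \<le> 2 * c * r"
    using assms(3) by (auto simp: scales_def)
  have b: "0 < r powr (1 / \<theta>) / c" using assms(1,2) by simp
  show "u \<le> 2 * c * r" by fact
  show "r powr (1 / \<theta>) / c \<le> u" unfolding j(1) using mult_left_mono[of 1 "2 ^ j" "r powr (1 / \<theta>) / c"] b by simp
  then show "0 < u" using b by linarith
qed

lemma card_scales:
  assumes c: "1 \<le> c" and \<delta>: "0 < \<delta>"
  shows "\<exists>B>0. \<forall>r. 0 < r \<longrightarrow> r < 1 \<longrightarrow> finite (scales c r) \<and> card (scales c r) \<le> B * r powr (- \<delta>)"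
proof -
  define L where "L = log 2 (2 * c\<^sup>2)"
  define B where "B = L + 1 / (\<theta> * ln 2 * \<delta>) + 1"
  have L: "0 \<le> L" using c by (simp add: L_def one_le_power order_trans[of 1 2])
  have B: "0 < B" using L theta_pos \<delta> by (simp add: B_def add_nonneg_pos)
  have "finite (scales c r) \<and> card (scales c r) \<le> B * r powr (- \<delta>)" if r: "0 < r" "r < 1" for r
  proof -
    define n where "n = nat \<lfloor>L - ln r / (\<theta> * ln 2)\<rfloor>"
    have "ln r / (\<theta> * ln 2) \<le> 0" using r theta_pos by (intro divide_nonpos_pos) auto
    then have pos: "0 \<le> L - ln r / (\<theta> * ln 2)" using L by linarith
    have "scales c r \<subseteq> (\<lambda>j. r powr (1 / \<theta>) / c * 2 ^ j) ` {..n}"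
    proof
      fix u assume "u \<in> scales c r"
      then obtain j :: nat where j: "u = r powr (1 / \<theta>) / c * 2 ^ j" "u \<le> 2 * c * r"
        by (auto simp: scales_def)
      have "2 ^ j = u * c / r powr (1 / \<theta>)" using j(1) r c by (simp add: field_simps)
      also have "\<dots> \<le> (2 * c * r) * c / r powr (1 / \<theta>)"
        using j(2) c by (intro divide_right_mono mult_right_mono) auto
      also have "\<dots> = 2 * c\<^sup>2 * r * r powr (- (1 / \<theta>))"
        by (simp add: powr_minus divide_inverse power2_eq_square)
      also have "\<dots> \<le> 2 * c\<^sup>2 * r powr (- (1 / \<theta>))"
        using r c by (intro mult_right_mono) auto
      finally have "log 2 (2 ^ j) \<le> log 2 (2 * c\<^sup>2 * r powr (- (1 / \<theta>)))"
        using c r by (subst log_le_cancel_iff) auto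
      also have "\<dots> = L + log 2 (r powr (- (1 / \<theta>)))"
        unfolding L_def using c r by (subst log_mult) auto
      also have "log 2 (r powr (- (1 / \<theta>))) = - ln r / (\<theta> * ln 2)"
        using r by (simp add: log_def ln_powr)
      finally have "real j \<le> L - ln r / (\<theta> * ln 2)" by (simp add: log_nat_power)
      then have "j \<le> n" unfolding n_def by linarith
      then show "u \<in> (\<lambda>j. r powr (1 / \<theta>) / c * 2 ^ j) ` {..n}" using j(1) by blast
    qed
    then have "finite (scales c r)" "card (scales c r) \<le> n + 1"
      using surj_card_le[of "{..n}" "scales c r"] finite_surj[of "{..n}" "scales c r"] by auto
    moreover have "real n + 1 \<le> B * r powr (- \<delta>)"
    proof -
      have "real n \<le> L + (- ln r / (\<theta> * ln 2))" using pos unfolding n_def by linarith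
      also have "- ln r / (\<theta> * ln 2) \<le> (r powr (- \<delta>) / \<delta>) / (\<theta> * ln 2)"
        using neg_ln_le_powr[OF r \<delta>] theta_pos by (intro divide_right_mono) auto
      finally have 1: "real n \<le> L + (1 / (\<theta> * ln 2 * \<delta>)) * r powr (- \<delta>)" by (simp add: mult_ac)
      have 2: "1 \<le> r powr (- \<delta>)" using r \<delta> by (simp add: powr_minus one_le_inverse_iff powr_le1)
      then have "L \<le> L * r powr (- \<delta>)" using L by (simp add: mult_le_cancel_left1)
      then show ?thesis using 1 2 by (simp add: B_def algebra_simps)
    qed
    ultimately show ?thesis by linarith
  qed
  then show ?thesis using B by blast
qed

text \<open>
  The sum over scales replaces the maximum in the kernel \<open>J\<close>, because transversality controls the
  integral over \<open>a\<close> for a single scale only. The price is the number of scales, which is logarithmic.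
\<close>
definition pair_potential ::
  "real \<Rightarrow> real \<Rightarrow> real \<Rightarrow> (nat \<Rightarrow> 'm) set \<Rightarrow> ((nat \<Rightarrow> 'm) \<Rightarrow> real) \<Rightarrow> real^'d^'m \<Rightarrow> real" where
  "pair_potential s c r R p a = (\<Sum>x\<in>R. \<Sum>y\<in>R. \<Sum>u\<in>scales c r.
     p x * p y * (u powr (- s) * indicator {a. dist (coding_map T a x) (coding_map T a y) \<le> u} a))"

text \<open>
  Assign each weighted point to a set of the cover that contains its image, and let \<open>m(U)\<close> be the mass
  assigned to \<open>U\<close>. By the Cauchy-Schwarz inequality
  \<open>1 = (\<Sum> m(U))\<^sup>2 \<le> (\<Sum> |U|\<^sup>s) (\<Sum> |U|\<^bsup>-s\<^esup> m(U)\<^sup>2)\<close>, and the last sum runs over pairs of points assigned to the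
  same set, hence at distance at most \<open>|U|\<close>. It is thus bounded by the potential.
\<close>
lemma cover_sum_lower_bound:
  assumes Rp: "(R, p) \<in> weights" and s: "0 \<le> s" and r: "0 < r" and c: "1 \<le> c" and fin: "finite (scales c r)"
    and cover: "coding_map T a ` E \<subseteq> \<Union>\<U>"
    and \<U>: "\<And>U. U \<in> \<U> \<Longrightarrow> bounded U \<and> r powr (1 / \<theta>) / c \<le> diameter U \<and> diameter U \<le> c * r"
    and v: "0 \<le> v" "cover_sum s \<U> \<le> ennreal v"
  shows "1 \<le> v * (2 powr s * pair_potential s c r R p a)"
proof -
  have R: "finite R" "R \<subseteq> E" "\<And>x. x \<in> R \<Longrightarrow> 0 \<le> p x" "sum p R = 1" using Rp by (auto simp: weights_def)
  have "\<forall>x\<in>R. \<exists>U. U \<in> \<U> \<and> coding_map T a x \<in> U" using cover R(2) by blast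
  then obtain V where "\<forall>x\<in>R. V x \<in> \<U> \<and> coding_map T a x \<in> V x"
    by (rule bchoice[THEN exE])
  then have V: "V x \<in> \<U> \<and> coding_map T a x \<in> V x" if "x \<in> R" for x using that by blast
  define k where "k x y = (\<Sum>u\<in>scales c r. u powr (- s) * indicator {a. dist (coding_map T a x) (coding_map T a y) \<le> u} a)" for x y
  have k0: "0 \<le> k x y" for x y
    unfolding k_def by (intro sum_nonneg mult_nonneg_nonneg) auto
  have dpos: "0 < diameter U" if "U \<in> \<U>" for U
  proof -
    have "0 < r powr (1 / \<theta>) / c" using r c by simp
    then show ?thesis using \<U>[OF that] by linarith
  qed
  have k_ge: "diameter (V x) powr (- s) \<le> 2 powr s * k x y" if xy: "x \<in> R" "y \<in> R" "V x = V y" for x y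
  proof -
    define t where "t = diameter (V x)"
    have t: "0 < t" "bounded (V x)" "r powr (1 / \<theta>) / c \<le> t" "t \<le> c * r"
      using \<U>[of "V x"] dpos[of "V x"] V[OF xy(1)] by (auto simp: t_def)
    obtain u where u: "u \<in> scales c r" "t \<le> u" "u \<le> 2 * t"
      using scales_dyadic[OF r c t(3,4)] by blast
    have "dist (coding_map T a x) (coding_map T a y) \<le> t"
      unfolding t_def using V[OF xy(1)] V[OF xy(2)] xy(3) t(2) by (intro diameter_bounded_bound) auto
    then have "u powr (- s) = u powr (- s) * indicator {a. dist (coding_map T a x) (coding_map T a y) \<le> u} a"
      using u(2) by simp
    also have "\<dots> \<le> k x y"
      unfolding k_def using fin u(1) by (intro member_le_sum) auto
    finally have "u powr (- s) \<le> k x y" .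
    moreover have "t powr (- s) \<le> (u / 2) powr (- s)"
      using u t s by (intro powr_mono2') auto
    moreover have "(u / 2) powr (- s) = 2 powr s * u powr (- s)"
      using u t by (simp add: powr_divide powr_minus field_simps)
    ultimately show ?thesis unfolding t_def by (smt (verit) mult_left_mono powr_ge_zero)
  qed
  define W where "W = V ` R"
  have W: "finite W" "W \<subseteq> \<U>" using R(1) V by (auto simp: W_def)
  define m where "m U = sum p {x \<in> R. V x = U}" for U
  have m1: "sum m W = 1"
    unfolding m_def W_def using sum.image_gen[OF R(1), of p V] R(4) by simp
  define D where "D = (\<Sum>U\<in>W. diameter U powr s)"
  have "ennreal D \<le> ennreal v"
    unfolding D_def using finite_sum_le_cover_sum[OF W, of s] v(2) by (rule order_trans)
  then have Dv: "D \<le> v" using v(1) by (simp add: ennreal_le_iff)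
  have "1 = (\<Sum>U\<in>W. diameter U powr (s / 2) * (m U * diameter U powr (- s / 2)))\<^sup>2"
  proof -
    have "(\<Sum>U\<in>W. diameter U powr (s / 2) * (m U * diameter U powr (- s / 2))) = sum m W"
    proof (rule sum.cong[OF refl])
      fix U assume "U \<in> W"
      then have "0 < diameter U" using dpos W by blast
      then have "diameter U powr (s / 2) * diameter U powr (- s / 2) = 1"
        by (simp flip: powr_add)
      then show "diameter U powr (s / 2) * (m U * diameter U powr (- s / 2)) = m U"
        by (simp add: mult.left_commute)
    qed
    then show ?thesis by (simp add: m1)
  qed
  also have "\<dots> \<le> (\<Sum>U\<in>W. (diameter U powr (s / 2))\<^sup>2) * (\<Sum>U\<in>W. (m U * diameter U powr (- s / 2))\<^sup>2)"
    by (rule Cauchy_Schwarz_ineq_sum)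
  also have "(\<Sum>U\<in>W. (diameter U powr (s / 2))\<^sup>2) = D"
    unfolding D_def by (intro sum.cong refl) (simp add: power2_eq_square flip: powr_add)
  also have "(\<Sum>U\<in>W. (m U * diameter U powr (- s / 2))\<^sup>2) \<le> 2 powr s * pair_potential s c r R p a"
  proof -
    have "(m U * diameter U powr (- s / 2))\<^sup>2 \<le> (\<Sum>x\<in>{x\<in>R. V x = U}. \<Sum>y\<in>R. p x * p y * (2 powr s * k x y))" if "U \<in> W" for U
    proof -
      have "(m U * diameter U powr (- s / 2))\<^sup>2 = m U * m U * diameter U powr (- s)"
        by (simp add: power2_eq_square mult_ac flip: powr_add)
      also have "\<dots> = (\<Sum>x\<in>{x\<in>R. V x = U}. \<Sum>y\<in>{y\<in>R. V y = U}. p x * p y * diameter U powr (- s))"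
        unfolding m_def sum_product by (simp add: sum_distrib_right)
      also have "\<dots> \<le> (\<Sum>x\<in>{x\<in>R. V x = U}. \<Sum>y\<in>{y\<in>R. V y = U}. p x * p y * (2 powr s * k x y))"
      proof (intro sum_mono mult_left_mono)
        fix x y assume "x \<in> {x\<in>R. V x = U}" "y \<in> {y\<in>R. V y = U}"
        then show "diameter U powr (- s) \<le> 2 powr s * k x y" "0 \<le> p x * p y"
          using k_ge[of x y] R(3) by auto
      qed
      also have "\<dots> \<le> (\<Sum>x\<in>{x\<in>R. V x = U}. \<Sum>y\<in>R. p x * p y * (2 powr s * k x y))"
        using R(1,3) k0 by (intro sum_mono sum_mono2) auto
      finally show ?thesis .
    qed
    then have "(\<Sum>U\<in>W. (m U * diameter U powr (- s / 2))\<^sup>2) \<le>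
        (\<Sum>U\<in>W. \<Sum>x\<in>{x\<in>R. V x = U}. \<Sum>y\<in>R. p x * p y * (2 powr s * k x y))"
      by (rule sum_mono)
    also have "\<dots> = (\<Sum>x\<in>R. \<Sum>y\<in>R. p x * p y * (2 powr s * k x y))"
      unfolding W_def by (rule sum.image_gen[OF R(1), symmetric])
    also have "\<dots> = 2 powr s * pair_potential s c r R p a"
      unfolding pair_potential_def k_def by (simp add: sum_distrib_left mult_ac)
    finally show ?thesis .
  qed
  finally have "1 \<le> D * (2 powr s * pair_potential s c r R p a)"
    by (simp add: D_def mult_left_mono sum_nonneg)
  also have "\<dots> \<le> v * (2 powr s * pair_potential s c r R p a)"
  proof -
    have "pair_potential s c r R p a = (\<Sum>x\<in>R. \<Sum>y\<in>R. p x * p y * k x y)"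
      unfolding pair_potential_def k_def by (simp add: sum_distrib_left)
    then have "0 \<le> pair_potential s c r R p a" using k0 R(3) by (simp add: sum_nonneg)
    then show ?thesis using Dv by (intro mult_right_mono) auto
  qed
  finally show ?thesis .
qed

lemma pair_potential_measurable: "pair_potential s c r R p \<in> borel_measurable borel"
  unfolding pair_potential_def[abs_def]
  by (intro borel_measurable_sum borel_measurable_times borel_measurable_const borel_measurable_indicator close_pair_sets)

lemma pair_potential_nonneg: "(R, p) \<in> weights \<Longrightarrow> 0 \<le> pair_potential s c r R p a"
  unfolding pair_potential_def by (intro sum_nonneg mult_nonneg_nonneg) (auto simp: weights_def)

text \<open>
  Integrate term by term: transversality turns \<open>u\<^bsup>-s\<^esup>\<close> times the measure of a set of close pairs into
  \<open>u\<^bsup>-s\<^esup> Z\<^sub>u\<close>, which is a term of \<open>J\<close> up to the widening of the window.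
\<close>
lemma mean_pair_potential:
  assumes half: "\<tau> < 1 / 2" and \<rho>: "0 < \<rho>" and c: "1 \<le> c" and s: "0 \<le> s"
  shows "\<exists>C>0. \<forall>r R p. 0 < r \<longrightarrow> r < 1 \<longrightarrow> (R, p) \<in> weights \<longrightarrow> finite (scales c r) \<longrightarrow>
    (\<integral>\<^sup>+ a \<in> cball 0 \<rho>. ennreal (pair_potential s c r R p a) \<partial>lborel)
      \<le> ennreal (C * real (card (scales c r)) * discrete_energy s r R p)"
proof -
  obtain C where C: "0 < C" "\<And>x y u. 0 < u \<Longrightarrow>
    emeasure lborel {a :: real^'d^'m. norm a \<le> \<rho> \<and> dist (coding_map T a x) (coding_map T a y) \<le> u}
      \<le> ennreal (C * Z_kernel T u x y)"
    using transversality[OF half \<rho>] by auto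
  define C' where "C' = C * ((2 * c) powr s * (2 * c) ^ CARD('d))"
  have "(\<integral>\<^sup>+ a \<in> cball 0 \<rho>. ennreal (pair_potential s c r R p a) \<partial>lborel)
      \<le> ennreal (C' * card (scales c r) * discrete_energy s r R p)"
    if r: "0 < r" "r < 1" and Rp: "(R, p) \<in> weights" and fin: "finite (scales c r)" for r R p
  proof -
    have R: "finite R" "\<And>x. x \<in> R \<Longrightarrow> 0 \<le> p x" using Rp by (auto simp: weights_def)
    define S where "S x y u = {a :: real^'d^'m. dist (coding_map T a x) (coding_map T a y) \<le> u}" for x y u
    have S: "S x y u \<in> sets borel" for x y u unfolding S_def by (rule close_pair_sets)
    have "(\<integral>\<^sup>+ a \<in> cball 0 \<rho>. ennreal (pair_potential s c r R p a) \<partial>lborel)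
        = (\<integral>\<^sup>+ a. (\<Sum>x\<in>R. \<Sum>y\<in>R. \<Sum>u\<in>scales c r.
            ennreal (p x * p y * u powr (- s)) * indicator (cball 0 \<rho> \<inter> S x y u) a) \<partial>lborel)"
    proof (rule nn_integral_cong)
      fix a :: "real^'d^'m"
      have "ennreal (pair_potential s c r R p a) = (\<Sum>x\<in>R. \<Sum>y\<in>R. \<Sum>u\<in>scales c r.
          ennreal (p x * p y * (u powr (- s) * indicator (S x y u) a)))"
        unfolding pair_potential_def S_def using R by (intro ennreal_triple_sum) simp
      then show "ennreal (pair_potential s c r R p a) * indicator (cball 0 \<rho>) a = (\<Sum>x\<in>R. \<Sum>y\<in>R. \<Sum>u\<in>scales c r.
            ennreal (p x * p y * u powr (- s)) * indicator (cball 0 \<rho> \<inter> S x y u) a)"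
        by (auto simp: sum_distrib_right indicator_def intro!: sum.cong)
    qed
    also have "\<dots> = (\<Sum>x\<in>R. \<Sum>y\<in>R. \<Sum>u\<in>scales c r.
        ennreal (p x * p y * u powr (- s)) * emeasure lborel (cball 0 \<rho> \<inter> S x y u))"
    proof -
      have ms: "cball 0 \<rho> \<inter> S x y u \<in> sets lborel" for x y u using S by simp
      then have m: "(\<lambda>a. k * indicator (cball 0 \<rho> \<inter> S x y u) a) \<in> borel_measurable lborel" for k :: ennreal and x y u
        by (intro borel_measurable_times_ennreal borel_measurable_const borel_measurable_indicator)
      show ?thesis
        by (simp only: nn_integral_sum m borel_measurable_sum nn_integral_cmult_indicator ms)
    qed
    also have "\<dots> \<le> (\<Sum>x\<in>R. \<Sum>y\<in>R. \<Sum>u\<in>scales c r. ennreal (C' * (p x * p y * J s r x y)))"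
    proof (intro sum_mono)
      fix x y u assume xy: "x \<in> R" "y \<in> R" and u: "u \<in> scales c r"
      note ub = scales_bounds[OF r(1) c u]
      have "cball 0 \<rho> \<inter> S x y u = {a :: real^'d^'m. norm a \<le> \<rho> \<and> dist (coding_map T a x) (coding_map T a y) \<le> u}"
        by (auto simp: S_def)
      then have "ennreal (p x * p y * u powr (- s)) * emeasure lborel (cball 0 \<rho> \<inter> S x y u)
          \<le> ennreal (p x * p y * u powr (- s)) * ennreal (C * Z_kernel T u x y)"
        using C(2)[OF ub(3), of x y] by (intro mult_left_mono) auto
      also have "\<dots> = ennreal (p x * p y * u powr (- s) * (C * Z_kernel T u x y))"
        using R(2) xy by (intro ennreal_mult'[symmetric]) auto
      also have "\<dots> \<le> ennreal (C' * (p x * p y * J s r x y))"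
      proof (rule ennreal_leI)
        have "r powr (1 / \<theta>) / (2 * c) \<le> u"
        proof (rule order_trans[OF _ ub(1)])
          show "r powr (1 / \<theta>) / (2 * c) \<le> r powr (1 / \<theta>) / c" using c by (intro divide_left_mono) auto
        qed
        then have "u powr (- s) * Z_kernel T u x y \<le> (2 * c) powr s * (2 * c) ^ CARD('d) * J s r x y"
          using ub(2) c by (intro term_outside_window[OF r s]) auto
        then have "C * (p x * p y) * (u powr (- s) * Z_kernel T u x y)
            \<le> C * (p x * p y) * ((2 * c) powr s * (2 * c) ^ CARD('d) * J s r x y)"
          using C(1) R(2) xy by (intro mult_left_mono) auto
        then show "p x * p y * u powr (- s) * (C * Z_kernel T u x y) \<le> C' * (p x * p y * J s r x y)"
          by (simp add: C'_def mult_ac)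
      qed
      finally show "ennreal (p x * p y * u powr (- s)) * emeasure lborel (cball 0 \<rho> \<inter> S x y u)
          \<le> ennreal (C' * (p x * p y * J s r x y))" .
    qed
    also have "\<dots> = ennreal (\<Sum>x\<in>R. \<Sum>y\<in>R. \<Sum>u\<in>scales c r. C' * (p x * p y * J s r x y))"
      using R C(1) c J_pos[OF r s]
      by (intro ennreal_triple_sum[symmetric]) (simp add: C'_def less_imp_le)
    also have "(\<Sum>x\<in>R. \<Sum>y\<in>R. \<Sum>u\<in>scales c r. C' * (p x * p y * J s r x y)) = C' * card (scales c r) * discrete_energy s r R p"
      by (simp add: discrete_energy_def sum_distrib_left mult_ac)
    finally show ?thesis .
  qed
  then have "\<forall>r R p. 0 < r \<longrightarrow> r < 1 \<longrightarrow> (R, p) \<in> weights \<longrightarrow> finite (scales c r) \<longrightarrow>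
    (\<integral>\<^sup>+ a \<in> cball 0 \<rho>. ennreal (pair_potential s c r R p a) \<partial>lborel)
      \<le> ennreal (C' * card (scales c r) * discrete_energy s r R p)"
    by (intro allI impI)
  moreover have "0 < C'" using C(1) c by (simp add: C'_def)
  ultimately show ?thesis by (intro exI[of _ C'] conjI)
qed

lemma near_minimal_weights:
  assumes "min_energy s r < e"
  shows "\<exists>(R, p)\<in>weights. discrete_energy s r R p < e"
proof (rule ccontr)
  assume "\<not> ?thesis"
  then have "e \<le> min_energy s r"
    unfolding min_energy_def using weights_nonempty by (intro cINF_greatest) (auto simp: not_less)
  then show False using assms by simp
qed

text \<open>
  For \<open>c = 1\<close> the covers considered include those admissible for \<open>r\<close>. The bound \<open>1/2\<close> could be any number less than
  \<open>1\<close>, the total mass of the weights.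
\<close>
definition no_cheap_cover :: "real \<Rightarrow> real \<Rightarrow> real \<Rightarrow> real^'d^'m \<Rightarrow> bool" where
  "no_cheap_cover s c r a \<longleftrightarrow> (\<forall>\<U>. coding_map T a ` E \<subseteq> \<Union>\<U> \<longrightarrow>
     (\<forall>U\<in>\<U>. bounded U \<and> r powr (1 / \<theta>) / c \<le> diameter U \<and> diameter U \<le> c * r) \<longrightarrow>
     \<not> cover_sum s \<U> \<le> ennreal (1 / 2))"

text \<open>
  The mean of the \<open>k\<close>-th potential over the ball is at most a constant times \<open>r\<^sub>k\<^bsup>\<delta>/2\<^esup>\<close>, which is summable.
  So the sum of the potentials is integrable, and they tend to zero almost everywhere.
\<close>
lemma AE_no_cheap_covers_in_ball:
  assumes half: "\<tau> < 1 / 2" and s: "0 \<le> s" and \<delta>: "0 < \<delta>" and c: "1 \<le> c" and \<rho>: "0 < \<rho>"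
    and r: "\<And>k::nat. 0 < r k" "\<And>k. r k < 1" "\<And>k. r k \<le> (1 / 2) ^ k"
    and en: "\<And>k. min_energy s (r k) < r k powr \<delta>"
  shows "AE a :: real^'d^'m in lborel. a \<in> cball 0 \<rho> \<longrightarrow>
    eventually (\<lambda>k. no_cheap_cover s c (r k) a) sequentially"
proof -
  obtain C where C: "0 < C" "\<And>r R p. 0 < r \<Longrightarrow> r < 1 \<Longrightarrow> (R, p) \<in> weights \<Longrightarrow> finite (scales c r) \<Longrightarrow>
    (\<integral>\<^sup>+ a \<in> cball 0 \<rho>. ennreal (pair_potential s c r R p a) \<partial>lborel)
      \<le> ennreal (C * real (card (scales c r)) * discrete_energy s r R p)"
    using mean_pair_potential[OF half \<rho> c s] by auto
  obtain B where B: "0 < B" "\<And>r. 0 < r \<Longrightarrow> r < 1 \<Longrightarrow> finite (scales c r) \<and> card (scales c r) \<le> B * r powr (- (\<delta> / 2))"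
    using card_scales[OF c, of "\<delta> / 2"] \<delta> by auto
  have "\<forall>k. \<exists>Rp. Rp \<in> weights \<and> discrete_energy s (r k) (fst Rp) (snd Rp) < r k powr \<delta>"
    using near_minimal_weights[OF en] by fastforce
  then obtain Rp where Rp: "\<forall>k. Rp k \<in> weights \<and> discrete_energy s (r k) (fst (Rp k)) (snd (Rp k)) < r k powr \<delta>"
    by (rule choice[THEN exE])
  define R where "R k = fst (Rp k)" for k
  define p where "p k = snd (Rp k)" for k
  have W: "(R k, p k) \<in> weights" and E: "discrete_energy s (r k) (R k) (p k) < r k powr \<delta>" for k
    using Rp by (simp_all add: R_def p_def)
  define \<Phi> where "\<Phi> k a = pair_potential s c (r k) (R k) (p k) a * indicator (cball 0 \<rho>) a" for k a
  have \<Phi>0: "0 \<le> \<Phi> k a" for k a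
    unfolding \<Phi>_def using pair_potential_nonneg[OF W] by simp
  have \<Phi>m: "\<Phi> k \<in> borel_measurable borel" for k
    unfolding \<Phi>_def[abs_def] by (intro borel_measurable_times pair_potential_measurable borel_measurable_indicator) simp
  \<comment> \<open>energy \<open>r\<^sup>\<delta>\<close> times \<open>O(r\<^bsup>-\<delta>/2\<^esup>)\<close> scales, with \<open>r \<le> 2\<^bsup>-k\<^esup>\<close>\<close>
  define q where "q = (1 / 2 :: real) powr (\<delta> / 2)"
  have "q < (1 / 2) powr 0" unfolding q_def using \<delta> by (intro powr_less_mono') auto
  then have q: "0 < q" "q < 1" by (simp_all add: q_def)
  have mean: "(\<integral>\<^sup>+ a. ennreal (\<Phi> k a) \<partial>lborel) \<le> ennreal (C * B * q ^ k)" for k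
  proof -
    have "(\<integral>\<^sup>+ a. ennreal (\<Phi> k a) \<partial>lborel) = (\<integral>\<^sup>+ a \<in> cball 0 \<rho>. ennreal (pair_potential s c (r k) (R k) (p k) a) \<partial>lborel)"
      unfolding \<Phi>_def by (intro nn_integral_cong) (auto simp: indicator_def)
    also have "\<dots> \<le> ennreal (C * real (card (scales c (r k))) * discrete_energy s (r k) (R k) (p k))"
      using B(2)[OF r(1,2)] by (intro C(2) r W) auto
    also have "\<dots> \<le> ennreal (C * B * q ^ k)"
    proof (rule ennreal_leI)
      have "C * real (card (scales c (r k))) * discrete_energy s (r k) (R k) (p k)
          \<le> C * (B * r k powr (- (\<delta> / 2))) * r k powr \<delta>"
        using B(2)[OF r(1,2), of k] E[of k] C(1) B(1) discrete_energy_nonneg[OF r(1,2) s W]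
        by (intro mult_mono) (auto simp: less_imp_le)
      also have "\<dots> = C * B * r k powr (\<delta> / 2)"
      proof -
        have "r k powr (- (\<delta> / 2)) * r k powr \<delta> = r k powr (\<delta> / 2)"
          by (simp flip: powr_add)
        then show ?thesis by (simp add: mult.assoc)
      qed
      also have "r k powr (\<delta> / 2) \<le> ((1 / 2) ^ k) powr (\<delta> / 2)"
        using r(1)[of k] r(3)[of k] \<delta> by (intro powr_mono2) auto
      also have "((1 / 2 :: real) ^ k) powr (\<delta> / 2) = q ^ k"
        by (simp add: q_def powr_power powr_powr mult.commute flip: powr_realpow)
      finally show "C * real (card (scales c (r k))) * discrete_energy s (r k) (R k) (p k) \<le> C * B * q ^ k"
        using C(1) B(1) by (simp add: mult_left_mono)
    qed
    finally show ?thesis .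
  qed
  have "(\<integral>\<^sup>+ a. (\<Sum>k. ennreal (\<Phi> k a)) \<partial>lborel) = (\<Sum>k. \<integral>\<^sup>+ a. ennreal (\<Phi> k a) \<partial>lborel)"
    using \<Phi>m by (intro nn_integral_suminf) simp
  also have "\<dots> \<le> (\<Sum>k. ennreal (C * B * q ^ k))"
    using mean by (intro suminf_le summableI) auto
  also have "\<dots> = ennreal (\<Sum>k. C * B * q ^ k)"
    using q C(1) B(1) by (intro suminf_ennreal2 summable_mult summable_geometric) auto
  finally have "(\<integral>\<^sup>+ a. (\<Sum>k. ennreal (\<Phi> k a)) \<partial>lborel) < \<infinity>"
    by (rule le_less_trans) (simp add: infinity_ennreal_def)
  then have "(\<integral>\<^sup>+ a. (\<Sum>k. ennreal (\<Phi> k a)) \<partial>lborel) \<noteq> \<infinity>" by (rule less_imp_neq)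
  then have "AE a in lborel. (\<Sum>k. ennreal (\<Phi> k a)) \<noteq> \<infinity>"
    using \<Phi>m by (intro nn_integral_PInf_AE borel_measurable_suminf) auto
  then show ?thesis
  proof eventually_elim
    case (elim a)
    show ?case
    proof
      assume a: "a \<in> cball 0 \<rho>"
      have "summable (\<lambda>k. \<Phi> k a)" using elim \<Phi>0 by (intro summable_suminf_not_top) auto
      then have "(\<lambda>k. \<Phi> k a) \<longlonglongrightarrow> 0" by (rule summable_LIMSEQ_zero)
      then have "eventually (\<lambda>k. \<Phi> k a < 1 / (2 powr s)) sequentially"
        by (rule order_tendstoD(2)) simp
      then show "eventually (\<lambda>k. no_cheap_cover s c (r k) a) sequentially"
      proof eventually_elim
        case (elim k)
        show ?case
          unfolding no_cheap_cover_def
        proof (intro allI impI notI)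
          fix \<U> assume \<U>: "coding_map T a ` E \<subseteq> \<Union>\<U>"
            "\<forall>U\<in>\<U>. bounded U \<and> r k powr (1 / \<theta>) / c \<le> diameter U \<and> diameter U \<le> c * r k"
            "cover_sum s \<U> \<le> ennreal (1 / 2)"
          have "1 \<le> 1 / 2 * (2 powr s * pair_potential s c (r k) (R k) (p k) a)"
            by (rule cover_sum_lower_bound[OF W s r(1) c _ \<U>(1) _ _ \<U>(3)]) (use \<U>(2) B(2)[OF r(1,2)] in auto)
          moreover have "pair_potential s c (r k) (R k) (p k) a < 1 / 2 powr s"
            using elim a by (simp add: \<Phi>_def)
          then have "2 powr s * pair_potential s c (r k) (R k) (p k) a < 1"
            by (simp add: field_simps)
          ultimately show False by simp
        qed
      qed
    qed
  qed
qed

lemma AE_no_cheap_covers: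
  assumes half: "\<tau> < 1 / 2" and s: "0 \<le> s" and \<delta>: "0 < \<delta>" and c: "1 \<le> c"
    and r: "\<And>k::nat. 0 < r k" "\<And>k. r k < 1" "\<And>k. r k \<le> (1 / 2) ^ k"
    and en: "\<And>k. min_energy s (r k) < r k powr \<delta>"
  shows "AE a :: real^'d^'m in lborel.
    eventually (\<lambda>k. no_cheap_cover s c (r k) a) sequentially"
proof -
  have "AE a :: real^'d^'m in lborel. \<forall>n::nat. a \<in> cball 0 (real (Suc n)) \<longrightarrow>
    eventually (\<lambda>k. no_cheap_cover s c (r k) a) sequentially"
    unfolding AE_all_countable by (intro allI AE_no_cheap_covers_in_ball[OF half s \<delta> c _ r en]) simp
  then show ?thesis
  proof eventually_elim
    case (elim a)
    obtain n where "norm a \<le> real n" using real_arch_simple by blast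
    then have "a \<in> cball 0 (real (Suc n))" by simp
    then show ?case using elim by blast
  qed
qed

lemma admissible_cover_sum_le:
  assumes "admissible_cover \<theta> r F \<U>" "0 < r" "r < 1" "s' \<le> s" "cover_sum s' \<U> \<le> e"
  shows "cover_sum s \<U> \<le> e"
proof -
  have "0 < diameter U \<and> diameter U \<le> 1" if "U \<in> \<U>" for U
  proof -
    have "r powr (1 / \<theta>) \<le> diameter U" "diameter U \<le> r"
      using assms(1) that by (auto simp: admissible_cover_def)
    then show ?thesis using window(1)[OF assms(2,3)] assms(3) by linarith
  qed
  then show ?thesis using cover_sum_mono_exponent[OF _ assms(4)] assms(5) by (meson order_trans)
qed

text \<open>
  The energy is small along some sequence of \<open>r\<close>; it can be thinned out until it decreases
  geometrically, since one bad \<open>r\<close> below every bound suffices to exclude an exponent.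
\<close>
lemma AE_upper_dim_ge:
  assumes half: "\<tau> < 1 / 2" and s: "s < upper_capacity_dim T \<theta> E"
  shows "AE a :: real^'d^'m in lborel. s \<le> upper_intermediate_dim \<theta> (coding_map T a ` E)"
proof (cases "0 \<le> s")
  case False
  then show ?thesis using intermediate_dim_nonneg(1) by (intro AE_I2) (meson le_cases order_trans)
next
  case True
  obtain \<delta> where \<delta>: "0 < \<delta>" "frequently (\<lambda>r. min_energy s r < r powr \<delta>) (at_right 0)"
    using below_upper_capacity_dim[OF True s] by blast
  have "\<exists>r. 0 < r \<and> r < 1 \<and> r \<le> (1 / 2) ^ k \<and> min_energy s r < r powr \<delta>" for k :: nat
  proof -
    have "eventually (\<lambda>r::real. r \<in> {0<..<(1 / 2) ^ k}) (at_right 0)"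
      by (intro eventually_at_right_real) simp
    from frequently_ex[OF frequently_eventually_conj[OF \<delta>(2) eventually_conj[OF this eventually_unit_interval]]]
    show ?thesis by auto
  qed
  then obtain r :: "nat \<Rightarrow> real" where r: "\<And>k. 0 < r k \<and> r k < 1 \<and> r k \<le> (1 / 2) ^ k \<and> min_energy s (r k) < r k powr \<delta>"
    by metis
  have "AE a :: real^'d^'m in lborel.
    eventually (\<lambda>k. no_cheap_cover s 1 (r k) a) sequentially"
    using r by (intro AE_no_cheap_covers[OF half True \<delta>(1)]) auto
  then show ?thesis
  proof eventually_elim
    case (elim a)
    show ?case
    proof (rule intermediate_dim_greatest(1), rule ccontr)
      fix s' assume s': "0 \<le> s'" "upper_admissible s' (coding_map T a ` E)" "\<not> s \<le> s'"
      obtain r0 where r0: "r0 \<in> {0<..1}" "\<forall>r\<in>{0<..<r0}. \<exists>\<U>.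
          admissible_cover \<theta> r (coding_map T a ` E) \<U> \<and> cover_sum s' \<U> \<le> ennreal (1 / 2)"
        using s'(2)[unfolded upper_admissible_def, rule_format, of "1 / 2"] by auto
      have "(\<lambda>k. (1 / 2 :: real) ^ k) \<longlonglongrightarrow> 0" by (rule LIMSEQ_power_zero) simp
      then have "eventually (\<lambda>k. (1 / 2 :: real) ^ k < r0) sequentially"
        using r0(1) by (intro order_tendstoD(2)) auto
      from eventually_happens'[OF sequentially_bot eventually_conj[OF elim this]]
      obtain k where k: "(1 / 2 :: real) ^ k < r0"
        "no_cheap_cover s 1 (r k) a" by blast
      have rk: "0 < r k" "r k < 1" "r k \<in> {0<..<r0}" using r[of k] k(1) by auto
      obtain \<U> where \<U>: "admissible_cover \<theta> (r k) (coding_map T a ` E) \<U>" "cover_sum s' \<U> \<le> ennreal (1 / 2)"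
        using r0(2) rk(3) by blast
      have "cover_sum s \<U> \<le> ennreal (1 / 2)"
        using admissible_cover_sum_le[OF \<U>(1) rk(1,2) _ \<U>(2)] s'(3) by simp
      then show False using k(2) \<U>(1) by (auto simp: admissible_cover_def no_cheap_cover_def)
    qed
  qed
qed

text \<open>
  Here all small \<open>r\<close> have to be excluded. The energy is small for all of them, so powers of \<open>1/2\<close> can be
  used, and a cover admissible for \<open>t\<close> has diameters within a factor \<open>2\<^bsup>1/\<theta>\<^esup>\<close> of the window of the next
  power of \<open>1/2\<close> above \<open>t\<close>.
\<close>
lemma AE_lower_dim_ge:
  assumes half: "\<tau> < 1 / 2" and s: "s < lower_capacity_dim T \<theta> E"
  shows "AE a :: real^'d^'m in lborel. s \<le> lower_intermediate_dim \<theta> (coding_map T a ` E)"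
proof (cases "0 \<le> s")
  case False
  then show ?thesis using intermediate_dim_nonneg(2) by (intro AE_I2) (meson le_cases order_trans)
next
  case True
  obtain \<delta> where \<delta>: "0 < \<delta>" "eventually (\<lambda>r. min_energy s r < r powr \<delta>) (at_right 0)"
    using below_lower_capacity_dim[OF True s] by blast
  then obtain b where b: "0 < b" "\<And>r. 0 < r \<Longrightarrow> r < b \<Longrightarrow> min_energy s r < r powr \<delta>"
    unfolding eventually_at_right_field by blast
  obtain K :: nat where K: "(1 / 2) ^ K < min b 1"
    using real_arch_pow_inv[of "min b 1" "1 / 2"] b(1) by auto
  define r where "r k = (1 / 2 :: real) ^ (k + K)" for k
  have r: "0 < r k" "r k < 1" "r k \<le> (1 / 2) ^ k" "r k < b" for k
  proof -
    show "0 < r k" by (simp add: r_def)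
    have "r k \<le> (1 / 2) ^ K" unfolding r_def by (intro power_decreasing) auto
    then show "r k < 1" "r k < b" using K by auto
    show "r k \<le> (1 / 2) ^ k" unfolding r_def by (intro power_decreasing) auto
  qed
  \<comment> \<open>\<open>t \<le> r k \<le> 2 t\<close> gives \<open>(r k)\<^bsup>1/\<theta>\<^esup> / c \<le> t\<^bsup>1/\<theta>\<^esup>\<close>\<close>
  define c where "c = (2 :: real) powr (1 / \<theta>)"
  have c: "1 \<le> c" using theta_pos by (simp add: c_def ge_one_powr_ge_zero)
  have "AE a :: real^'d^'m in lborel.
    eventually (\<lambda>k. no_cheap_cover s c (r k) a) sequentially"
    using r b(2) by (intro AE_no_cheap_covers[OF half True \<delta>(1) c]) auto
  then show ?thesis
  proof eventually_elim
    case (elim a)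
    then obtain k0 where k0: "\<forall>k\<ge>k0. no_cheap_cover s c (r k) a"
      unfolding eventually_sequentially by (rule exE)
    show ?case
    proof (rule intermediate_dim_greatest(2), rule ccontr)
      fix s' assume s': "0 \<le> s'" "lower_admissible s' (coding_map T a ` E)" "\<not> s \<le> s'"
      have "(1 / 2) ^ Suc (k0 + K) \<in> {0<..(1::real)}" by (simp add: power_le_one del: power_Suc)
      then obtain t \<U> where t: "t \<in> {0<..<(1 / 2) ^ Suc (k0 + K)}"
        and \<U>: "admissible_cover \<theta> t (coding_map T a ` E) \<U>" "cover_sum s' \<U> \<le> ennreal (1 / 2)"
        using s'(2)[unfolded lower_admissible_def, rule_format, of "1 / 2" "(1 / 2) ^ Suc (k0 + K)"] by auto
      have "(1 / 2 :: real) ^ Suc (k0 + K) \<le> 1" by (rule power_le_one) auto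
      then have t01: "0 < t" "t < 1" using t by auto
      obtain n where n: "t \<le> (1 / 2) ^ n" "(1 / 2) ^ n \<le> 2 * t"
        using dyadic_bracket[OF t01] by blast
      have "2 * t < (1 / 2) ^ (k0 + K)" using t by simp
      with n(2) have "(1 / 2) ^ n < (1 / 2 :: real) ^ (k0 + K)" by (rule le_less_trans)
      then have "k0 + K < n" by (rule power_strict_decreasing_iff[THEN iffD1, rotated 2]) auto
      then obtain k where k: "n = k + K" "k0 \<le> k" using that[of "n - K"] by simp
      have rk: "t \<le> r k" "r k \<le> 2 * t" using n by (simp_all add: r_def k(1))
      have "bounded U \<and> r k powr (1 / \<theta>) / c \<le> diameter U \<and> diameter U \<le> c * r k" if "U \<in> \<U>" for U
      proof -
        have U: "bounded U" "t powr (1 / \<theta>) \<le> diameter U" "diameter U \<le> t"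
          using \<U>(1) that by (auto simp: admissible_cover_def)
        have "r k powr (1 / \<theta>) \<le> (2 * t) powr (1 / \<theta>)"
          using rk(2) r(1)[of k] theta_pos by (intro powr_mono2) auto
        also have "\<dots> = c * t powr (1 / \<theta>)" using t01 by (simp add: powr_mult c_def)
        finally have "r k powr (1 / \<theta>) / c \<le> t powr (1 / \<theta>)" using c by (simp add: field_simps)
        moreover have "r k \<le> c * r k" using c r(1)[of k] by simp
        ultimately show ?thesis using U rk(1) by linarith
      qed
      then have "\<not> cover_sum s \<U> \<le> ennreal (1 / 2)"
        using k0[rule_format, OF k(2)] \<U>(1) by (simp add: admissible_cover_def no_cheap_cover_def)
      moreover have "cover_sum s \<U> \<le> ennreal (1 / 2)"
        using admissible_cover_sum_le[OF \<U>(1) t01 _ \<U>(2)] s'(3) by simp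
      ultimately show False by simp
    qed
  qed
qed

lemma AE_dims_ge:
  assumes half: "\<tau> < 1 / 2"
  shows "AE a :: real^'d^'m in lborel.
    lower_capacity_dim T \<theta> E \<le> lower_intermediate_dim \<theta> (coding_map T a ` E) \<and>
    upper_capacity_dim T \<theta> E \<le> upper_intermediate_dim \<theta> (coding_map T a ` E)"
proof -
  have limit: "x \<le> y" if "\<forall>n::nat. x - 1 / real (Suc n) \<le> y" for x y :: real
  proof (rule field_le_epsilon)
    fix e :: real assume "0 < e"
    then obtain n where "inverse (real (Suc n)) < e" using reals_Archimedean by blast
    then show "x \<le> y + e" using that[rule_format, of n] by (simp add: inverse_eq_divide)
  qed
  have "AE a :: real^'d^'m in lborel. \<forall>n::nat.
      lower_capacity_dim T \<theta> E - 1 / real (Suc n) \<le> lower_intermediate_dim \<theta> (coding_map T a ` E)"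
    unfolding AE_all_countable by (intro allI AE_lower_dim_ge[OF half]) simp
  moreover have "AE a :: real^'d^'m in lborel. \<forall>n::nat.
      upper_capacity_dim T \<theta> E - 1 / real (Suc n) \<le> upper_intermediate_dim \<theta> (coding_map T a ` E)"
    unfolding AE_all_countable by (intro allI AE_upper_dim_ge[OF half]) simp
  ultimately show ?thesis by eventually_elim (blast intro: limit)
qed

end

theorem theorem1p2:
  fixes T :: "'m::finite \<Rightarrow> real^'d^'d"
    and \<theta> :: real
    and E :: "(nat \<Rightarrow> 'm) set"
  assumes "\<And>j. invertible (T j)"
    and "\<And>j. onorm (\<lambda>x. T j *v x) < 1"
    and "0 < \<theta>" and "\<theta> \<le> 1"
    and "E \<noteq> {}"
  shows "(\<forall>a :: real^'d^'m.
            lower_intermediate_dim \<theta> (coding_map T a ` E) \<le> lower_capacity_dim T \<theta> E \<and>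
            upper_intermediate_dim \<theta> (coding_map T a ` E) \<le> upper_capacity_dim T \<theta> E) \<and>
         ((\<forall>j. onorm (\<lambda>x. T j *v x) < 1 / 2) \<longrightarrow>
            (AE a :: real^'d^'m in lebesgue.
               lower_intermediate_dim \<theta> (coding_map T a ` E) = lower_capacity_dim T \<theta> E \<and>
               upper_intermediate_dim \<theta> (coding_map T a ` E) = upper_capacity_dim T \<theta> E))"
proof -
  interpret affine_ifs_coding T \<theta> E
    using assms by unfold_locales
  have "AE a :: real^'d^'m in lebesgue.
      lower_intermediate_dim \<theta> (coding_map T a ` E) = lower_capacity_dim T \<theta> E \<and>
      upper_intermediate_dim \<theta> (coding_map T a ` E) = upper_capacity_dim T \<theta> E"
    if half: "\<forall>j. onorm (\<lambda>x. T j *v x) < 1 / 2"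
  proof (rule AE_completion)
    have "\<tau> < 1 / 2" using half tau_less_iff[of "1 / 2"] by blast
    from AE_dims_ge[OF this]
    show "AE a :: real^'d^'m in lborel.
      lower_intermediate_dim \<theta> (coding_map T a ` E) = lower_capacity_dim T \<theta> E \<and>
      upper_intermediate_dim \<theta> (coding_map T a ` E) = upper_capacity_dim T \<theta> E"
      by eventually_elim (use intermediate_dim_le_capacity_dim in \<open>blast intro: antisym\<close>)
  qed
  then show ?thesis using intermediate_dim_le_capacity_dim by blast
qed

end
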